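(* Let $2\le d\le 4$, let $\mathcal{O}\subset\mathbb{R}^d$ be a bounded domain with $C^2$ boundary, let $r=3$ and let $\mu,\beta>0$ satisfy $2\beta\mu\ge1$. Then the operator $\mathrm{G}(\cdot)=\mu\mathrm{A}+\mathrm{B}(\cdot)+\beta\mathcal{C}(\cdot):\mathbb{V}\cap\widetilde{\mathbb{L}}^{4}\to\mathbb{V}'+\widetilde{\mathbb{L}}^{\frac43}$ is globally monotone, that is, for all $\boldsymbol{u},\boldsymbol{v}\in\mathbb{V}$, $$\langle\mathrm{G}(\boldsymbol{u})-\mathrm{G}(\boldsymbol{v}),\boldsymbol{u}-\boldsymbol{v}\rangle\ge0.$$
   Context: Function spaces: $\mathcal{V}=\{\boldsymbol{u}\in C_0^\infty(\mathcal{O};\mathbb{R}^d):\nabla\cdot\boldsymbol{u}=0\}$. $\mathbb{V}$ and $\widetilde{\mathbb{L}}^4$ are the closures of $\mathcal{V}$ in $H_0^1(\mathcal{O};\mathbb{R}^d)$ and $L^4(\mathcal{O};\mathbb{R}^d)$, with norms $\|\boldsymbol u\|_{\mathbb V}=\|\nabla\boldsymbol u\|_{L^2}$ and $\|\boldsymbol u\|_{\widetilde{\mathbb L}^4}=\|\boldsymbol u\|_{L^4}$. Since $2\le d\le4$ and $\mathcal O$ is bounded, $\mathbb{V}\hookrightarrow\widetilde{\mathbb{L}}^4$. $\widetilde{\mathbb{L}}^{4/3}$ denotes the dual of $\widetilde{\mathbb{L}}^{4}$, $\mathbb{V}'+\widetilde{\mathbb{L}}^{4/3}$ is the dual of $\mathbb{V}\cap\widetilde{\mathbb{L}}^{4}$,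 and $\langle\cdot,\cdot\rangle$ is the duality pairing. Operators (as functionals): $\langle \mathrm{A}\boldsymbol{u},\boldsymbol{v}\rangle=\int_{\mathcal{O}}\nabla\boldsymbol{u}:\nabla\boldsymbol{v}\,dx$; $\langle\mathrm{B}(\boldsymbol u),\boldsymbol{w}\rangle=\int_{\mathcal{O}}(\boldsymbol{u}\cdot\nabla)\boldsymbol{u}\cdot\boldsymbol{w}\,dx=-\int_{\mathcal{O}}(\boldsymbol{u}\cdot\nabla)\boldsymbol{w}\cdot\boldsymbol{u}\,dx$; $\langle\mathcal{C}(\boldsymbol{u}),\boldsymbol{v}\rangle=\int_{\mathcal{O}}|\boldsymbol{u}|^{2}\boldsymbol{u}\cdot\boldsymbol{v}\,dx$. *)

theory Defs
  imports "HOL-Analysis.Analysis"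
begin

section \<open>Smooth functions, test fields and domains with \<open>C\<^sup>2\<close> boundary\<close>

text \<open>For open \<open>S\<close> the next predicate is the usual class \<open>C\<^sup>k(S)\<close>: all partial derivatives up to
  order \<open>k\<close> exist and are continuous.\<close>

primrec C_k_on :: "nat \<Rightarrow> 'a::euclidean_space set \<Rightarrow> ('a \<Rightarrow> 'b::real_normed_vector) \<Rightarrow> bool" where
  "C_k_on 0 S f \<longleftrightarrow> continuous_on S f"
| "C_k_on (Suc k) S f \<longleftrightarrow> f differentiable_on S \<and>
     (\<forall>b\<in>Basis. C_k_on k S (\<lambda>x. frechet_derivative f (at x) b))"

text \<open>\<open>C\<^sub>0\<^sup>\<infinity>(D)\<close>, with test functions extended by zero to the whole space.\<close>

definition test_functions :: "'a::euclidean_space set \<Rightarrow> ('a \<Rightarrow> 'b::real_normed_vector) set" where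
  "test_functions D = {\<phi>. (\<forall>k. C_k_on k UNIV \<phi>) \<and>
     compact (closure {x. \<phi> x \<noteq> 0}) \<and> closure {x. \<phi> x \<noteq> 0} \<subseteq> D}"

definition divergence :: "(real^'n \<Rightarrow> real^'n) \<Rightarrow> real^'n \<Rightarrow> real" where
  "divergence u x = trace (jacobian u (at x))"

definition solenoidal_tests :: "(real^'n) set \<Rightarrow> (real^'n \<Rightarrow> real^'n) set" where
  "solenoidal_tests D = {\<phi> \<in> test_functions D. \<forall>x. divergence \<phi> x = 0}"

text \<open>Near each boundary point, \<open>D\<close> is the strict epigraph of a \<open>C\<^sup>2\<close> function over the hyperplane
  orthogonal to some unit vector \<open>e\<close>. The graph function \<open>\<gamma>\<close> is given on the whole space, but only
  its values on that hyperplane, where \<open>x - (x \<bullet> e) *\<^sub>R e\<close> lies, are used.\<close>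

definition C2_boundary :: "'a::euclidean_space set \<Rightarrow> bool" where
  "C2_boundary D \<longleftrightarrow> (\<forall>x0\<in>frontier D. \<exists>r>0. \<exists>e. \<exists>\<gamma>::'a \<Rightarrow> real.
     norm e = 1 \<and> C_k_on 2 UNIV \<gamma> \<and>
     D \<inter> ball x0 r = {x \<in> ball x0 r. x \<bullet> e > \<gamma> (x - (x \<bullet> e) *\<^sub>R e)})"

section \<open>Function spaces\<close>

text \<open>Elements of Lebesgue and Sobolev spaces are represented by functions on the whole space;
  only their values almost everywhere in \<open>D\<close> matter. On matrices, \<open>norm\<close> and \<open>\<bullet>\<close> are the Frobenius
  norm and inner product.\<close>

definition Lp_space :: "real \<Rightarrow> 'a::euclidean_space set \<Rightarrow> ('a \<Rightarrow> 'b::euclidean_space) set" where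
  "Lp_space p D = {u \<in> borel_measurable (lebesgue_on D).
     integrable (lebesgue_on D) (\<lambda>x. norm (u x) powr p)}"

definition Lp_norm :: "real \<Rightarrow> 'a::euclidean_space set \<Rightarrow> ('a \<Rightarrow> 'b::euclidean_space) \<Rightarrow> real" where
  "Lp_norm p D u = (LINT x|lebesgue_on D. norm (u x) powr p) powr (1 / p)"

text \<open>The weak gradient is laid out as the Jacobian: the entry \<open>$ i $ j\<close> is the \<open>j\<close>-th partial
  derivative of the \<open>i\<close>-th component.\<close>

definition is_weak_gradient ::
  "(real^'n) set \<Rightarrow> (real^'n \<Rightarrow> real^'n) \<Rightarrow> (real^'n \<Rightarrow> real^'n^'n) \<Rightarrow> bool" where
  "is_weak_gradient D u Du \<longleftrightarrow> (\<forall>\<phi>\<in>test_functions D. \<forall>i j.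
     (LINT x|lebesgue_on D. u x $ i * frechet_derivative \<phi> (at x) (axis j 1)) =
     - (LINT x|lebesgue_on D. Du x $ i $ j * \<phi> x))"

definition H1 :: "(real^'n) set \<Rightarrow> (real^'n \<Rightarrow> real^'n) set" where
  "H1 D = {u \<in> Lp_space 2 D. \<exists>Du\<in>Lp_space 2 D. is_weak_gradient D u Du}"

text \<open>For \<open>u \<in> H1 D\<close> the choice below is unique up to equality almost everywhere in \<open>D\<close>.\<close>

definition weak_gradient :: "(real^'n) set \<Rightarrow> (real^'n \<Rightarrow> real^'n) \<Rightarrow> (real^'n \<Rightarrow> real^'n^'n)" where
  "weak_gradient D u = (SOME Du. Du \<in> Lp_space 2 D \<and> is_weak_gradient D u Du)"

definition H1_norm :: "(real^'n) set \<Rightarrow> (real^'n \<Rightarrow> real^'n) \<Rightarrow> real" where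
  "H1_norm D u = sqrt ((Lp_norm 2 D u)\<^sup>2 + (Lp_norm 2 D (weak_gradient D u))\<^sup>2)"

definition closure_in :: "('a \<Rightarrow> 'b::minus) set \<Rightarrow> (('a \<Rightarrow> 'b) \<Rightarrow> real) \<Rightarrow> ('a \<Rightarrow> 'b) set \<Rightarrow> ('a \<Rightarrow> 'b) set" where
  "closure_in X N S = {u \<in> X. \<forall>\<epsilon>>0. \<exists>\<phi>\<in>S. N (u - \<phi>) < \<epsilon>}"

definition H10 :: "(real^'n) set \<Rightarrow> (real^'n \<Rightarrow> real^'n) set" where
  "H10 D = closure_in (H1 D) (H1_norm D) (test_functions D)"

text \<open>By Poincare's inequality, on a bounded \<open>D\<close> the norms \<open>H1_norm D\<close> and \<open>V_norm D\<close> are equivalent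
  on \<open>H10 D\<close>, so either gives the same closure.\<close>

definition V_space :: "(real^'n) set \<Rightarrow> (real^'n \<Rightarrow> real^'n) set" where
  "V_space D = closure_in (H10 D) (H1_norm D) (solenoidal_tests D)"

definition V_norm :: "(real^'n) set \<Rightarrow> (real^'n \<Rightarrow> real^'n) \<Rightarrow> real" where
  "V_norm D u = Lp_norm 2 D (weak_gradient D u)"

definition L4_sol :: "(real^'n) set \<Rightarrow> (real^'n \<Rightarrow> real^'n) set" where
  "L4_sol D = closure_in (Lp_space 4 D) (Lp_norm 4 D) (solenoidal_tests D)"

text \<open>Bounded linear functionals on \<open>X\<close>, as functions whose values outside \<open>X\<close> are irrelevant.
  The bound makes them respect equality almost everywhere. The duality pairing of \<open>F\<close> with \<open>w\<close> is
  the application \<open>F w\<close>.\<close>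

definition dual_space ::
  "('a \<Rightarrow> 'b::real_vector) set \<Rightarrow> (('a \<Rightarrow> 'b) \<Rightarrow> real) \<Rightarrow> (('a \<Rightarrow> 'b) \<Rightarrow> real) set" where
  "dual_space X N = {F.
     (\<forall>v\<in>X. \<forall>w\<in>X. \<forall>a b. F (\<lambda>x. a *\<^sub>R v x + b *\<^sub>R w x) = a * F v + b * F w) \<and>
     (\<exists>C. \<forall>w\<in>X. \<bar>F w\<bar> \<le> C * N w)}"

text \<open>The space \<open>V' + L\<^sup>4\<^sup>/\<^sup>3\<close>, as the dual of \<open>V \<inter> L\<^sup>4\<close>.\<close>

definition V_L4_dual :: "(real^'n) set \<Rightarrow> ((real^'n \<Rightarrow> real^'n) \<Rightarrow> real) set" where
  "V_L4_dual D = dual_space (V_space D \<inter> L4_sol D) (\<lambda>w. V_norm D w + Lp_norm 4 D w)"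

section \<open>The operators\<close>

definition A_op :: "(real^'n) set \<Rightarrow> (real^'n \<Rightarrow> real^'n) \<Rightarrow> (real^'n \<Rightarrow> real^'n) \<Rightarrow> real" where
  "A_op D u v = (LINT x|lebesgue_on D. weak_gradient D u x \<bullet> weak_gradient D v x)"

definition B_op :: "(real^'n) set \<Rightarrow> (real^'n \<Rightarrow> real^'n) \<Rightarrow> (real^'n \<Rightarrow> real^'n) \<Rightarrow> real" where
  "B_op D u w = (LINT x|lebesgue_on D. (weak_gradient D u x *v u x) \<bullet> w x)"

definition C_op :: "(real^'n) set \<Rightarrow> (real^'n \<Rightarrow> real^'n) \<Rightarrow> (real^'n \<Rightarrow> real^'n) \<Rightarrow> real" where
  "C_op D u v = (LINT x|lebesgue_on D. (norm (u x))\<^sup>2 * (u x \<bullet> v x))"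

definition G_op ::
  "real \<Rightarrow> real \<Rightarrow> (real^'n) set \<Rightarrow> (real^'n \<Rightarrow> real^'n) \<Rightarrow> (real^'n \<Rightarrow> real^'n) \<Rightarrow> real" where
  "G_op \<mu> \<beta> D u = (\<lambda>w. \<mu> * A_op D u w + B_op D u w + \<beta> * C_op D u w)"

end

theory Submission
  imports Defs
begin

text \<open>Put \<open>w = u - v\<close> and \<open>s = (u + v)/2\<close>, so that \<open>B(u) - B(v)\<close> tested with \<open>w\<close> is
  \<open>b(w,s,w) + b(s,w,w)\<close>, where \<open>b(a,c,d)\<close> is the integral of \<open>(a \<cdot> \<nabla>)c \<cdot> d\<close>. On \<open>V\<close> the form \<open>b\<close> is skew
  in its last two arguments, so this equals \<open>-b(w,w,s)\<close>, and monotonicity becomes a pointwise inequality: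
  \<open>\<bar>(w \<cdot> \<nabla>)w \<cdot> s\<bar> \<le> \<bar>\<nabla>w\<bar> \<bar>w\<bar> \<bar>s\<bar>\<close> is absorbed by \<open>\<mu> \<bar>\<nabla>w\<bar>\<^sup>2\<close> and by
  \<open>(\<bar>u\<bar>\<^sup>2 u - \<bar>v\<bar>\<^sup>2 v) \<cdot> w \<ge> \<bar>w\<bar>\<^sup>2 \<bar>s\<bar>\<^sup>2\<close>.
  Skewness is the definition of the weak gradient for smooth solenoidal fields. It extends to \<open>V\<close> because in
  dimension at most four the \<open>H\<^sup>1\<close> norm of a test function controls its \<open>L\<^sup>4\<close> norm (Gagliardo-Nirenberg
  applied to the cube of the function), so that \<open>H\<^sup>1\<close> approximation by test fields is also \<open>L\<^sup>4\<close>
  approximation.\<close>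

text \<open>Two obstacles shape the proof. First, \<open>V_space\<close> is a closure in the
  \<open>H1_norm\<close> alone, whereas the trilinear form is continuous only when its two slots
  without a gradient are measured in L^4. Passing to limits therefore needs a Sobolev estimate, and
  dimension four is the borderline: there 4 is the critical exponent for square integrable
  gradients. Second, \<open>weak_gradient\<close> is a choice, hence linear only almost everywhere.
  Its uniqueness rests on the fundamental lemma of the calculus of variations, and that in turn on
  explicit smooth cutoffs of boxes.

  The midpoint s is preferred to v in the trilinear term because the cubic term is at least (|u|^2 +
  |v|^2) |w|^2 / 2. By convexity of the square this dominates |s|^2 |w|^2 with constant one, whereas
  against |v|^2 |w|^2 the constant would be one half.\<close>

section \<open>Powers of extended nonnegative reals and the inequality of Gagliardo and Nirenberg\<close>

text \<open>As for reals, \<open>ennreal_powr 0 0 = 0\<close>.\<close>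

definition ennreal_powr :: "ennreal \<Rightarrow> real \<Rightarrow> ennreal" where
  "ennreal_powr x p = (if x = top then top else ennreal (enn2real x powr p))"

lemma ennreal_powr_top [simp]: "ennreal_powr top p = top"
  by (simp add: ennreal_powr_def)

lemma ennreal_powr_ennreal: "0 \<le> a \<Longrightarrow> ennreal_powr (ennreal a) p = ennreal (a powr p)"
  by (simp add: ennreal_powr_def)

lemma ennreal_powr_0 [simp]: "ennreal_powr 0 p = 0"
  by (simp add: ennreal_powr_def)

lemma ennreal_powr_eq_0_iff [simp]: "ennreal_powr x p = 0 \<longleftrightarrow> x = 0"
  by (auto simp: ennreal_powr_def enn2real_eq_0_iff powr_def)

text \<open>No sign condition on the exponents: every power, also the zeroth and the negative ones,
  fixes \<open>0\<close> and \<open>top\<close>.\<close>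

lemma ennreal_powr_add: "ennreal_powr x p * ennreal_powr x q = ennreal_powr x (p + q)"
  by (cases "x = top") (auto simp: ennreal_powr_def powr_add ennreal_mult)

lemma ennreal_powr_mono: "x \<le> y \<Longrightarrow> 0 \<le> p \<Longrightarrow> ennreal_powr x p \<le> ennreal_powr y p"
  by (auto simp: ennreal_powr_def top_unique less_top[symmetric] intro!: ennreal_leI powr_mono2 enn2real_mono)

lemma measurable_ennreal_powr [measurable]:
  assumes [measurable]: "f \<in> borel_measurable M"
  shows "(\<lambda>x. ennreal_powr (f x) p) \<in> borel_measurable M"
  unfolding ennreal_powr_def by measurable

section \<open>Hoelder's inequality for several factors\<close>

lemma weighted_arith_geo_mean:
  fixes x p :: "'k \<Rightarrow> real"
  assumes "finite K" "\<And>k. k \<in> K \<Longrightarrow> 0 \<le> p k" "(\<Sum>k\<in>K. p k) = 1" "\<And>k. k \<in> K \<Longrightarrow> 0 \<le> x k"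
  shows "(\<Prod>k\<in>K. x k powr p k) \<le> (\<Sum>k\<in>K. p k * x k)"
proof (cases "\<exists>k\<in>K. x k = 0")
  case True
  \<comment> \<open>The product vanishes even if the exponent is zero, because
    \<open>0 powr 0 = 0\<close>.\<close>
  then have "(\<Prod>k\<in>K. x k powr p k) = 0"
    using assms(1) by (intro prod_zero) auto
  moreover have "0 \<le> (\<Sum>k\<in>K. p k * x k)"
    using assms by (intro sum_nonneg mult_nonneg_nonneg) auto
  ultimately show ?thesis by simp
next
  case False
  then have pos: "x k > 0" if "k \<in> K" for k
    using assms(4) that by (metis less_eq_real_def)
  have "(\<Prod>k\<in>K. x k powr p k) = exp (\<Sum>k\<in>K. p k *\<^sub>R ln (x k))"
    using assms(1) False by (auto simp: powr_def exp_sum intro!: prod.cong)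
  \<comment> \<open>Jensen's inequality for the convex function \<open>exp\<close> at the points
    \<open>ln (x k)\<close>.\<close>
  also have "\<dots> \<le> (\<Sum>k\<in>K. p k * exp (ln (x k)))"
    using convex_on_sum[OF assms(1) _ exp_convex assms(3)] assms by fastforce
  also have "\<dots> = (\<Sum>k\<in>K. p k * x k)"
    using pos by (auto intro!: sum.cong)
  finally show ?thesis .
qed

lemma prod_ennreal_top:
  fixes f :: "'k \<Rightarrow> ennreal"
  assumes "finite K" "k \<in> K" "f k = top" "\<And>k. k \<in> K \<Longrightarrow> f k \<noteq> 0"
  shows "(\<Prod>k\<in>K. f k) = top"
proof -
  have "(\<Prod>k\<in>K. f k) = f k * (\<Prod>k\<in>K - {k}. f k)"
    using assms(1,2) by (rule prod.remove)
  moreover have "(\<Prod>k\<in>K - {k}. f k) \<noteq> 0"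
    using assms by auto
  ultimately show ?thesis
    using assms(3) by (simp add: ennreal_top_mult)
qed

lemma nn_integral_Holder:
  fixes f :: "'k \<Rightarrow> 'a \<Rightarrow> ennreal"
  assumes K: "finite K" and p: "\<And>k. k \<in> K \<Longrightarrow> 0 \<le> p k" "(\<Sum>k\<in>K. p k) = 1"
    and f[measurable]: "\<And>k. k \<in> K \<Longrightarrow> f k \<in> borel_measurable M"
  shows "(\<integral>\<^sup>+x. (\<Prod>k\<in>K. ennreal_powr (f k x) (p k)) \<partial>M) \<le> (\<Prod>k\<in>K. ennreal_powr (\<integral>\<^sup>+x. f k x \<partial>M) (p k))"
proof -
  define A where "A k = (\<integral>\<^sup>+x. f k x \<partial>M)" for k
  consider (zero) k where "k \<in> K" "A k = 0" | (unbounded) k where "k \<in> K" "A k = top" "\<And>k. k \<in> K \<Longrightarrow> A k \<noteq> 0"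
    | (fin) "\<And>k. k \<in> K \<Longrightarrow> A k \<noteq> 0 \<and> A k \<noteq> top" by metis
  then show ?thesis
  proof cases
    case zero
    then have "AE x in M. f k x = 0"
      using f[OF zero(1)] unfolding A_def by (simp add: nn_integral_0_iff_AE)
    then have "AE x in M. (\<Prod>k\<in>K. ennreal_powr (f k x) (p k)) = 0"
    proof eventually_elim
      case (elim x)
      then show ?case using zero(1) K by (intro prod_zero) auto
    qed
    then have "(\<integral>\<^sup>+x. (\<Prod>k\<in>K. ennreal_powr (f k x) (p k)) \<partial>M) = (\<integral>\<^sup>+x. 0 \<partial>M)"
      by (intro nn_integral_cong_AE) auto
    then show ?thesis by simp
  next
    case unbounded
    then have "(\<Prod>k\<in>K. ennreal_powr (A k) (p k)) = top"
      by (intro prod_ennreal_top[OF K unbounded(1)]) auto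
    then show ?thesis by (simp add: A_def)
  next
    case fin
    define a where "a k = enn2real (A k)" for k
    have Aa: "A k = ennreal (a k)" "0 < a k" if "k \<in> K" for k
      using fin[OF that] by (auto simp: a_def enn2real_positive_iff less_top zero_less_iff_neq_zero)
    define P where "P = (\<Prod>k\<in>K. a k powr p k)"
    have P0: "0 \<le> P" unfolding P_def by (intro prod_nonneg) auto
    have "AE x in M. \<forall>k\<in>K. f k x \<noteq> top"
    proof (rule AE_finite_allI[OF K])
      fix k assume "k \<in> K"
      then show "AE x in M. f k x \<noteq> top"
        using nn_integral_PInf_AE[OF f[of k]] fin[of k] by (auto simp: A_def infinity_ennreal_def)
    qed
    then have "AE x in M. (\<Prod>k\<in>K. ennreal_powr (f k x) (p k)) \<le> ennreal P * (\<Sum>k\<in>K. ennreal (p k / a k) * f k x)"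
    proof eventually_elim
      case (elim x)
      define y where "y k = enn2real (f k x)" for k
      have y: "f k x = ennreal (y k)" "0 \<le> y k" if "k \<in> K" for k
        using elim that by (auto simp: y_def less_top)
      have "(\<Prod>k\<in>K. ennreal_powr (f k x) (p k)) = ennreal (\<Prod>k\<in>K. y k powr p k)"
        by (subst prod_ennreal[symmetric]) (auto simp: y ennreal_powr_ennreal intro!: prod.cong)
      also have "(\<Prod>k\<in>K. y k powr p k) = P * (\<Prod>k\<in>K. (y k / a k) powr p k)"
        unfolding P_def prod.distrib[symmetric]
      proof (rule prod.cong)
        fix k assume "k \<in> K"
        then show "y k powr p k = a k powr p k * (y k / a k) powr p k"
          using Aa(2)[of k] y(2)[of k] by (simp flip: powr_mult)
      qed simp
      also have "ennreal \<dots> \<le> ennreal (P * (\<Sum>k\<in>K. p k * (y k / a k)))"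
        using Aa(2) y(2) p P0
        by (intro ennreal_leI mult_left_mono weighted_arith_geo_mean K) (auto intro!: divide_nonneg_pos)
      also have "\<dots> = ennreal P * (\<Sum>k\<in>K. ennreal (p k * (y k / a k)))"
        using Aa(2) y(2) p P0
        by (subst sum_ennreal) (auto simp: ennreal_mult intro!: sum_nonneg ennreal_mult divide_nonneg_pos mult_nonneg_nonneg)
      also have "(\<Sum>k\<in>K. ennreal (p k * (y k / a k))) = (\<Sum>k\<in>K. ennreal (p k / a k) * f k x)"
      proof (rule sum.cong)
        fix k assume k: "k \<in> K"
        show "ennreal (p k * (y k / a k)) = ennreal (p k / a k) * f k x"
          unfolding y(1)[OF k] using Aa(2)[OF k] y(2)[OF k] p(1)[OF k]
          by (subst ennreal_mult[symmetric]) auto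
      qed simp
      finally show ?case .
    qed
    then have "(\<integral>\<^sup>+x. (\<Prod>k\<in>K. ennreal_powr (f k x) (p k)) \<partial>M)
      \<le> (\<integral>\<^sup>+x. ennreal P * (\<Sum>k\<in>K. ennreal (p k / a k) * f k x) \<partial>M)"
      by (rule nn_integral_mono_AE)
    also have "\<dots> = ennreal P * (\<Sum>k\<in>K. ennreal (p k / a k) * A k)"
      by (simp add: nn_integral_cmult nn_integral_sum A_def)
    also have "(\<Sum>k\<in>K. ennreal (p k / a k) * A k) = (\<Sum>k\<in>K. ennreal (p k))"
    proof (rule sum.cong)
      fix k assume k: "k \<in> K"
      show "ennreal (p k / a k) * A k = ennreal (p k)"
        unfolding Aa(1)[OF k] using Aa(2)[OF k] p(1)[OF k]
        by (subst ennreal_mult[symmetric]) auto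
    qed simp
    also have "\<dots> = 1"
      using p by (subst sum_ennreal) auto
    also have "ennreal P * 1 = (\<Prod>k\<in>K. ennreal_powr (A k) (p k))"
    proof -
      have "(\<Prod>k\<in>K. ennreal_powr (A k) (p k)) = (\<Prod>k\<in>K. ennreal (a k powr p k))"
        using Aa by (intro prod.cong) (auto simp: ennreal_powr_ennreal less_imp_le)
      then show ?thesis by (simp add: P_def prod_ennreal)
    qed
    finally show ?thesis unfolding A_def .
  qed
qed

text \<open>Hoelder's inequality in the variable \<open>x i\<close> turns the left-hand side into the same expression
  for \<open>I - {i}\<close> and the function obtained from \<open>f\<close> by integrating out \<open>x i\<close>.\<close>

lemma grid_inequality:
  fixes f :: "('i \<Rightarrow> real) \<Rightarrow> ennreal"
  assumes "finite I" "card I \<le> 4" "f \<in> borel_measurable (Pi\<^sub>M I (\<lambda>_. lborel))"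
  shows "(\<integral>\<^sup>+x. ennreal_powr (f x) ((4 - real (card I)) / 3)
      * (\<Prod>j\<in>I. ennreal_powr (\<integral>\<^sup>+t. f (x(j := t)) \<partial>lborel) (1/3)) \<partial>Pi\<^sub>M I (\<lambda>_. lborel))
    \<le> ennreal_powr (\<integral>\<^sup>+x. f x \<partial>Pi\<^sub>M I (\<lambda>_. lborel)) (4/3)"
  using assms
proof (induction I arbitrary: f rule: finite_induct)
  case empty
  \<comment> \<open>Without variables the exponent on the left is 4/3 as well, and the measure is a
    unit point mass.\<close>
  then show ?case by (simp add: PiM_empty nn_integral_count_space_finite)
next
  case (insert i I)
  interpret product_sigma_finite "\<lambda>_::'i. lborel::real measure" by standard
  let ?P = "Pi\<^sub>M I (\<lambda>_. lborel::real measure)" and ?Q = "Pi\<^sub>M (insert i I) (\<lambda>_. lborel::real measure)"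
  note [measurable] = insert.prems(2)
  have cI: "card I \<le> 3" and cI': "card (insert i I) = Suc (card I)" using insert by auto
  define g where "g x = (\<integral>\<^sup>+y. f (x(i := y)) \<partial>lborel)" for x
  have upd[measurable]: "(\<lambda>(x, y). x(i := y)) \<in> measurable (?P \<Otimes>\<^sub>M lborel) ?Q"
    by measurable
  have fupd[measurable]: "(\<lambda>(x, y). f (x(i := y))) \<in> borel_measurable (?P \<Otimes>\<^sub>M lborel)"
    using measurable_compose[OF upd insert.prems(2)] by (simp add: split_beta')
  have g[measurable]: "g \<in> borel_measurable ?P"
    unfolding g_def by measurable
  have Qupd[measurable]: "(\<lambda>(x, y). f (x(j := y))) \<in> borel_measurable (?Q \<Otimes>\<^sub>M lborel)" if "j \<in> insert i I" for j
  proof -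
    have "(\<lambda>(x, y). x(j := y)) \<in> measurable (?Q \<Otimes>\<^sub>M lborel) ?Q"
      unfolding split_beta' using that
      by (intro measurable_fun_upd[where J="insert i I"]) auto
    from measurable_compose[OF this insert.prems(2)] show ?thesis
      by (simp only: split_beta')
  qed
  define h where "h x = ennreal_powr (f x) ((4 - real (card (insert i I))) / 3)
      * (\<Prod>j\<in>insert i I. ennreal_powr (\<integral>\<^sup>+t. f (x(j := t)) \<partial>lborel) (1/3))" for x
  have h[measurable]: "h \<in> borel_measurable ?Q"
    unfolding h_def by measurable
  have "(\<integral>\<^sup>+x. h x \<partial>?Q) = (\<integral>\<^sup>+x. \<integral>\<^sup>+y. h (x(i := y)) \<partial>lborel \<partial>?P)"
    using insert.hyps by (intro product_nn_integral_insert h) auto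
  also have "\<dots> \<le> (\<integral>\<^sup>+x. ennreal_powr (g x) ((4 - real (card I)) / 3)
      * (\<Prod>j\<in>I. ennreal_powr (\<integral>\<^sup>+t. g (x(j := t)) \<partial>lborel) (1/3)) \<partial>?P)"
  proof (rule nn_integral_mono)
    fix x assume x: "x \<in> space ?P"
    \<comment> \<open>As a function of \<open>y\<close>, the factor belonging to \<open>i\<close>
      itself is the constant \<open>ennreal_powr (g x) (1/3)\<close>. The other factors are a power
      of \<open>f\<close> with exponent (3 - card I)/3 and card I line integrals with exponent 1/3
      each, so the exponents sum to one and Hoelder's inequality applies. The integral of
      \<open>f\<close> in \<open>y\<close> is again \<open>g x\<close>; together with the constant
      factor it reaches the exponent (4 - card I)/3 that the induction hypothesis asks for.\<close>
    define F where "F k y = (if k = i then f (x(i := y)) else (\<integral>\<^sup>+t. f (x(i := y, k := t)) \<partial>lborel))" for k y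
    define q where "q k = (if k = i then (3 - real (card I)) / 3 else 1/3)" for k
    have xi[measurable]: "(\<lambda>y. x(i := y)) \<in> measurable lborel ?Q"
      using measurable_component_update[OF x insert.hyps(2)] by simp
    have xik: "(\<lambda>(y,t). f (x(i := y, k := t))) \<in> borel_measurable (lborel \<Otimes>\<^sub>M lborel)" if "k \<in> I" for k
    proof -
      have "(\<lambda>(y, t). (x(i := y), t)) \<in> measurable (lborel \<Otimes>\<^sub>M lborel) (?Q \<Otimes>\<^sub>M lborel)"
        by measurable
      from measurable_compose[OF this Qupd[of k]] that show ?thesis by (simp add: split_beta')
    qed
    have F: "F k \<in> borel_measurable lborel" if "k \<in> insert i I" for k
    proof (cases "k = i")
      case True
      then show ?thesis unfolding F_def by (simp add: xi measurable_compose[OF xi insert.prems(2)])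
    next
      case False
      then have [measurable]: "(\<lambda>(y,t). f (x(i := y, k := t))) \<in> borel_measurable (lborel \<Otimes>\<^sub>M lborel)"
        using xik that by auto
      show ?thesis using False unfolding F_def by simp
    qed
    have sq: "(\<Sum>k\<in>insert i I. q k) = 1"
    proof -
      have "(\<Sum>k\<in>I. q k) = (\<Sum>k\<in>I. 1/3)"
        using insert.hyps by (intro sum.cong) (auto simp: q_def)
      then show ?thesis using insert.hyps by (simp add: q_def field_simps)
    qed
    have eq: "h (x(i := y)) = ennreal_powr (g x) (1/3) * (\<Prod>k\<in>insert i I. ennreal_powr (F k y) (q k))" for y
    proof -
      have "(\<Prod>k\<in>I. ennreal_powr (F k y) (q k)) = (\<Prod>j\<in>I. ennreal_powr (\<integral>\<^sup>+t. f (x(i := y, j := t)) \<partial>lborel) (1/3))"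
        using insert.hyps by (intro prod.cong) (auto simp: F_def q_def)
      then show ?thesis
        using insert.hyps unfolding h_def cI' by (simp add: F_def q_def g_def mult_ac)
    qed
    have "(\<integral>\<^sup>+y. h (x(i := y)) \<partial>lborel)
        = ennreal_powr (g x) (1/3) * (\<integral>\<^sup>+y. (\<Prod>k\<in>insert i I. ennreal_powr (F k y) (q k)) \<partial>lborel)"
      unfolding eq by (intro nn_integral_cmult borel_measurable_prod_ennreal measurable_ennreal_powr F)
    also have "\<dots> \<le> ennreal_powr (g x) (1/3) * (\<Prod>k\<in>insert i I. ennreal_powr (\<integral>\<^sup>+y. F k y \<partial>lborel) (q k))"
      using insert.hyps sq F cI by (intro mult_left_mono nn_integral_Holder) (auto simp: q_def)
    also have "(\<Prod>k\<in>insert i I. ennreal_powr (\<integral>\<^sup>+y. F k y \<partial>lborel) (q k))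
      = ennreal_powr (g x) ((3 - real (card I)) / 3) * (\<Prod>k\<in>I. ennreal_powr (\<integral>\<^sup>+y. F k y \<partial>lborel) (q k))"
      using insert.hyps by (simp add: F_def q_def g_def)
    also have "(\<Prod>k\<in>I. ennreal_powr (\<integral>\<^sup>+y. F k y \<partial>lborel) (q k)) = (\<Prod>j\<in>I. ennreal_powr (\<integral>\<^sup>+t. g (x(j := t)) \<partial>lborel) (1/3))"
    proof (rule prod.cong)
      fix k assume k: "k \<in> I"
      then have ki: "k \<noteq> i" using insert.hyps by auto
      have "(\<integral>\<^sup>+y. F k y \<partial>lborel) = (\<integral>\<^sup>+y. \<integral>\<^sup>+t. f (x(i := y, k := t)) \<partial>lborel \<partial>lborel)"
        using ki by (simp add: F_def)
      also have "\<dots> = (\<integral>\<^sup>+t. \<integral>\<^sup>+y. f (x(i := y, k := t)) \<partial>lborel \<partial>lborel)"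
        using lborel_pair.Fubini'[OF xik[OF k]] by simp
      also have "\<dots> = (\<integral>\<^sup>+t. g (x(k := t)) \<partial>lborel)"
        unfolding g_def using ki by (simp add: fun_upd_twist)
      finally show "ennreal_powr (\<integral>\<^sup>+y. F k y \<partial>lborel) (q k) = ennreal_powr (\<integral>\<^sup>+t. g (x(k := t)) \<partial>lborel) (1/3)"
        using ki by (simp add: q_def)
    qed simp
    also have "ennreal_powr (g x) (1/3) * (ennreal_powr (g x) ((3 - real (card I)) / 3)
        * (\<Prod>j\<in>I. ennreal_powr (\<integral>\<^sup>+t. g (x(j := t)) \<partial>lborel) (1/3)))
      = ennreal_powr (g x) ((4 - real (card I)) / 3) * (\<Prod>j\<in>I. ennreal_powr (\<integral>\<^sup>+t. g (x(j := t)) \<partial>lborel) (1/3))"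
      by (simp add: mult.assoc[symmetric] ennreal_powr_add add_divide_distrib[symmetric])
    finally show "(\<integral>\<^sup>+y. h (x(i := y)) \<partial>lborel) \<le> ennreal_powr (g x) ((4 - real (card I)) / 3)
      * (\<Prod>j\<in>I. ennreal_powr (\<integral>\<^sup>+t. g (x(j := t)) \<partial>lborel) (1/3))" .
  qed
  also have "\<dots> \<le> ennreal_powr (\<integral>\<^sup>+x. g x \<partial>?P) (4/3)"
    using cI by (intro insert.IH g) auto
  also have "(\<integral>\<^sup>+x. g x \<partial>?P) = (\<integral>\<^sup>+x. f x \<partial>?Q)"
    unfolding g_def using insert.hyps by (intro product_nn_integral_insert[symmetric]) auto
  finally show ?case unfolding h_def .
qed

text \<open>In the application \<open>g = \<bar>w\<bar> + \<bar>\<nabla>w\<bar>\<close>. The summand \<open>\<bar>w\<bar>\<close> makes the exponent \<open>4/3\<close> available in every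
  dimension up to four.\<close>

lemma gagliardo_nirenberg:
  fixes w g :: "'a::euclidean_space \<Rightarrow> real"
  assumes "DIM('a) \<le> 4"
    and w: "w \<in> borel_measurable borel" and g: "g \<in> borel_measurable borel"
    and wg: "\<And>x. \<bar>w x\<bar> \<le> g x"
    and line: "\<And>x b. b \<in> Basis \<Longrightarrow> ennreal \<bar>w x\<bar> \<le> (\<integral>\<^sup>+t. ennreal (g (x + (t - x \<bullet> b) *\<^sub>R b)) \<partial>lborel)"
  shows "(\<integral>\<^sup>+x. ennreal (\<bar>w x\<bar> powr (4/3)) \<partial>lborel) \<le> ennreal_powr (\<integral>\<^sup>+x. ennreal (g x) \<partial>lborel) (4/3)"
proof -
  let ?P = "Pi\<^sub>M (Basis::'a set) (\<lambda>_. lborel::real measure)"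
  define T :: "('a \<Rightarrow> real) \<Rightarrow> 'a" where "T f = (\<Sum>b\<in>Basis. f b *\<^sub>R b)" for f
  have T[measurable]: "T \<in> measurable ?P borel"
    unfolding T_def by measurable
  note [measurable] = w g
  have leb: "lborel = distr ?P borel T" unfolding lborel_eq[where 'a='a] T_def ..
  have Tb: "T f \<bullet> b = f b" if "b \<in> Basis" for f b
    unfolding T_def using that by simp
  \<comment> \<open>The point in the hypothesis \<open>line\<close> is \<open>x\<close> with its
    coordinate along \<open>b\<close> replaced by \<open>t\<close>. So its line integrals are
    integrals over a single factor of the product measure.\<close>
  have Tupd: "T (f(b := t)) = T f + (t - T f \<bullet> b) *\<^sub>R b" if "b \<in> Basis" for f b t
  proof (rule euclidean_eqI)
    fix c :: 'a assume c: "c \<in> Basis"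
    show "T (f(b := t)) \<bullet> c = (T f + (t - T f \<bullet> b) *\<^sub>R b) \<bullet> c"
      unfolding inner_add_left inner_scaleR_left Tb[OF c] Tb[OF that] inner_Basis[OF that c] by simp
  qed
  define F where "F f = ennreal (g (T f))" for f
  have F[measurable]: "F \<in> borel_measurable ?P" unfolding F_def by measurable
  have "(\<integral>\<^sup>+x. ennreal (\<bar>w x\<bar> powr (4/3)) \<partial>lborel) = (\<integral>\<^sup>+f. ennreal (\<bar>w (T f)\<bar> powr (4/3)) \<partial>?P)"
    unfolding leb by (subst nn_integral_distr) auto
  also have "\<dots> \<le> (\<integral>\<^sup>+f. ennreal_powr (F f) ((4 - real (card (Basis::'a set))) / 3)
      * (\<Prod>j\<in>Basis. ennreal_powr (\<integral>\<^sup>+t. F (f(j := t)) \<partial>lborel) (1/3)) \<partial>?P)"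
  proof (rule nn_integral_mono)
    fix f
    let ?w = "ennreal \<bar>w (T f)\<bar>"
    have "ennreal (\<bar>w (T f)\<bar> powr (4/3)) = ennreal_powr ?w (4/3)"
      by (simp add: ennreal_powr_ennreal)
    \<comment> \<open>With d the dimension, 4/3 is (4 - d)/3 plus d times 1/3. The first power is
      bounded pointwise by \<open>g\<close>, each of the d others by the integral of
      \<open>g\<close> along one coordinate line.\<close>
    also have "\<dots> = ennreal_powr ?w ((4 - real (card (Basis::'a set))) / 3) * ennreal_powr ?w (real (card (Basis::'a set)) / 3)"
      by (simp add: ennreal_powr_add add_divide_distrib[symmetric])
    also have "ennreal_powr ?w (real (card (Basis::'a set)) / 3) = (\<Prod>j\<in>(Basis::'a set). ennreal_powr ?w (1/3))"
      by (cases "w (T f) = 0") (simp_all add: ennreal_powr_ennreal ennreal_power powr_power)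
    also have "ennreal_powr ?w ((4 - real (card (Basis::'a set))) / 3) * (\<Prod>j\<in>(Basis::'a set). ennreal_powr ?w (1/3))
      \<le> ennreal_powr (F f) ((4 - real (card (Basis::'a set))) / 3)
      * (\<Prod>j\<in>Basis. ennreal_powr (\<integral>\<^sup>+t. F (f(j := t)) \<partial>lborel) (1/3))"
    proof (rule mult_mono)
      show "ennreal_powr ?w ((4 - real (card (Basis::'a set))) / 3) \<le> ennreal_powr (F f) ((4 - real (card (Basis::'a set))) / 3)"
        using assms(1) wg by (intro ennreal_powr_mono) (auto simp: F_def intro!: ennreal_leI)
      show "(\<Prod>j\<in>(Basis::'a set). ennreal_powr ?w (1/3)) \<le> (\<Prod>j\<in>Basis. ennreal_powr (\<integral>\<^sup>+t. F (f(j := t)) \<partial>lborel) (1/3))"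
        using line by (intro prod_mono_ennreal ennreal_powr_mono) (auto simp: F_def Tupd)
    qed auto
    finally show "ennreal (\<bar>w (T f)\<bar> powr (4/3)) \<le> ennreal_powr (F f) ((4 - real (card (Basis::'a set))) / 3)
      * (\<Prod>j\<in>Basis. ennreal_powr (\<integral>\<^sup>+t. F (f(j := t)) \<partial>lborel) (1/3))" .
  qed
  also have "\<dots> \<le> ennreal_powr (\<integral>\<^sup>+f. F f \<partial>?P) (4/3)"
    using assms(1) by (intro grid_inequality F) auto
  also have "(\<integral>\<^sup>+f. F f \<partial>?P) = (\<integral>\<^sup>+x. ennreal (g x) \<partial>lborel)"
    unfolding leb F_def by (subst nn_integral_distr) auto
  finally show ?thesis .
qed

section \<open>Smooth functions and cutoffs\<close>

lemma C_k_on_SucD: "C_k_on (Suc k) S f \<Longrightarrow> C_k_on k S f"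
  by (induction k arbitrary: f) (auto intro: differentiable_imp_continuous_on)

lemma C_k_on_has_derivative:
  assumes "C_k_on (Suc k) UNIV f"
  shows "(f has_derivative frechet_derivative f (at x)) (at x)"
  using assms by (simp add: differentiable_on_def frechet_derivative_works)

text \<open>Makes inductions on \<open>k\<close> possible with an explicit candidate for the
  derivative, which uniqueness identifies with \<open>frechet_derivative\<close>.\<close>

lemma C_k_on_SucI:
  assumes "\<And>x. (f has_derivative f' x) (at x)" "\<And>b. b \<in> Basis \<Longrightarrow> C_k_on k UNIV (\<lambda>x. f' x b)"
  shows "C_k_on (Suc k) UNIV f"
proof -
  have "f' = (\<lambda>x. frechet_derivative f (at x))"
    by (intro ext frechet_derivative_at assms(1))
  moreover have "f differentiable_on UNIV"
    unfolding differentiable_on_def using differentiableI[OF assms(1)] by simp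
  ultimately show ?thesis
    using assms(2) by simp
qed

lemma C_k_on_const: "C_k_on k UNIV (\<lambda>x. c)"
  by (induction k arbitrary: c) (auto simp: differentiable_on_def)

lemma C_k_on_bounded_linear:
  assumes "bounded_linear L" "C_k_on k UNIV f"
  shows "C_k_on k UNIV (\<lambda>x. L (f x))"
  using assms(2)
proof (induction k arbitrary: f)
  case 0
  then show ?case using assms(1) by (simp add: bounded_linear.continuous_on)
next
  case (Suc k)
  show ?case
  proof (rule C_k_on_SucI)
    show "((\<lambda>x. L (f x)) has_derivative (\<lambda>h. L (frechet_derivative f (at x) h))) (at x)" for x
      using bounded_linear.has_derivative[OF assms(1) C_k_on_has_derivative[OF Suc.prems]] .
    show "C_k_on k UNIV (\<lambda>x. L (frechet_derivative f (at x) b))" if "b \<in> Basis" for b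
      by (rule Suc.IH) (use Suc.prems that in simp_all)
  qed
qed

lemma C_k_on_add:
  assumes "C_k_on k UNIV f" "C_k_on k UNIV g"
  shows "C_k_on k UNIV (\<lambda>x. f x + g x)"
  using assms
proof (induction k arbitrary: f g)
  case 0
  then show ?case by (auto intro: continuous_on_add)
next
  case (Suc k)
  show ?case
  proof (rule C_k_on_SucI)
    show "((\<lambda>x. f x + g x) has_derivative (\<lambda>h. frechet_derivative f (at x) h + frechet_derivative g (at x) h)) (at x)" for x
      using has_derivative_add[OF C_k_on_has_derivative[OF Suc.prems(1)] C_k_on_has_derivative[OF Suc.prems(2)]] .
    show "C_k_on k UNIV (\<lambda>x. frechet_derivative f (at x) b + frechet_derivative g (at x) b)" if "b \<in> Basis" for b
      by (rule Suc.IH) (use Suc.prems that in simp_all)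
  qed
qed

lemma C_k_on_diff:
  assumes "C_k_on k UNIV f" "C_k_on k UNIV g"
  shows "C_k_on k UNIV (\<lambda>x. f x - g x)"
  using C_k_on_add[OF assms(1) C_k_on_bounded_linear[OF bounded_linear_minus[OF bounded_linear_ident] assms(2)]]
  by simp

lemma C_k_on_mult:
  fixes f g :: "'a::euclidean_space \<Rightarrow> real"
  assumes "C_k_on k UNIV f" "C_k_on k UNIV g"
  shows "C_k_on k UNIV (\<lambda>x. f x * g x)"
  using assms
proof (induction k arbitrary: f g)
  case 0
  then show ?case by (auto intro: continuous_on_mult)
next
  case (Suc k)
  show ?case
  proof (rule C_k_on_SucI)
    show "((\<lambda>x. f x * g x) has_derivative (\<lambda>h. f x * frechet_derivative g (at x) h + frechet_derivative f (at x) h * g x)) (at x)" for x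
      using has_derivative_mult[OF C_k_on_has_derivative[OF Suc.prems(1)] C_k_on_has_derivative[OF Suc.prems(2)]] .
    show "C_k_on k UNIV (\<lambda>x. f x * frechet_derivative g (at x) b + frechet_derivative f (at x) b * g x)" if "b \<in> Basis" for b
      using Suc.prems that by (intro C_k_on_add Suc.IH C_k_on_SucD[OF Suc.prems(1)] C_k_on_SucD[OF Suc.prems(2)]) auto
  qed
qed

lemma C_k_on_prod:
  fixes f :: "'k \<Rightarrow> 'a::euclidean_space \<Rightarrow> real"
  assumes "\<And>j. j \<in> J \<Longrightarrow> C_k_on k UNIV (f j)"
  shows "C_k_on k UNIV (\<lambda>x. \<Prod>j\<in>J. f j x)"
  using assms by (induction J rule: infinite_finite_induct) (auto intro: C_k_on_const C_k_on_mult)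

text \<open>An affine inner map has constant derivative, so a partial derivative is a constant times
  \<open>h'\<close> at the same affine argument and the induction closes without a general chain
  rule.\<close>

lemma C_k_on_compose_affine:
  fixes h :: "real \<Rightarrow> real" and c :: "'a::euclidean_space"
  assumes "C_k_on k UNIV h"
  shows "C_k_on k UNIV (\<lambda>x. h (x \<bullet> c + d))"
  using assms
proof (induction k arbitrary: h)
  case 0
  have "continuous_on UNIV (\<lambda>x. h (x \<bullet> c + d))"
    by (rule continuous_on_compose2[where s=UNIV and t=UNIV and g=h]) (use 0 in \<open>auto intro!: continuous_intros\<close>)
  then show ?case by simp
next
  case (Suc k)
  show ?case
  proof (rule C_k_on_SucI)
    have 1: "((\<lambda>x. x \<bullet> c + d) has_derivative (\<lambda>v. v \<bullet> c)) (at x)" for x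
      by (auto intro!: derivative_eq_intros)
    have 2: "(h has_derivative (\<lambda>s. s * frechet_derivative h (at t) 1)) (at t)" for t
    proof -
      have 3: "(h has_derivative frechet_derivative h (at t)) (at t)"
        by (rule C_k_on_has_derivative[OF Suc.prems])
      have "frechet_derivative h (at t) = (\<lambda>s. s * frechet_derivative h (at t) 1)"
      proof
        show "frechet_derivative h (at t) s = s * frechet_derivative h (at t) 1" for s
          using linear_scale[OF has_derivative_linear[OF 3], of s 1] by simp
      qed
      with 3 show ?thesis by metis
    qed
    show "((\<lambda>x. h (x \<bullet> c + d)) has_derivative (\<lambda>v. (v \<bullet> c) * frechet_derivative h (at (x \<bullet> c + d)) 1)) (at x)" for x
      by (rule has_derivative_compose[OF 1 2])
    have "C_k_on k UNIV (\<lambda>t. frechet_derivative h (at t) 1)"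
      using Suc.prems by simp
    from C_k_on_mult[OF C_k_on_const Suc.IH[OF this]]
    show "C_k_on k UNIV (\<lambda>x. (b \<bullet> c) * frechet_derivative h (at (x \<bullet> c + d)) 1)" for b .
  qed
qed

text \<open>The factors \<open>(1 / t) ^ m\<close> make the family closed under differentiation.\<close>

definition exp_cutoff :: "real \<Rightarrow> nat \<Rightarrow> real \<Rightarrow> real" where
  "exp_cutoff c m t = (if t > 0 then (1 / t) ^ m * exp (- c / t) else 0)"

text \<open>From the right, the substitution s = c / t turns the claim into the decay of s^m / exp s
  at infinity; the factor \<open>(1 / c) ^ m\<close> undoes the rescaling.\<close>

lemma exp_cutoff_tendsto_0:
  assumes "c > 0"
  shows "(exp_cutoff c m \<longlongrightarrow> 0) (at 0)"
proof (rule filterlim_split_at_real)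
  show "(exp_cutoff c m \<longlongrightarrow> 0) (at_left 0)"
    by (rule tendsto_eventually) (auto simp: exp_cutoff_def eventually_at_filter)
  have "filterlim (\<lambda>t::real. c / t) at_top (at_right 0)"
    unfolding divide_inverse
    by (rule filterlim_tendsto_pos_mult_at_top[OF tendsto_const assms filterlim_inverse_at_top_right])
  from filterlim_compose[OF tendsto_power_div_exp_0[of m] this]
  have "((\<lambda>t. (1 / c) ^ m * ((c / t) ^ m / exp (c / t))) \<longlongrightarrow> (1 / c) ^ m * 0) (at_right 0)"
    by (intro tendsto_intros)
  then have "((\<lambda>t. (1 / c) ^ m * ((c / t) ^ m / exp (c / t))) \<longlongrightarrow> 0) (at_right 0)" by simp
  then show "(exp_cutoff c m \<longlongrightarrow> 0) (at_right 0)"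
  proof (rule Lim_transform_eventually)
    show "\<forall>\<^sub>F t in at_right 0. (1 / c) ^ m * ((c / t) ^ m / exp (c / t)) = exp_cutoff c m t"
      using assms
      by (simp add: eventually_at_filter exp_cutoff_def exp_minus divide_inverse power_mult_distrib power_inverse)
  qed
qed

lemma exp_cutoff_has_derivative:
  assumes "c > 0"
  shows "(exp_cutoff c m has_real_derivative
    c * exp_cutoff c (Suc (Suc m)) t - m * exp_cutoff c (Suc m) t) (at t)"
proof (cases t "0::real" rule: linorder_cases)
  case less
  have "((\<lambda>_. 0) has_real_derivative 0) (at t)" by simp
  then have "(exp_cutoff c m has_real_derivative 0) (at t)"
    by (rule has_field_derivative_transform_within_open[where S="{..<0}"])
      (use less in \<open>auto simp: exp_cutoff_def\<close>)
  then show ?thesis using less by (simp add: exp_cutoff_def)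
next
  case equal
  \<comment> \<open>At the origin the difference quotient of one member of the family is exactly the
    next member, whose limit is already known.\<close>
  have "((\<lambda>h. (exp_cutoff c m (0 + h) - exp_cutoff c m 0) / h) \<longlongrightarrow> 0) (at 0)"
    using exp_cutoff_tendsto_0[OF assms, of "Suc m"]
  proof (rule Lim_transform_eventually)
    show "\<forall>\<^sub>F h in at 0. exp_cutoff c (Suc m) h = (exp_cutoff c m (0 + h) - exp_cutoff c m 0) / h"
      by (auto simp: eventually_at_filter exp_cutoff_def)
  qed
  then show ?thesis
    unfolding equal DERIV_def by (simp add: exp_cutoff_def)
next
  case greater
  have "((\<lambda>t. (1 / t) ^ m * exp (- c / t)) has_real_derivative
    c * ((1 / t) ^ (Suc (Suc m)) * exp (- c / t)) - m * ((1 / t) ^ Suc m * exp (- c / t))) (at t)"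
  proof -
    have 1: "((\<lambda>t. 1 / t) has_real_derivative - ((1 / t) ^ 2)) (at t)"
      using greater by (auto intro!: derivative_eq_intros simp: field_simps power2_eq_square)
    have "((\<lambda>t. (1 / t) ^ m) has_real_derivative - (m * (1 / t) ^ Suc m)) (at t)"
      using DERIV_power[OF 1, of m] by (cases m) (simp_all add: power2_eq_square mult_ac)
    moreover have "((\<lambda>t. exp (- c / t)) has_real_derivative exp (- c / t) * (c * (1 / t) ^ 2)) (at t)"
      using DERIV_chain2[OF DERIV_exp DERIV_cmult[OF 1, of "- c"]] by simp
    ultimately show ?thesis
      by (auto dest: DERIV_mult simp: power2_eq_square algebra_simps)
  qed
  then have "(exp_cutoff c m has_real_derivative
    c * ((1 / t) ^ (Suc (Suc m)) * exp (- c / t)) - m * ((1 / t) ^ Suc m * exp (- c / t))) (at t)"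
    by (rule has_field_derivative_transform_within_open[where S="{0<..}"])
      (use greater in \<open>auto simp: exp_cutoff_def\<close>)
  then show ?thesis using greater by (simp add: exp_cutoff_def)
qed

lemma C_k_on_exp_cutoff:
  assumes "c > 0"
  shows "C_k_on k UNIV (exp_cutoff c m)"
proof (induction k arbitrary: m)
  case 0
  have "continuous_on UNIV (exp_cutoff c m)"
    using exp_cutoff_has_derivative[OF assms] by (intro DERIV_continuous_on) auto
  then show ?case by simp
next
  case (Suc k)
  show ?case
  proof (rule C_k_on_SucI)
    show "(exp_cutoff c m has_derivative
      (\<lambda>h. (c * exp_cutoff c (Suc (Suc m)) t - m * exp_cutoff c (Suc m) t) * h)) (at t)" for t
      using exp_cutoff_has_derivative[OF assms, of m t] by (simp add: has_field_derivative_def)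
    show "C_k_on k UNIV (\<lambda>t. (c * exp_cutoff c (Suc (Suc m)) t - m * exp_cutoff c (Suc m) t) * b)" for b
      by (intro C_k_on_mult C_k_on_diff C_k_on_const Suc.IH)
  qed
qed

section \<open>The class of test functions\<close>

lemma test_functionsI:
  assumes "\<And>k. C_k_on k UNIV f" "compact K" "K \<subseteq> D" "\<And>x. x \<notin> K \<Longrightarrow> f x = 0"
  shows "f \<in> test_functions D"
proof -
  have "closure {x. f x \<noteq> 0} \<subseteq> K"
    using assms by (intro closure_minimal compact_imp_closed) auto
  moreover from this have "compact (closure {x. f x \<noteq> 0})"
    using compact_Int_closed[OF assms(2) closed_closure, of "{x. f x \<noteq> 0}"] by (simp add: Int_absorb1)
  ultimately show ?thesis
    using assms by (auto simp: test_functions_def)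
qed

text \<open>The complement of the closed support is open, so off it the derivative vanishes together
  with the function.\<close>

lemma test_functionsE:
  assumes "f \<in> test_functions D"
  obtains K where "compact K" "K \<subseteq> D" "\<And>x. x \<notin> K \<Longrightarrow> f x = 0"
    "\<And>x. x \<notin> K \<Longrightarrow> frechet_derivative f (at x) = (\<lambda>h. 0)"
proof -
  define K where "K = closure {x. f x \<noteq> 0}"
  have K: "compact K" "K \<subseteq> D" and "closed K"
    using assms by (simp_all add: test_functions_def K_def)
  have 0: "f x = 0" if "x \<notin> K" for x
    using that closure_subset[of "{x. f x \<noteq> 0}"] unfolding K_def by blast
  have "frechet_derivative f (at x) = (\<lambda>h. 0)" if "x \<notin> K" for x
  proof -
    have "(f has_derivative (\<lambda>h. 0)) (at x)"
    proof (rule has_derivative_transform_within_open)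
      show "((\<lambda>_. 0) has_derivative (\<lambda>h. 0)) (at x)" by simp
      show "open (- K)" using \<open>closed K\<close> by (rule open_Compl)
      show "x \<in> - K" using that by simp
    qed (simp add: 0)
    then show ?thesis by (rule frechet_derivative_at[symmetric])
  qed
  with K 0 show ?thesis by (rule that)
qed

lemma test_functions_C_k: "f \<in> test_functions D \<Longrightarrow> C_k_on k UNIV f"
  by (simp add: test_functions_def)

lemma test_functions_add:
  assumes "f \<in> test_functions D" "g \<in> test_functions D"
  shows "(\<lambda>x. f x + g x) \<in> test_functions D"
proof -
  obtain K where K: "compact K" "K \<subseteq> D" "\<And>x. x \<notin> K \<Longrightarrow> f x = 0" by (rule test_functionsE[OF assms(1)]) (rule that)
  obtain L where L: "compact L" "L \<subseteq> D" "\<And>x. x \<notin> L \<Longrightarrow> g x = 0" by (rule test_functionsE[OF assms(2)]) (rule that)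
  show ?thesis
    by (rule test_functionsI[where K="K \<union> L"]) (use K L assms in \<open>auto intro!: C_k_on_add simp: test_functions_C_k\<close>)
qed

lemma test_functions_bounded_linear:
  assumes "bounded_linear L" "f \<in> test_functions D"
  shows "(\<lambda>x. L (f x)) \<in> test_functions D"
proof -
  obtain K where K: "compact K" "K \<subseteq> D" "\<And>x. x \<notin> K \<Longrightarrow> f x = 0" by (rule test_functionsE[OF assms(2)]) (rule that)
  show ?thesis
    by (rule test_functionsI[OF C_k_on_bounded_linear[OF assms(1) test_functions_C_k[OF assms(2)]] K(1,2)])
      (simp add: K(3) linear_0[OF bounded_linear.linear[OF assms(1)]])
qed

lemma test_functions_mult:
  fixes f g :: "'a::euclidean_space \<Rightarrow> real"
  assumes "f \<in> test_functions D" "\<And>k. C_k_on k UNIV g"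
  shows "(\<lambda>x. f x * g x) \<in> test_functions D"
proof -
  obtain K where K: "compact K" "K \<subseteq> D" "\<And>x. x \<notin> K \<Longrightarrow> f x = 0" by (rule test_functionsE[OF assms(1)]) (rule that)
  show ?thesis
    by (rule test_functionsI[OF _ K(1,2)]) (use K assms in \<open>auto intro!: C_k_on_mult simp: test_functions_C_k\<close>)
qed

text \<open>A tensor product of one-dimensional bumps. Lowering the rate \<open>1 / Suc n\<close> in
  the exponent pushes each bump up to the indicator of its open interval, with values in [0, 1] and
  a support independent of \<open>n\<close>. The arguments are written as inner product plus
  constant, with \<open>- j\<close> for the right end, to match
  \<open>C_k_on_compose_affine\<close>.\<close>

definition box_cutoff :: "'a::euclidean_space \<Rightarrow> 'a \<Rightarrow> nat \<Rightarrow> 'a \<Rightarrow> real" where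
  "box_cutoff a b n x = (\<Prod>j\<in>Basis. exp_cutoff (1 / real (Suc n)) 0 (x \<bullet> j + - (a \<bullet> j))
     * exp_cutoff (1 / real (Suc n)) 0 (x \<bullet> (- j) + b \<bullet> j))"

lemma exp_cutoff_0_bounds: "0 < c \<Longrightarrow> 0 \<le> exp_cutoff c 0 t \<and> exp_cutoff c 0 t \<le> 1"
  by (auto simp: exp_cutoff_def)

lemma box_cutoff_bounds: "0 \<le> box_cutoff a b n x" "box_cutoff a b n x \<le> 1"
  unfolding box_cutoff_def
  by (auto intro!: prod_nonneg prod_le_1 mult_nonneg_nonneg mult_le_one simp: exp_cutoff_0_bounds)

lemma box_cutoff_eq_0:
  assumes "x \<notin> box a b"
  shows "box_cutoff a b n x = 0"
proof -
  obtain j where "j \<in> Basis" "\<not> (a \<bullet> j < x \<bullet> j \<and> x \<bullet> j < b \<bullet> j)"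
    using assms by (auto simp: mem_box)
  then show ?thesis
    unfolding box_cutoff_def by (intro prod_zero) (auto simp: exp_cutoff_def intro!: bexI[of _ j])
qed

lemma box_cutoff_test_function:
  assumes "cbox a b \<subseteq> D"
  shows "box_cutoff a b n \<in> test_functions D"
proof (rule test_functionsI[OF _ compact_cbox assms])
  show "C_k_on k UNIV (box_cutoff a b n)" for k
    unfolding box_cutoff_def
    by (intro C_k_on_prod C_k_on_mult C_k_on_compose_affine C_k_on_exp_cutoff) auto
  show "box_cutoff a b n x = 0" if "x \<notin> cbox a b" for x
    using that box_subset_cbox[of a b] by (intro box_cutoff_eq_0) auto
qed

lemma box_cutoff_tendsto: "(\<lambda>n. box_cutoff a b n x) \<longlonglongrightarrow> indicator (box a b) x"
proof (cases "x \<in> box a b")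
  case False
  then show ?thesis by (simp add: box_cutoff_eq_0)
next
  case True
  have lim: "(\<lambda>n. exp_cutoff (1 / real (Suc n)) 0 t) \<longlonglongrightarrow> 1" if "t > 0" for t
  proof -
    have "(\<lambda>n. exp (- (1 / real (Suc n)) / t)) \<longlonglongrightarrow> exp (- 0 / t)"
      by (intro tendsto_intros LIMSEQ_inverse_real_of_nat[unfolded inverse_eq_divide]) (use that in auto)
    then show ?thesis using that by (simp add: exp_cutoff_def)
  qed
  have "(\<lambda>n. box_cutoff a b n x) \<longlonglongrightarrow> (\<Prod>j\<in>(Basis::'a set). 1 * 1)"
    unfolding box_cutoff_def using True
    by (intro tendsto_prod tendsto_mult lim) (auto simp: mem_box)
  then show ?thesis using True by simp
qed

section \<open>The fundamental lemma of the calculus of variations\<close>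

lemma line_has_real_derivative:
  fixes h :: "'a::euclidean_space \<Rightarrow> real"
  assumes "C_k_on (Suc 0) UNIV h"
  shows "((\<lambda>t. h (x + t *\<^sub>R b)) has_real_derivative frechet_derivative h (at (x + t *\<^sub>R b)) b) (at t)"
proof -
  have 1: "((\<lambda>t. x + t *\<^sub>R b) has_derivative (\<lambda>s. s *\<^sub>R b)) (at t)"
    by (auto intro!: derivative_eq_intros)
  note 2 = C_k_on_has_derivative[OF assms, of "x + t *\<^sub>R b"]
  have 3: "frechet_derivative h (at (x + t *\<^sub>R b)) (s *\<^sub>R b) = frechet_derivative h (at (x + t *\<^sub>R b)) b * s" for s
    using linear_scale[OF has_derivative_linear[OF 2], of s b] by simp
  show ?thesis
    using has_derivative_compose[OF 1 2] unfolding has_field_derivative_def 3 .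
qed

lemma integrable_lborel_compact_support:
  fixes f :: "'a::euclidean_space \<Rightarrow> 'b::{banach, second_countable_topology}"
  assumes "continuous_on UNIV f" "compact K" "\<And>x. x \<notin> K \<Longrightarrow> f x = 0"
  shows "integrable lborel f"
proof -
  have "(\<lambda>x. indicator K x *\<^sub>R f x) = f"
    using assms(3) by (auto simp: indicator_def)
  then show ?thesis
    using borel_integrable_compact[OF assms(2) continuous_on_subset[OF assms(1)]] by simp
qed

lemma bounded_compact_support:
  fixes f :: "'a::euclidean_space \<Rightarrow> real"
  assumes "continuous_on UNIV f" "compact K" "\<And>x. x \<notin> K \<Longrightarrow> f x = 0"
  obtains B where "0 \<le> B" "\<And>x. \<bar>f x\<bar> \<le> B"
proof -
  have "bounded (f ` K)"
    using assms by (intro compact_imp_bounded compact_continuous_image) (auto intro: continuous_on_subset)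
  then obtain B where "\<And>x. x \<in> K \<Longrightarrow> \<bar>f x\<bar> \<le> B"
    by (auto simp: bounded_iff)
  then have "\<bar>f x\<bar> \<le> max B 0" for x
    using assms(3) by (cases "x \<in> K") (auto simp: le_max_iff_disj)
  then show ?thesis by (intro that[of "max B 0"]) auto
qed

text \<open>Difference quotients of \<open>h\<close> have integral zero by translation invariance of
  Lebesgue measure. They converge pointwise to the derivative and, by the mean value theorem, are
  bounded by its supremum. Steps of length at most one keep all of them inside the ball of radius
  \<open>R + 1\<close>, so dominated convergence applies.\<close>

lemma integral_frechet_derivative_eq_0:
  fixes h :: "'a::euclidean_space \<Rightarrow> real"
  assumes h: "h \<in> test_functions UNIV" and b: "b \<in> Basis"
  shows "(LINT x|lborel. frechet_derivative h (at x) b) = 0"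
proof -
  define d where "d x = frechet_derivative h (at x) b" for x
  obtain K where K: "compact K" "\<And>x. x \<notin> K \<Longrightarrow> h x = 0" "\<And>x. x \<notin> K \<Longrightarrow> d x = 0"
    unfolding d_def by (rule test_functionsE[OF h]) auto
  have C1: "C_k_on (Suc 0) UNIV h" using h by (rule test_functions_C_k)
  have ch: "continuous_on UNIV h" using test_functions_C_k[OF h, of 0] by simp
  have cd: "continuous_on UNIV d" using C1 b by (simp add: d_def)
  obtain B where B: "0 \<le> B" "\<And>x. \<bar>d x\<bar> \<le> B" 
    using bounded_compact_support[OF cd K(1) K(3)] by metis
  obtain R where R: "\<And>x. x \<in> K \<Longrightarrow> norm x \<le> R"
    using compact_imp_bounded[OF K(1)] by (auto simp: bounded_iff)
  define \<delta> where "\<delta> n = 1 / real (Suc n)" for n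
  have \<delta>: "0 < \<delta> n" "\<delta> n \<le> 1" for n by (auto simp: \<delta>_def)
  define q where "q n x = (h (x + \<delta> n *\<^sub>R b) - h x) / \<delta> n" for n x
  have mh: "h \<in> borel_measurable borel" using ch by (rule borel_measurable_continuous_onI)
  have ih: "integrable lborel h" by (rule integrable_lborel_compact_support[OF ch K(1,2)])
  have shift: "integrable lborel (\<lambda>x. h (x + c))" "(LINT x|lborel. h (x + c)) = (LINT x|lborel. h x)" for c
  proof -
    have "integrable (distr lborel borel ((+) c)) h" "integral\<^sup>L (distr lborel borel ((+) c)) h = integral\<^sup>L lborel h"
      using ih by (simp_all add: lborel_distr_plus)
    then show "integrable lborel (\<lambda>x. h (x + c))" "(LINT x|lborel. h (x + c)) = (LINT x|lborel. h x)"
      using mh by (auto simp: integrable_distr_eq integral_distr add.commute)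
  qed
  have q0: "(LINT x|lborel. q n x) = 0" for n
    unfolding q_def using shift ih by simp
  have bound: "\<bar>q n x\<bar> \<le> indicator (cball 0 (R + 1)) x * B" for n x
  proof (cases "x \<in> cball 0 (R + 1)")
    case True
    have "\<exists>z. 0 < z \<and> z < \<delta> n \<and> h (x + \<delta> n *\<^sub>R b) - h (x + 0 *\<^sub>R b) = (\<delta> n - 0) * d (x + z *\<^sub>R b)"
      unfolding d_def using \<delta> by (intro MVT2 line_has_real_derivative C1) auto
    then obtain z where "q n x = d (x + z *\<^sub>R b)"
      unfolding q_def using \<delta>[of n] by auto
    then show ?thesis using True B by simp
  next
    case False
    then have "norm x > R + 1" by (simp add: dist_norm)
    moreover have "norm (x + \<delta> n *\<^sub>R b) \<ge> norm x - norm (\<delta> n *\<^sub>R b)"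
      by (metis norm_diff_ineq)
    moreover have "norm (\<delta> n *\<^sub>R b) \<le> 1" using \<delta>[of n] b by simp
    ultimately have "x \<notin> K" "x + \<delta> n *\<^sub>R b \<notin> K"
      using R[of x] R[of "x + \<delta> n *\<^sub>R b"] by auto
    then show ?thesis using K(2) B(1) by (simp add: q_def)
  qed
  have \<delta>0: "\<delta> \<longlonglongrightarrow> 0"
    unfolding \<delta>_def using LIMSEQ_inverse_real_of_nat by (simp add: inverse_eq_divide)
  have lim: "(\<lambda>n. q n x) \<longlonglongrightarrow> d x" for x
  proof -
    have "((\<lambda>s. (h (x + (0 + s) *\<^sub>R b) - h (x + 0 *\<^sub>R b)) / s) \<longlongrightarrow> d (x + 0 *\<^sub>R b)) (at 0)"
      using line_has_real_derivative[OF C1, of x b 0] unfolding DERIV_def d_def .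
    moreover have "filterlim \<delta> (at 0) sequentially"
      unfolding filterlim_at using \<delta>0 \<delta>(1) by (simp add: less_imp_neq[symmetric])
    ultimately have "(\<lambda>n. (h (x + (0 + \<delta> n) *\<^sub>R b) - h (x + 0 *\<^sub>R b)) / \<delta> n) \<longlonglongrightarrow> d (x + 0 *\<^sub>R b)"
      by (rule filterlim_compose)
    then show ?thesis by (simp add: q_def)
  qed
  have "(\<lambda>n. LINT x|lborel. q n x) \<longlonglongrightarrow> (LINT x|lborel. d x)"
  proof (rule integral_dominated_convergence)
    show "d \<in> borel_measurable lborel" using borel_measurable_continuous_onI[OF cd] by simp
    show "q n \<in> borel_measurable lborel" for n unfolding q_def using mh by measurable
    show "integrable lborel (\<lambda>x::'a. indicator (cball 0 (R + 1)) x * B)"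
      using borel_integrable_compact[of "cball 0 (R + 1)" "\<lambda>_. B"] by (simp add: continuous_on_const)
    show "AE x in lborel. (\<lambda>n. q n x) \<longlonglongrightarrow> d x" using lim by simp
    show "AE x in lborel. norm (q n x) \<le> indicator (cball 0 (R + 1)) x * B" for n using bound by simp
  qed
  then have "(\<lambda>n. 0) \<longlonglongrightarrow> (LINT x|lborel. d x)" unfolding q0 .
  then show ?thesis unfolding d_def using LIMSEQ_const_iff by metis
qed

text \<open>Boxes form an intersection-stable generator of the Borel sets, so the integral of
  \<open>g\<close> vanishes over every Borel set; the hypothesis \<open>g0\<close> starts the
  complement step, the whole space not being a box. Applied to the sets where \<open>g\<close> is
  positive and where it is negative, this forces \<open>g\<close> to vanish almost
  everywhere.\<close>

lemma AE_eq_0_if_box_integrals_eq_0: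
  fixes g :: "'a::euclidean_space \<Rightarrow> real"
  assumes g: "integrable lebesgue g" and g0: "(LINT x|lebesgue. g x) = 0"
    and box0: "\<And>a b. (LINT x:box a b|lebesgue. g x) = 0"
  shows "AE x in lebesgue. g x = 0"
proof -
  have si: "set_integrable lebesgue A g" if "A \<in> sets borel" for A
    using g that unfolding set_integrable_def by (intro integrable_mult_indicator) auto
  let ?G = "range (\<lambda>(a, b). box a b :: 'a set)"
  have sets: "sigma_sets UNIV ?G = sets borel"
    unfolding borel_eq_box by simp
  have zero: "(LINT x:A|lebesgue. g x) = 0" if "A \<in> sets borel" for A
  proof -
    have "Int_stable ?G" by (auto simp: Int_stable_def box_Int_box)
    moreover have "?G \<subseteq> Pow UNIV" by simp
    moreover have "A \<in> sigma_sets UNIV ?G" using that sets by simp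
    ultimately show ?thesis
    proof (induction rule: sigma_sets_induct_disjoint)
      case (basic A)
      then show ?case using box0 by auto
    next
      case empty
      then show ?case by (simp add: set_lebesgue_integral_def)
    next
      case (compl A)
      then have A: "A \<in> sets borel" using sets by simp
      have "(LINT x:UNIV|lebesgue. g x) = (LINT x:A|lebesgue. g x) + (LINT x:UNIV - A|lebesgue. g x)"
        using set_integral_Un[of A "UNIV - A" lebesgue g] si A by simp
      then show ?case using compl g0 by (simp add: set_lebesgue_integral_def)
    next
      case (union A)
      then have A: "A i \<in> sets borel" for i using sets by auto
      have "(LINT x:(\<Union>i. A i)|lebesgue. g x) = (\<Sum>i. LINT x:A i|lebesgue. g x)"
        using A union(1) by (intro lebesgue_integral_countable_add si) (auto simp: disjoint_family_on_def)
      then show ?case using union by simp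
    qed
  qed
  \<comment> \<open>\<open>g\<close> is only Lebesgue measurable, and its sign sets need not be
    Borel. Those of the representative \<open>g'\<close> are.\<close>
  obtain g' where g': "g' \<in> borel_measurable lborel" "AE x in lborel. g x = g' x"
    using completion_ex_borel_measurable_real[of g lborel] g by auto
  have part: "AE x in lebesgue. \<not> 0 < s * g x" if "s \<in> {1, -1::real}" for s
  proof -
    define A where "A = {x. 0 < s * g' x}"
    have A: "A \<in> sets borel" unfolding A_def using g'(1) by measurable
    have ae: "AE x in lebesgue. g x = g' x" using g'(2) by (rule AE_completion)
    have ii: "integrable lebesgue (\<lambda>x. s * (indicator A x *\<^sub>R g x))"
      using si[OF A] unfolding set_integrable_def by simp
    have "AE x in lebesgue. 0 \<le> s * (indicator A x *\<^sub>R g x)"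
      using ae by eventually_elim (auto simp: A_def indicator_def)
    from integral_nonneg_eq_0_iff_AE[OF ii this]
    have "AE x in lebesgue. s * (indicator A x *\<^sub>R g x) = 0"
      using zero[OF A] unfolding set_lebesgue_integral_def by simp
    with ae show ?thesis
      by eventually_elim (auto simp: A_def indicator_def split: if_splits)
  qed
  have "AE x in lebesgue. \<not> 0 < g x" "AE x in lebesgue. \<not> g x < 0"
    using part[of 1] part[of "-1"] by auto
  then show ?thesis
    by eventually_elim auto
qed

text \<open>Testing with box cutoffs and passing to the limit by dominated convergence gives zero
  integral over the interior of each closed box contained in \<open>D\<close>. Every box inside such
  a box is covered as well, so the zero extension \<open>F\<close> vanishes almost everywhere on it.
  Countably many closed boxes exhaust the open set \<open>D\<close>.\<close>

lemma fundamental_lemma_calculus_of_variations: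
  fixes f :: "'a::euclidean_space \<Rightarrow> real"
  assumes "open D" and f: "integrable (lebesgue_on D) f"
    and test: "\<And>\<phi>. \<phi> \<in> test_functions D \<Longrightarrow> (LINT x|lebesgue_on D. f x * \<phi> x) = 0"
  shows "AE x in lebesgue_on D. f x = 0"
proof -
  have D: "D \<inter> space lebesgue \<in> sets lebesgue" using \<open>open D\<close> by auto
  define F where "F x = indicator D x * f x" for x
  have F: "integrable lebesgue F"
    using f integrable_restrict_space[OF D, of f] unfolding F_def[abs_def] by simp
  have Ftest: "(LINT x|lebesgue. F x * \<phi> x) = 0" if "\<phi> \<in> test_functions D" for \<phi>
    using test[OF that] integral_restrict_space[OF D, of "\<lambda>x. f x * \<phi> x"] by (simp add: F_def mult.assoc)
  have box: "(LINT x|lebesgue. F x * indicator (box a b) x) = 0" if ab: "cbox a b \<subseteq> D" for a b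
  proof -
    have "(\<lambda>n. LINT x|lebesgue. F x * box_cutoff a b n x) \<longlonglongrightarrow> (LINT x|lebesgue. F x * indicator (box a b) x)"
    proof (rule integral_dominated_convergence)
      have [measurable]: "F \<in> borel_measurable lebesgue" using F by auto
      show "(\<lambda>x. F x * indicator (box a b) x) \<in> borel_measurable lebesgue"
        by (intro borel_measurable_times borel_measurable_indicator) auto
      show "(\<lambda>x. F x * box_cutoff a b n x) \<in> borel_measurable lebesgue" for n
      proof -
        have "continuous_on UNIV (box_cutoff a b n)"
          using test_functions_C_k[OF box_cutoff_test_function[OF ab], of 0 n] by simp
        from borel_measurable_continuous_onI[OF this]
        have "box_cutoff a b n \<in> borel_measurable lebesgue" by (intro measurable_completion) simp
        then show ?thesis by (intro borel_measurable_times) auto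
      qed
      show "integrable lebesgue (\<lambda>x. norm (F x))" using F by (rule integrable_norm)
      show "AE x in lebesgue. (\<lambda>n. F x * box_cutoff a b n x) \<longlonglongrightarrow> F x * indicator (box a b) x"
        by (intro AE_I2 tendsto_intros box_cutoff_tendsto)
      show "AE x in lebesgue. norm (F x * box_cutoff a b n x) \<le> norm (F x)" for n
        using box_cutoff_bounds[of a b n] by (intro AE_I2) (auto simp: abs_mult intro!: mult_left_le)
    qed
    then have "(\<lambda>n. 0) \<longlonglongrightarrow> (LINT x|lebesgue. F x * indicator (box a b) x)"
      using Ftest box_cutoff_test_function[OF ab] by simp
    then show ?thesis using LIMSEQ_const_iff by metis
  qed
  have cboxae: "AE x in lebesgue. x \<in> cbox c d \<longrightarrow> F x = 0" if cd: "cbox c d \<subseteq> D" for c d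
  proof -
    have "AE x in lebesgue. F x * indicator (box c d) x = 0"
    proof (rule AE_eq_0_if_box_integrals_eq_0)
      show "integrable lebesgue (\<lambda>x. F x * indicator (box c d) x)"
        using integrable_mult_indicator[OF _ F, of "box c d"] by (simp add: mult.commute)
      show "(LINT x|lebesgue. F x * indicator (box c d) x) = 0" by (rule box[OF cd])
      fix a b :: 'a
      \<comment> \<open>The corners of the intersection of \<open>box a b\<close> with
        \<open>box c d\<close>, which is again a box whose closure stays in
        \<open>D\<close>.\<close>
      let ?a = "\<Sum>i\<in>Basis. max (a\<bullet>i) (c\<bullet>i) *\<^sub>R i" and ?b = "\<Sum>i\<in>Basis. min (b\<bullet>i) (d\<bullet>i) *\<^sub>R i"
      have "cbox ?a ?b \<subseteq> cbox c d" by (auto simp: mem_box)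
      then have "(LINT x|lebesgue. F x * indicator (box ?a ?b) x) = 0" using cd by (intro box) auto
      then show "(LINT x:box a b|lebesgue. F x * indicator (box c d) x) = 0"
        unfolding set_lebesgue_integral_def box_Int_box[symmetric]
        by (simp add: indicator_inter_arith mult_ac)
    qed
    moreover have "AE x in lebesgue. x \<notin> cbox c d - box c d"
      using negligible_frontier_interval[of c d] by (intro AE_not_in) (simp add: negligible_iff_null_sets)
    ultimately show ?thesis
      by eventually_elim (auto simp: indicator_def split: if_splits)
  qed
  obtain \<D> where \<D>: "countable \<D>" "\<D> \<subseteq> Pow D" "\<And>X. X \<in> \<D> \<Longrightarrow> \<exists>a b. X = cbox a b" "\<Union>\<D> = D"
    using open_countable_Union_open_cbox[OF \<open>open D\<close>] by metis
  have "AE x in lebesgue. \<forall>X\<in>\<D>. x \<in> X \<longrightarrow> F x = 0"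
    unfolding AE_ball_countable[OF \<D>(1)] using \<D>(2,3) cboxae by blast
  then have "AE x in lebesgue. x \<in> D \<longrightarrow> f x = 0"
  proof (eventually_elim, intro impI)
    fix x assume "\<forall>X\<in>\<D>. x \<in> X \<longrightarrow> F x = 0" "x \<in> D"
    then have "F x = 0" using \<D>(4) by blast
    then show "f x = 0" using \<open>x \<in> D\<close> by (simp add: F_def)
  qed
  then show ?thesis
    unfolding AE_restrict_space_iff[OF D] .
qed

section \<open>The Sobolev inequality for test functions\<close>

lemma Cauchy_Schwarz_integral:
  fixes f g :: "'a \<Rightarrow> real"
  assumes [measurable]: "f \<in> borel_measurable M" "g \<in> borel_measurable M"
    and f2: "integrable M (\<lambda>x. (f x)\<^sup>2)" and g2: "integrable M (\<lambda>x. (g x)\<^sup>2)"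
  shows "integrable M (\<lambda>x. f x * g x)"
    and "(LINT x|M. \<bar>f x * g x\<bar>) \<le> sqrt (LINT x|M. (f x)\<^sup>2) * sqrt (LINT x|M. (g x)\<^sup>2)"
proof -
  show i: "integrable M (\<lambda>x. f x * g x)"
  proof (rule Bochner_Integration.integrable_bound)
    show "integrable M (\<lambda>x. (f x)\<^sup>2 + (g x)\<^sup>2)" using f2 g2 by simp
    have "\<bar>f x * g x\<bar> \<le> (f x)\<^sup>2 + (g x)\<^sup>2" for x
    proof -
      have "0 \<le> (\<bar>f x\<bar> - \<bar>g x\<bar>)\<^sup>2" by simp
      then have "2 * (\<bar>f x\<bar> * \<bar>g x\<bar>) \<le> (f x)\<^sup>2 + (g x)\<^sup>2" by (simp add: power2_diff)
      moreover have "0 \<le> \<bar>f x\<bar> * \<bar>g x\<bar>" by simp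
      ultimately show ?thesis unfolding abs_mult by linarith
    qed
    then show "AE x in M. norm (f x * g x) \<le> norm ((f x)\<^sup>2 + (g x)\<^sup>2)" by (auto simp: abs_mult)
  qed simp
  let ?A = "LINT x|M. (f x)\<^sup>2" and ?B = "LINT x|M. (g x)\<^sup>2" and ?C = "LINT x|M. \<bar>f x * g x\<bar>"
  have "(\<integral>\<^sup>+x. ennreal \<bar>f x\<bar> * ennreal \<bar>g x\<bar> \<partial>M)\<^sup>2
    \<le> (\<integral>\<^sup>+x. (ennreal \<bar>f x\<bar>)\<^sup>2 \<partial>M) * (\<integral>\<^sup>+x. (ennreal \<bar>g x\<bar>)\<^sup>2 \<partial>M)"
    by (rule Cauchy_Schwarz_nn_integral) measurable
  moreover have "(\<integral>\<^sup>+x. ennreal \<bar>f x\<bar> * ennreal \<bar>g x\<bar> \<partial>M) = ennreal ?C"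
    using integrable_abs[OF i] by (subst nn_integral_eq_integral[symmetric]) (auto simp: ennreal_mult abs_mult)
  moreover have "(\<integral>\<^sup>+x. (ennreal \<bar>f x\<bar>)\<^sup>2 \<partial>M) = ennreal ?A" "(\<integral>\<^sup>+x. (ennreal \<bar>g x\<bar>)\<^sup>2 \<partial>M) = ennreal ?B"
    using f2 g2 by (subst nn_integral_eq_integral[symmetric]; simp add: ennreal_power)+
  ultimately have "ennreal (?C\<^sup>2) \<le> ennreal (?A * ?B)"
    by (simp add: ennreal_power ennreal_mult)
  then have "?C\<^sup>2 \<le> ?A * ?B" by (subst (asm) ennreal_le_iff) auto
  then have "sqrt (?C\<^sup>2) \<le> sqrt (?A * ?B)" by (rule real_sqrt_le_mono)
  then show "?C \<le> sqrt ?A * sqrt ?B" by (simp add: real_sqrt_mult)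
qed

text \<open>The fundamental theorem of calculus along the line through \<open>x\<close> in direction
  \<open>b\<close>, started at a point where the function vanishes.\<close>

lemma test_function_le_line_integral:
  fixes w :: "'a::euclidean_space \<Rightarrow> real"
  assumes w: "w \<in> test_functions UNIV" and b: "b \<in> Basis"
  shows "ennreal \<bar>w x\<bar> \<le> (\<integral>\<^sup>+t. ennreal \<bar>frechet_derivative w (at (x + (t - x \<bullet> b) *\<^sub>R b)) b\<bar> \<partial>lborel)"
proof -
  have C1: "C_k_on (Suc 0) UNIV w" using w by (rule test_functions_C_k)
  define d where "d x = frechet_derivative w (at x) b" for x
  have cd: "continuous_on UNIV d" using C1 b by (simp add: d_def)
  obtain K where K: "compact K" "\<And>x. x \<notin> K \<Longrightarrow> w x = 0"
    by (rule test_functionsE[OF w]) auto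
  obtain R where R: "\<And>x. x \<in> K \<Longrightarrow> norm x \<le> R"
    using compact_imp_bounded[OF K(1)] by (auto simp: bounded_iff)
  define y where "y = x - (x \<bullet> b) *\<^sub>R b"
  \<comment> \<open>The second term of the minimum places the starting point outside the ball
    containing the support, the first keeps it from lying beyond \<open>x\<close>.\<close>
  define a where "a = min (x \<bullet> b) (- R - 1)"
  have "a = (y + a *\<^sub>R b) \<bullet> b" using b by (simp add: y_def inner_diff_left inner_add_left)
  then have "\<bar>a\<bar> \<le> norm (y + a *\<^sub>R b)" using Basis_le_norm[OF b] by metis
  then have "y + a *\<^sub>R b \<notin> K" using R[of "y + a *\<^sub>R b"] by (auto simp: a_def)
  then have wa: "w (y + a *\<^sub>R b) = 0" by (rule K)
  have cl: "continuous_on S (\<lambda>t. d (y + t *\<^sub>R b))" for S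
    by (rule continuous_on_compose2[OF cd]) (auto intro!: continuous_intros)
  have "(LINT t|lborel. indicator {a..x \<bullet> b} t *\<^sub>R d (y + t *\<^sub>R b)) = w (y + (x \<bullet> b) *\<^sub>R b) - w (y + a *\<^sub>R b)"
  proof (rule integral_FTC_Icc)
    show "a \<le> x \<bullet> b" by (simp add: a_def)
    show "((\<lambda>t. w (y + t *\<^sub>R b)) has_vector_derivative d (y + t *\<^sub>R b)) (at t within {a..x \<bullet> b})" for t
      using line_has_real_derivative[OF C1, of y b t] unfolding d_def
      by (simp add: has_real_derivative_iff_has_vector_derivative[symmetric] has_field_derivative_at_within)
  qed (rule cl)
  then have eq: "w x = (LINT t|lborel. indicator {a..x \<bullet> b} t *\<^sub>R d (y + t *\<^sub>R b))"
    unfolding wa by (simp add: y_def)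
  have "ennreal \<bar>w x\<bar> \<le> (\<integral>\<^sup>+t. norm (indicator {a..x \<bullet> b} t *\<^sub>R d (y + t *\<^sub>R b)) \<partial>lborel)"
    unfolding eq real_norm_def[symmetric]
    by (intro integral_norm_bound_ennreal borel_integrable_compact compact_Icc cl)
  also have "\<dots> \<le> (\<integral>\<^sup>+t. ennreal \<bar>d (y + t *\<^sub>R b)\<bar> \<partial>lborel)"
    by (intro nn_integral_mono ennreal_leI) (auto simp: indicator_def)
  finally show ?thesis
    by (simp add: d_def y_def algebra_simps)
qed

text \<open>The cube w is chosen so that |w|^(4/3) is the fourth power of the function, while its
  gradient is 3 times the square of the function times its gradient. By Cauchy-Schwarz the bound on
  w costs only the square root of the integral to be estimated. A common bound \<open>G\<close> on
  all partial derivatives is assumed so that the norm of a Jacobian can serve for every component of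
  a field.\<close>

lemma sobolev_inequality_test_function:
  fixes \<phi> G :: "'a::euclidean_space \<Rightarrow> real"
  assumes dim: "DIM('a) \<le> 4" and \<phi>: "\<phi> \<in> test_functions UNIV"
    and G: "G \<in> borel_measurable borel" "integrable lborel (\<lambda>x. (G x)\<^sup>2)"
    and grad: "\<And>x b. b \<in> Basis \<Longrightarrow> \<bar>frechet_derivative \<phi> (at x) b\<bar> \<le> G x"
  shows "(LINT x|lborel. \<phi> x ^ 4) \<le> (3 * sqrt (LINT x|lborel. (G x)\<^sup>2) + sqrt (LINT x|lborel. (\<phi> x)\<^sup>2)) ^ 4"
proof -
  note [measurable] = G(1)
  have cont: "continuous_on UNIV \<phi>" using test_functions_C_k[OF \<phi>, of 0] by simp
  have [measurable]: "\<phi> \<in> borel_measurable borel" using cont by (rule borel_measurable_continuous_onI)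
  obtain K where K: "compact K" "\<And>x. x \<notin> K \<Longrightarrow> \<phi> x = 0"
    by (rule test_functionsE[OF \<phi>]) auto
  have G0: "0 \<le> G x" for x using grad[OF SOME_Basis, of x] by (rule order_trans[rotated]) simp
  have int\<phi>: "integrable lborel (\<lambda>x. (\<phi> x) ^ n)" if "n > 0" for n
    by (rule integrable_lborel_compact_support[OF _ K(1)]) (use K(2) that in \<open>auto intro!: continuous_on_power cont\<close>)
  define w where "w x = \<phi> x * \<phi> x * \<phi> x" for x
  have w: "w \<in> test_functions UNIV"
    unfolding w_def using \<phi> by (intro test_functions_mult) (auto simp: test_functions_C_k)
  have dw: "frechet_derivative w (at x) b = 3 * (\<phi> x)\<^sup>2 * frechet_derivative \<phi> (at x) b" for x b
  proof -
    note 1 = C_k_on_has_derivative[OF test_functions_C_k[OF \<phi>], of x]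
    have "(w has_derivative (\<lambda>h. 3 * (\<phi> x)\<^sup>2 * frechet_derivative \<phi> (at x) h)) (at x)"
      unfolding w_def[abs_def]
      by (rule has_derivative_eq_rhs[OF has_derivative_mult[OF has_derivative_mult[OF 1 1] 1]])
        (auto simp: power2_eq_square algebra_simps)
    from frechet_derivative_at[OF this] show ?thesis by metis
  qed
  define g where "g x = 3 * ((\<phi> x)\<^sup>2 * G x) + (\<phi> x)\<^sup>2 * \<bar>\<phi> x\<bar>" for x
  have mg: "g \<in> borel_measurable borel" unfolding g_def by measurable
  have mw: "w \<in> borel_measurable borel" unfolding w_def by measurable
  have wg: "\<bar>w x\<bar> \<le> g x" for x
    using G0[of x] by (simp add: w_def g_def abs_mult power2_eq_square)
  have GN: "(\<integral>\<^sup>+x. ennreal (\<bar>w x\<bar> powr (4/3)) \<partial>lborel) \<le> ennreal_powr (\<integral>\<^sup>+x. ennreal (g x) \<partial>lborel) (4/3)"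
  proof (rule gagliardo_nirenberg[OF dim mw mg wg])
    fix x b :: 'a assume b: "b \<in> Basis"
    have "\<bar>frechet_derivative w (at y) b\<bar> \<le> g y" for y
      unfolding dw g_def using grad[OF b, of y]
      by (auto simp: abs_mult intro!: add_increasing2 mult_left_mono)
    then have "(\<integral>\<^sup>+t. ennreal \<bar>frechet_derivative w (at (x + (t - x \<bullet> b) *\<^sub>R b)) b\<bar> \<partial>lborel)
      \<le> (\<integral>\<^sup>+t. ennreal (g (x + (t - x \<bullet> b) *\<^sub>R b)) \<partial>lborel)"
      by (intro nn_integral_mono ennreal_leI)
    with test_function_le_line_integral[OF w b, of x]
    show "ennreal \<bar>w x\<bar> \<le> (\<integral>\<^sup>+t. ennreal (g (x + (t - x \<bullet> b) *\<^sub>R b)) \<partial>lborel)"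
      by (rule order_trans)
  qed
  define X where "X = (LINT x|lborel. \<phi> x ^ 4)"
  define S where "S = 3 * sqrt (LINT x|lborel. (G x)\<^sup>2) + sqrt (LINT x|lborel. (\<phi> x)\<^sup>2)"
  define Y where "Y = (LINT x|lborel. g x)"
  have X0: "0 \<le> X" unfolding X_def by simp
  have S0: "0 \<le> S" unfolding S_def by simp
  have \<phi>4: "((\<phi> x)\<^sup>2)\<^sup>2 = \<phi> x ^ 4" for x by (simp flip: power_mult)
  have "\<bar>w x\<bar> powr (4/3) = \<phi> x ^ 4" for x
  proof (cases "\<phi> x = 0")
    case False
    have "\<bar>w x\<bar> powr (4/3) = (\<bar>\<phi> x\<bar> powr 3) powr (4/3)"
      by (simp add: w_def abs_mult powr_numeral power3_eq_cube)
    also have "\<dots> = \<bar>\<phi> x\<bar> powr 4"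
      unfolding powr_powr by simp
    finally show ?thesis by (simp add: powr_numeral power_even_abs)
  qed (simp add: w_def)
  then have LX: "(\<integral>\<^sup>+x. ennreal (\<bar>w x\<bar> powr (4/3)) \<partial>lborel) = ennreal X"
    unfolding X_def using int\<phi>[of 4] by (simp add: nn_integral_eq_integral)
  have CS1: "integrable lborel (\<lambda>x. (\<phi> x)\<^sup>2 * G x)"
    "(LINT x|lborel. \<bar>(\<phi> x)\<^sup>2 * G x\<bar>) \<le> sqrt X * sqrt (LINT x|lborel. (G x)\<^sup>2)"
    using Cauchy_Schwarz_integral[of "\<lambda>x. (\<phi> x)\<^sup>2" lborel G] int\<phi>[of 4] G by (simp_all add: \<phi>4 X_def)
  have CS2: "integrable lborel (\<lambda>x. (\<phi> x)\<^sup>2 * \<bar>\<phi> x\<bar>)"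
    "(LINT x|lborel. \<bar>(\<phi> x)\<^sup>2 * \<bar>\<phi> x\<bar>\<bar>) \<le> sqrt X * sqrt (LINT x|lborel. (\<phi> x)\<^sup>2)"
    using Cauchy_Schwarz_integral[of "\<lambda>x. (\<phi> x)\<^sup>2" lborel "\<lambda>x. \<bar>\<phi> x\<bar>"] int\<phi>[of 4] int\<phi>[of 2]
    by (simp_all add: \<phi>4 X_def)
  have "Y = 3 * (LINT x|lborel. (\<phi> x)\<^sup>2 * G x) + (LINT x|lborel. (\<phi> x)\<^sup>2 * \<bar>\<phi> x\<bar>)"
    unfolding Y_def g_def using CS1(1) CS2(1) by simp
  also have "\<dots> \<le> sqrt X * S"
    using CS1(2) CS2(2) G0 by (simp add: S_def abs_mult algebra_simps)
  finally have YS: "Y \<le> sqrt X * S" .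
  have g0: "0 \<le> g x" for x using wg[of x] by linarith
  have Y0: "0 \<le> Y" unfolding Y_def using g0 by simp
  have "integrable lborel g" unfolding g_def using CS1(1) CS2(1) by simp
  then have "(\<integral>\<^sup>+x. ennreal (g x) \<partial>lborel) = ennreal Y"
    unfolding Y_def using g0 by (intro nn_integral_eq_integral) auto
  with GN LX Y0 have "X \<le> Y powr (4/3)" by (simp add: ennreal_powr_ennreal)
  \<comment> \<open>Cubing clears the fractional exponent. With the bound on \<open>Y\<close>, X^3
    is at most X^2 S^4, and X^2 cancels because the compact support makes \<open>X\<close> a finite
    number.\<close>
  then have "X ^ 3 \<le> (Y powr (4/3)) ^ 3" using X0 by (rule power_mono)
  also have "\<dots> = Y ^ 4"
    using Y0 by (cases "Y = 0") (simp_all add: powr_power powr_numeral)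
  also have "\<dots> \<le> (sqrt X * S) ^ 4" using YS Y0 by (rule power_mono)
  also have "\<dots> = X ^ 2 * S ^ 4"
  proof -
    have "sqrt X ^ 4 = ((sqrt X)\<^sup>2)\<^sup>2" by (simp flip: power_mult)
    then show ?thesis using X0 by (simp add: power_mult_distrib)
  qed
  finally have "X\<^sup>2 * X \<le> X\<^sup>2 * S ^ 4" by (simp add: power3_eq_cube power2_eq_square mult_ac)
  then have "X \<le> S ^ 4"
    using X0 S0 by (cases "X = 0") (auto simp: mult_le_cancel_left)
  then show ?thesis unfolding X_def S_def .
qed

section \<open>Lebesgue spaces and the trilinear form\<close>

lemma Lp_space_numeral_iff:
  "u \<in> Lp_space (numeral n) D \<longleftrightarrow> u \<in> borel_measurable (lebesgue_on D)
    \<and> integrable (lebesgue_on D) (\<lambda>x. norm (u x) ^ numeral n)"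
  by (simp add: Lp_space_def powr_numeral)

lemma Lp_space_measurable: "u \<in> Lp_space p D \<Longrightarrow> u \<in> borel_measurable (lebesgue_on D)"
  by (simp add: Lp_space_def)

lemma norm_add_power_le:
  fixes x y :: "'a::real_normed_vector"
  shows "norm (x + y) ^ n \<le> 2 ^ n * (norm x ^ n + norm y ^ n)"
proof -
  have "norm (x + y) ^ n \<le> (2 * max (norm x) (norm y)) ^ n"
    using norm_triangle_ineq[of x y] by (intro power_mono) auto
  also have "\<dots> = 2 ^ n * max (norm x) (norm y) ^ n" by (simp add: power_mult_distrib)
  also have "\<dots> \<le> 2 ^ n * (norm x ^ n + norm y ^ n)"
    by (intro mult_left_mono) (auto simp: max_def)
  finally show ?thesis .
qed

lemma Lp_space_lincomb:
  fixes u v :: "'a::euclidean_space \<Rightarrow> 'b::euclidean_space"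
  assumes "u \<in> Lp_space (numeral n) D" "v \<in> Lp_space (numeral n) D"
  shows "(\<lambda>x. s *\<^sub>R u x + t *\<^sub>R v x) \<in> Lp_space (numeral n) D"
proof -
  have [measurable]: "u \<in> borel_measurable (lebesgue_on D)" "v \<in> borel_measurable (lebesgue_on D)"
    using assms by (auto simp: Lp_space_measurable)
  have "integrable (lebesgue_on D) (\<lambda>x. norm (s *\<^sub>R u x + t *\<^sub>R v x) ^ numeral n)"
  proof (rule Bochner_Integration.integrable_bound)
    show "integrable (lebesgue_on D) (\<lambda>x. 2 ^ numeral n *
      (\<bar>s\<bar> ^ numeral n * norm (u x) ^ numeral n + \<bar>t\<bar> ^ numeral n * norm (v x) ^ numeral n))"
      using assms by (simp add: Lp_space_numeral_iff)
    show "AE x in lebesgue_on D. norm (norm (s *\<^sub>R u x + t *\<^sub>R v x) ^ numeral n) \<le>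
      norm (2 ^ numeral n * (\<bar>s\<bar> ^ numeral n * norm (u x) ^ numeral n + \<bar>t\<bar> ^ numeral n * norm (v x) ^ numeral n))"
      using norm_add_power_le[of "s *\<^sub>R u x" "t *\<^sub>R v x" "numeral n" for x]
      by (intro AE_I2) (simp add: power_mult_distrib)
  qed measurable
  then show ?thesis by (simp add: Lp_space_numeral_iff)
qed

lemma Lp_space_diff:
  fixes u v :: "'a::euclidean_space \<Rightarrow> 'b::euclidean_space"
  assumes "u \<in> Lp_space (numeral n) D" "v \<in> Lp_space (numeral n) D"
  shows "(\<lambda>x. u x - v x) \<in> Lp_space (numeral n) D"
  using Lp_space_lincomb[OF assms, of 1 "-1"] by simp

text \<open>The \<open>n\<close>-th power of the \<open>L\<^sup>n\<close> norm.\<close>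

definition Lp_int :: "nat \<Rightarrow> 'a::euclidean_space set \<Rightarrow> ('a \<Rightarrow> 'b::euclidean_space) \<Rightarrow> real" where
  "Lp_int n D u = (LINT x|lebesgue_on D. norm (u x) ^ n)"

lemma Lp_int_nonneg [simp]: "0 \<le> Lp_int n D u"
  by (simp add: Lp_int_def)

lemma Lp_norm_2: "Lp_norm 2 D u = sqrt (Lp_int 2 D u)"
proof -
  have "0 \<le> Lp_int 2 D u" by simp
  then show ?thesis unfolding Lp_norm_def Lp_int_def by (simp add: powr_numeral powr_half_sqrt)
qed

text \<open>Nested square roots are the form in which two successive uses of Cauchy-Schwarz produce
  this norm.\<close>

lemma Lp_norm_4: "Lp_norm 4 D u = sqrt (sqrt (Lp_int 4 D u))"
proof -
  have 0: "0 \<le> Lp_int 4 D u" by simp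
  have "Lp_norm 4 D u = Lp_int 4 D u powr (1/4)"
    unfolding Lp_norm_def Lp_int_def by (simp add: powr_numeral)
  also have "\<dots> = (Lp_int 4 D u powr (1/2)) powr (1/2)"
    unfolding powr_powr by simp
  finally show ?thesis using 0 by (simp add: powr_half_sqrt)
qed

text \<open>A triangle inequality up to a constant, for powers of norms. It carries null sequences
  through linear combinations, so Minkowski's inequality is avoided.\<close>

lemma Lp_int_lincomb_le:
  fixes u v :: "'a::euclidean_space \<Rightarrow> 'b::euclidean_space"
  assumes "u \<in> Lp_space (numeral n) D" "v \<in> Lp_space (numeral n) D"
  shows "Lp_int (numeral n) D (\<lambda>x. s *\<^sub>R u x + t *\<^sub>R v x)
    \<le> 2 ^ numeral n * (\<bar>s\<bar> ^ numeral n * Lp_int (numeral n) D u + \<bar>t\<bar> ^ numeral n * Lp_int (numeral n) D v)"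
proof -
  have "Lp_int (numeral n) D (\<lambda>x. s *\<^sub>R u x + t *\<^sub>R v x) \<le> (LINT x|lebesgue_on D. 2 ^ numeral n *
      (\<bar>s\<bar> ^ numeral n * norm (u x) ^ numeral n + \<bar>t\<bar> ^ numeral n * norm (v x) ^ numeral n))"
    unfolding Lp_int_def
  proof (rule integral_mono)
    show "integrable (lebesgue_on D) (\<lambda>x. norm (s *\<^sub>R u x + t *\<^sub>R v x) ^ numeral n)"
      using Lp_space_lincomb[OF assms, of s t] by (simp add: Lp_space_numeral_iff)
    show "norm (s *\<^sub>R u x + t *\<^sub>R v x) ^ numeral n \<le> 2 ^ numeral n *
      (\<bar>s\<bar> ^ numeral n * norm (u x) ^ numeral n + \<bar>t\<bar> ^ numeral n * norm (v x) ^ numeral n)" for x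
      using norm_add_power_le[of "s *\<^sub>R u x" "t *\<^sub>R v x" "numeral n"] by (simp add: power_mult_distrib)
  qed (use assms in \<open>simp add: Lp_space_numeral_iff\<close>)
  also have "\<dots> = 2 ^ numeral n * (\<bar>s\<bar> ^ numeral n * Lp_int (numeral n) D u + \<bar>t\<bar> ^ numeral n * Lp_int (numeral n) D v)"
    using assms by (simp add: Lp_space_numeral_iff Lp_int_def)
  finally show ?thesis .
qed

lemma Lp_int_diff_triangle:
  fixes u v w :: "'a::euclidean_space \<Rightarrow> 'b::euclidean_space"
  assumes "u \<in> Lp_space (numeral n) D" "v \<in> Lp_space (numeral n) D" "w \<in> Lp_space (numeral n) D"
  shows "Lp_int (numeral n) D (\<lambda>x. u x - w x)
    \<le> 2 ^ numeral n * (Lp_int (numeral n) D (\<lambda>x. u x - v x) + Lp_int (numeral n) D (\<lambda>x. v x - w x))"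
  using Lp_int_lincomb_le[OF Lp_space_diff[OF assms(1,2)] Lp_space_diff[OF assms(2,3)], of 1 1] by simp

lemma Lp_int_minus_commute: "Lp_int n D (\<lambda>x. u x - v x) = Lp_int n D (\<lambda>x. v x - u x)"
  by (simp add: Lp_int_def norm_minus_commute)

lemma Lp_int_cong_AE:
  assumes "AE x in lebesgue_on D. u x = v x" "u \<in> borel_measurable (lebesgue_on D)" "v \<in> borel_measurable (lebesgue_on D)"
  shows "Lp_int n D u = Lp_int n D v"
  unfolding Lp_int_def using assms by (intro integral_cong_AE) auto

lemma inner_integrable_L2:
  fixes f g :: "'a::euclidean_space \<Rightarrow> 'b::euclidean_space"
  assumes "f \<in> Lp_space 2 D" "g \<in> Lp_space 2 D"
  shows "integrable (lebesgue_on D) (\<lambda>x. f x \<bullet> g x)"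
    and "\<bar>LINT x|lebesgue_on D. f x \<bullet> g x\<bar> \<le> sqrt (Lp_int 2 D f) * sqrt (Lp_int 2 D g)"
proof -
  have [measurable]: "f \<in> borel_measurable (lebesgue_on D)" "g \<in> borel_measurable (lebesgue_on D)"
    using assms by (auto simp: Lp_space_measurable)
  note CS = Cauchy_Schwarz_integral[of "\<lambda>x. norm (f x)" "lebesgue_on D" "\<lambda>x. norm (g x)"]
  have i: "integrable (lebesgue_on D) (\<lambda>x. norm (f x) * norm (g x))"
    using assms by (intro CS) (auto simp: Lp_space_numeral_iff)
  show j: "integrable (lebesgue_on D) (\<lambda>x. f x \<bullet> g x)"
    by (rule Bochner_Integration.integrable_bound[OF i]) (auto intro: Cauchy_Schwarz_ineq2)
  have "\<bar>LINT x|lebesgue_on D. f x \<bullet> g x\<bar> \<le> (LINT x|lebesgue_on D. \<bar>f x \<bullet> g x\<bar>)"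
    by (rule integral_abs_bound)
  also have "\<dots> \<le> (LINT x|lebesgue_on D. norm (f x) * norm (g x))"
    using i j by (intro integral_mono) (auto intro: Cauchy_Schwarz_ineq2)
  also have "\<dots> \<le> sqrt (Lp_int 2 D f) * sqrt (Lp_int 2 D g)"
    using CS(2) assms by (simp add: Lp_space_numeral_iff Lp_int_def abs_mult)
  finally show "\<bar>LINT x|lebesgue_on D. f x \<bullet> g x\<bar> \<le> sqrt (Lp_int 2 D f) * sqrt (Lp_int 2 D g)" .
qed

lemma norm_mult_L4:
  fixes a :: "'a::euclidean_space \<Rightarrow> 'b::euclidean_space" and c :: "'a \<Rightarrow> 'c::euclidean_space"
  assumes "a \<in> Lp_space 4 D" "c \<in> Lp_space 4 D"
  shows "(\<lambda>x. norm (a x) * norm (c x)) \<in> Lp_space 2 D"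
    and "Lp_int 2 D (\<lambda>x. norm (a x) * norm (c x)) \<le> sqrt (Lp_int 4 D a) * sqrt (Lp_int 4 D c)"
proof -
  have [measurable]: "a \<in> borel_measurable (lebesgue_on D)" "c \<in> borel_measurable (lebesgue_on D)"
    using assms by (auto simp: Lp_space_measurable)
  have 4: "((norm y)\<^sup>2)\<^sup>2 = norm y ^ 4" for y :: "'z::real_normed_vector" by (simp flip: power_mult)
  note CS = Cauchy_Schwarz_integral[of "\<lambda>x. (norm (a x))\<^sup>2" "lebesgue_on D" "\<lambda>x. (norm (c x))\<^sup>2"]
  have "integrable (lebesgue_on D) (\<lambda>x. (norm (a x))\<^sup>2 * (norm (c x))\<^sup>2)"
    using assms by (intro CS) (auto simp: Lp_space_numeral_iff 4)
  then show "(\<lambda>x. norm (a x) * norm (c x)) \<in> Lp_space 2 D"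
    by (simp add: Lp_space_numeral_iff power_mult_distrib)
  show "Lp_int 2 D (\<lambda>x. norm (a x) * norm (c x)) \<le> sqrt (Lp_int 4 D a) * sqrt (Lp_int 4 D c)"
    using CS(2) assms by (simp add: Lp_space_numeral_iff Lp_int_def 4 abs_mult power_mult_distrib)
qed

text \<open>Cauchy-Schwarz in each row; the matrix norm is the Frobenius norm, as that of a vector
  of Euclidean vectors.\<close>

lemma norm_matrix_vector_mult_le:
  fixes A :: "real^'n^'m"
  shows "norm (A *v x) \<le> norm A * norm x"
proof -
  have "(norm (A *v x))\<^sup>2 = (\<Sum>i\<in>UNIV. (A $ i \<bullet> x)\<^sup>2)"
    by (simp add: norm_vec_def L2_set_def matrix_vector_mul_component sum_nonneg)
  also have "\<dots> \<le> (\<Sum>i\<in>UNIV. (norm (A $ i))\<^sup>2 * (norm x)\<^sup>2)"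
  proof (rule sum_mono)
    fix i
    have "\<bar>A $ i \<bullet> x\<bar>\<^sup>2 \<le> (norm (A $ i) * norm x)\<^sup>2"
      by (intro power_mono Cauchy_Schwarz_ineq2) simp
    then show "(A $ i \<bullet> x)\<^sup>2 \<le> (norm (A $ i))\<^sup>2 * (norm x)\<^sup>2" by (simp add: power_mult_distrib)
  qed
  also have "\<dots> = (norm A * norm x)\<^sup>2"
    by (simp add: norm_vec_def[of A] L2_set_def sum_nonneg power_mult_distrib sum_distrib_right)
  finally show ?thesis by (rule power2_le_imp_le) simp
qed

lemma measurable_vec_nth [measurable (raw)]:
  fixes f :: "'a \<Rightarrow> 'b::euclidean_space ^ 'n"
  assumes "f \<in> borel_measurable M"
  shows "(\<lambda>x. f x $ i) \<in> borel_measurable M"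
proof -
  have "(\<lambda>v::'b^'n. v $ i) \<in> borel_measurable borel"
    by (intro borel_measurable_continuous_onI continuous_intros)
  from measurable_compose[OF assms this] show ?thesis .
qed

lemma matrix_vector_inner_eq: "((A::real^'n^'m) *v x) \<bullet> y = (\<Sum>i\<in>UNIV. \<Sum>j\<in>UNIV. A $ i $ j * x $ j * y $ i)"
  by (simp add: inner_vec_def matrix_vector_mult_def sum_distrib_right)

lemma measurable_matrix_vector_inner [measurable (raw)]:
  fixes A :: "'a \<Rightarrow> real^'n^'m"
  assumes [measurable]: "A \<in> borel_measurable M" "x \<in> borel_measurable M" "y \<in> borel_measurable M"
  shows "(\<lambda>t. (A t *v x t) \<bullet> y t) \<in> borel_measurable M"
  unfolding matrix_vector_inner_eq by measurable

text \<open>The form b(a,b,c) with the gradient of b replaced by an arbitrary matrix field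
  \<open>M\<close>, placed first. Linearity and continuity can then be stated before weak gradients
  enter, and convergence of gradients is separated from convergence of fields.\<close>

definition trilin :: "(real^'n) set \<Rightarrow> (real^'n \<Rightarrow> real^'n^'n) \<Rightarrow> (real^'n \<Rightarrow> real^'n) \<Rightarrow> (real^'n \<Rightarrow> real^'n) \<Rightarrow> real" where
  "trilin D M a c = (LINT x|lebesgue_on D. (M x *v a x) \<bullet> c x)"

text \<open>Hoelder's inequality with exponents 2, 4, 4, obtained by using Cauchy-Schwarz twice:
  once between \<open>M\<close> and the product of the other two norms, once inside that
  product.\<close>

lemma trilin_integrable:
  assumes "M \<in> Lp_space 2 D" "a \<in> Lp_space 4 D" "c \<in> Lp_space 4 D"
  shows "integrable (lebesgue_on D) (\<lambda>x. (M x *v a x) \<bullet> c x)"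
    and "\<bar>trilin D M a c\<bar> \<le> sqrt (Lp_int 2 D M) * sqrt (sqrt (Lp_int 4 D a) * sqrt (Lp_int 4 D c))"
proof -
  have [measurable]: "M \<in> borel_measurable (lebesgue_on D)" "a \<in> borel_measurable (lebesgue_on D)"
    "c \<in> borel_measurable (lebesgue_on D)"
    using assms by (auto simp: Lp_space_measurable)
  have le: "\<bar>(M x *v a x) \<bullet> c x\<bar> \<le> norm (M x) * (norm (a x) * norm (c x))" for x
  proof -
    have "\<bar>(M x *v a x) \<bullet> c x\<bar> \<le> norm (M x *v a x) * norm (c x)" by (rule Cauchy_Schwarz_ineq2)
    also have "\<dots> \<le> (norm (M x) * norm (a x)) * norm (c x)"
      by (intro mult_right_mono norm_matrix_vector_mult_le) simp
    finally show ?thesis by (simp add: mult.assoc)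
  qed
  have nM: "(\<lambda>x. norm (M x)) \<in> Lp_space 2 D" "Lp_int 2 D (\<lambda>x. norm (M x)) = Lp_int 2 D M"
    using assms(1) by (auto simp: Lp_space_numeral_iff Lp_int_def)
  note ac = norm_mult_L4[OF assms(2,3)]
  note i = inner_integrable_L2[OF nM(1) ac(1), unfolded inner_real_def]
  show j: "integrable (lebesgue_on D) (\<lambda>x. (M x *v a x) \<bullet> c x)"
    by (rule Bochner_Integration.integrable_bound[OF i(1)]) (use le in \<open>auto simp: abs_mult\<close>)
  have "\<bar>trilin D M a c\<bar> \<le> (LINT x|lebesgue_on D. \<bar>(M x *v a x) \<bullet> c x\<bar>)"
    unfolding trilin_def by (rule integral_abs_bound)
  also have "\<dots> \<le> (LINT x|lebesgue_on D. norm (M x) * (norm (a x) * norm (c x)))"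
    using i(1) j le by (intro integral_mono) auto
  also have "\<dots> \<le> sqrt (Lp_int 2 D M) * sqrt (Lp_int 2 D (\<lambda>x. norm (a x) * norm (c x)))"
    using i(2) unfolding nM(2) by linarith
  also have "\<dots> \<le> sqrt (Lp_int 2 D M) * sqrt (sqrt (Lp_int 4 D a) * sqrt (Lp_int 4 D c))"
    using ac(2) by (intro mult_left_mono real_sqrt_le_mono) auto
  finally show "\<bar>trilin D M a c\<bar> \<le> sqrt (Lp_int 2 D M) * sqrt (sqrt (Lp_int 4 D a) * sqrt (Lp_int 4 D c))" .
qed

section \<open>Linearity and continuity of the trilinear form in each slot\<close>

lemma trilin_lincomb_1:
  assumes "M \<in> Lp_space 2 D" "N \<in> Lp_space 2 D" "a \<in> Lp_space 4 D" "c \<in> Lp_space 4 D"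
  shows "trilin D (\<lambda>x. s *\<^sub>R M x + t *\<^sub>R N x) a c = s * trilin D M a c + t * trilin D N a c"
  unfolding trilin_def using trilin_integrable(1)[OF assms(1,3,4)] trilin_integrable(1)[OF assms(2,3,4)]
  by (simp add: matrix_vector_mult_add_rdistrib scaleR_matrix_vector_assoc[symmetric] inner_add_left)

lemma trilin_lincomb_2:
  assumes "M \<in> Lp_space 2 D" "a \<in> Lp_space 4 D" "b \<in> Lp_space 4 D" "c \<in> Lp_space 4 D"
  shows "trilin D M (\<lambda>x. s *\<^sub>R a x + t *\<^sub>R b x) c = s * trilin D M a c + t * trilin D M b c"
  unfolding trilin_def using trilin_integrable(1)[OF assms(1,2,4)] trilin_integrable(1)[OF assms(1,3,4)]
  by (simp add: matrix_vector_right_distrib matrix_vector_mult_scaleR inner_add_left)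

lemma trilin_lincomb_3:
  assumes "M \<in> Lp_space 2 D" "a \<in> Lp_space 4 D" "b \<in> Lp_space 4 D" "c \<in> Lp_space 4 D"
  shows "trilin D M a (\<lambda>x. s *\<^sub>R b x + t *\<^sub>R c x) = s * trilin D M a b + t * trilin D M a c"
  unfolding trilin_def using trilin_integrable(1)[OF assms(1,2,3)] trilin_integrable(1)[OF assms(1,2,4)]
  by (simp add: inner_add_right)

lemma LIMSEQ_if_abs_diff_le:
  fixes X :: "nat \<Rightarrow> real"
  assumes "B \<longlonglongrightarrow> 0" "\<And>n. \<bar>L - X n\<bar> \<le> B n"
  shows "X \<longlonglongrightarrow> L"
proof -
  have "(\<lambda>n. L - X n) \<longlonglongrightarrow> 0"
    by (rule Lim_null_comparison[OF always_eventually assms(1)]) (simp add: assms(2))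
  from tendsto_diff[OF tendsto_const[of L] this] show ?thesis by simp
qed

lemma trilin_tendsto_1:
  assumes "M \<in> Lp_space 2 D" "\<And>n. N n \<in> Lp_space 2 D" "a \<in> Lp_space 4 D" "c \<in> Lp_space 4 D"
    and lim: "(\<lambda>n. Lp_int 2 D (\<lambda>x. M x - N n x)) \<longlonglongrightarrow> 0"
  shows "(\<lambda>n. trilin D (N n) a c) \<longlonglongrightarrow> trilin D M a c"
proof -
  let ?B = "\<lambda>n. sqrt (Lp_int 2 D (\<lambda>x. M x - N n x)) * sqrt (sqrt (Lp_int 4 D a) * sqrt (Lp_int 4 D c))"
  have "?B \<longlonglongrightarrow> sqrt 0 * sqrt (sqrt (Lp_int 4 D a) * sqrt (Lp_int 4 D c))"
    by (intro tendsto_intros lim)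
  moreover have "\<bar>trilin D M a c - trilin D (N n) a c\<bar> \<le> ?B n" for n
    using trilin_integrable(2)[OF Lp_space_diff[OF assms(1) assms(2)[of n]] assms(3,4)]
      trilin_lincomb_1[OF assms(1) assms(2)[of n] assms(3,4), of 1 "-1"] by simp
  ultimately show ?thesis
    by - (rule LIMSEQ_if_abs_diff_le[of ?B], simp_all)
qed

lemma trilin_tendsto_2:
  assumes "M \<in> Lp_space 2 D" "a \<in> Lp_space 4 D" "\<And>n. b n \<in> Lp_space 4 D" "c \<in> Lp_space 4 D"
    and lim: "(\<lambda>n. Lp_int 4 D (\<lambda>x. a x - b n x)) \<longlonglongrightarrow> 0"
  shows "(\<lambda>n. trilin D M (b n) c) \<longlonglongrightarrow> trilin D M a c"
proof -
  let ?B = "\<lambda>n. sqrt (Lp_int 2 D M) * sqrt (sqrt (Lp_int 4 D (\<lambda>x. a x - b n x)) * sqrt (Lp_int 4 D c))"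
  have "?B \<longlonglongrightarrow> sqrt (Lp_int 2 D M) * sqrt (sqrt 0 * sqrt (Lp_int 4 D c))"
    by (intro tendsto_intros lim)
  moreover have "\<bar>trilin D M a c - trilin D M (b n) c\<bar> \<le> ?B n" for n
    using trilin_integrable(2)[OF assms(1) Lp_space_diff[OF assms(2) assms(3)[of n]] assms(4)]
      trilin_lincomb_2[OF assms(1,2) assms(3)[of n] assms(4), of 1 "-1"] by simp
  ultimately show ?thesis
    by - (rule LIMSEQ_if_abs_diff_le[of ?B], simp_all)
qed

lemma trilin_tendsto_3:
  assumes "M \<in> Lp_space 2 D" "a \<in> Lp_space 4 D" "\<And>n. b n \<in> Lp_space 4 D" "c \<in> Lp_space 4 D"
    and lim: "(\<lambda>n. Lp_int 4 D (\<lambda>x. c x - b n x)) \<longlonglongrightarrow> 0"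
  shows "(\<lambda>n. trilin D M a (b n)) \<longlonglongrightarrow> trilin D M a c"
proof -
  let ?B = "\<lambda>n. sqrt (Lp_int 2 D M) * sqrt (sqrt (Lp_int 4 D a) * sqrt (Lp_int 4 D (\<lambda>x. c x - b n x)))"
  have "?B \<longlonglongrightarrow> sqrt (Lp_int 2 D M) * sqrt (sqrt (Lp_int 4 D a) * sqrt 0)"
    by (intro tendsto_intros lim)
  moreover have "\<bar>trilin D M a c - trilin D M a (b n)\<bar> \<le> ?B n" for n
    using trilin_integrable(2)[OF assms(1,2) Lp_space_diff[OF assms(4) assms(3)[of n]]]
      trilin_lincomb_3[OF assms(1,2,4) assms(3)[of n], of 1 "-1"] by simp
  ultimately show ?thesis
    by - (rule LIMSEQ_if_abs_diff_le[of ?B], simp_all)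
qed

section \<open>Weak gradients\<close>

abbreviation jac :: "(real^'n \<Rightarrow> real^'n) \<Rightarrow> real^'n \<Rightarrow> real^'n^'n" where
  "jac \<phi> \<equiv> \<lambda>x. jacobian \<phi> (at x)"

lemma axis_Basis [simp]: "axis j (1::real) \<in> Basis"
  by (auto simp: Basis_vec_def)

lemma continuous_imp_measurable_lebesgue_on:
  fixes f :: "'a::euclidean_space \<Rightarrow> 'b::euclidean_space"
  assumes "continuous_on UNIV f"
  shows "f \<in> borel_measurable (lebesgue_on D)"
proof -
  have "f \<in> borel_measurable lebesgue"
    using borel_measurable_continuous_onI[OF assms] by (intro measurable_completion) simp
  then show ?thesis by (rule measurable_restrict_space1)
qed

text \<open>Moves integrals of test functions from \<open>D\<close> to the whole space, where
  translation invariance and the Sobolev inequality are available.\<close>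

lemma lebesgue_on_eq_lborel:
  fixes f :: "'a::euclidean_space \<Rightarrow> real"
  assumes "open D" "continuous_on UNIV f" "\<And>x. x \<notin> D \<Longrightarrow> f x = 0"
  shows "integrable (lebesgue_on D) f \<longleftrightarrow> integrable lborel f"
    and "(LINT x|lebesgue_on D. f x) = (LINT x|lborel. f x)"
proof -
  have D: "D \<inter> space lebesgue \<in> sets lebesgue" using \<open>open D\<close> by auto
  have f: "f \<in> borel_measurable lborel" using borel_measurable_continuous_onI[OF assms(2)] by simp
  have eq: "(\<lambda>x. indicator D x *\<^sub>R f x) = f"
  proof
    show "indicator D x *\<^sub>R f x = f x" for x by (cases "x \<in> D") (simp_all add: assms(3))
  qed
  show "integrable (lebesgue_on D) f \<longleftrightarrow> integrable lborel f"
    unfolding integrable_restrict_space[OF D] eq by (rule integrable_completion[OF f])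
  show "(LINT x|lebesgue_on D. f x) = (LINT x|lborel. f x)"
    unfolding integral_restrict_space[OF D] eq by (rule integral_completion[OF f])
qed

lemma compact_support_in_Lp_space:
  fixes f :: "'a::euclidean_space \<Rightarrow> 'b::euclidean_space"
  assumes "open D" "continuous_on UNIV f" "compact K" "K \<subseteq> D" "\<And>x. x \<notin> K \<Longrightarrow> f x = 0"
  shows "f \<in> Lp_space (numeral n) D"
proof -
  have c: "continuous_on UNIV (\<lambda>x. norm (f x) ^ numeral n)" using assms(2) by (intro continuous_intros)
  have "integrable lborel (\<lambda>x. norm (f x) ^ numeral n)"
    by (rule integrable_lborel_compact_support[OF c assms(3)]) (simp add: assms(5))
  moreover have "norm (f x) ^ numeral n = 0" if "x \<notin> D" for x
    using that assms(4) assms(5)[of x] by auto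
  ultimately have "integrable (lebesgue_on D) (\<lambda>x. norm (f x) ^ numeral n)"
    using lebesgue_on_eq_lborel(1)[OF assms(1) c] by simp
  with continuous_imp_measurable_lebesgue_on[OF assms(2)] show ?thesis
    by (simp add: Lp_space_numeral_iff)
qed

lemma test_functions_continuous: "\<phi> \<in> test_functions D \<Longrightarrow> continuous_on UNIV \<phi>"
  using test_functions_C_k[of \<phi> D 0] by simp

lemma test_functions_derivative_continuous:
  "\<phi> \<in> test_functions D \<Longrightarrow> b \<in> Basis \<Longrightarrow> continuous_on UNIV (\<lambda>x. frechet_derivative \<phi> (at x) b)"
  using test_functions_C_k[of \<phi> D "Suc 0"] by simp

lemma test_functions_has_derivative:
  "\<phi> \<in> test_functions D \<Longrightarrow> (\<phi> has_derivative frechet_derivative \<phi> (at x)) (at x)"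
  by (rule C_k_on_has_derivative[OF test_functions_C_k])

lemma test_functions_component:
  fixes \<phi> :: "real^'n \<Rightarrow> real^'n"
  assumes "\<phi> \<in> test_functions D"
  shows "(\<lambda>x. \<phi> x $ i) \<in> test_functions D"
  by (rule test_functions_bounded_linear[OF bounded_linear_vec_nth assms])

lemma test_functions_mono: "D \<subseteq> E \<Longrightarrow> \<phi> \<in> test_functions D \<Longrightarrow> \<phi> \<in> test_functions E"
  by (auto simp: test_functions_def)

lemma test_functions_in_Lp_space:
  fixes \<phi> :: "'a::euclidean_space \<Rightarrow> 'b::euclidean_space"
  assumes "open D" "\<phi> \<in> test_functions D"
  shows "\<phi> \<in> Lp_space (numeral n) D"
    and "b \<in> Basis \<Longrightarrow> (\<lambda>x. frechet_derivative \<phi> (at x) b) \<in> Lp_space (numeral n) D"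
proof -
  obtain K where K: "compact K" "K \<subseteq> D" "\<And>x. x \<notin> K \<Longrightarrow> \<phi> x = 0"
    "\<And>x. x \<notin> K \<Longrightarrow> frechet_derivative \<phi> (at x) = (\<lambda>h. 0)"
    by (rule test_functionsE[OF assms(2)]) (rule that)
  show "\<phi> \<in> Lp_space (numeral n) D"
    by (rule compact_support_in_Lp_space[OF assms(1) test_functions_continuous[OF assms(2)] K(1,2)]) (rule K(3))
  show "(\<lambda>x. frechet_derivative \<phi> (at x) b) \<in> Lp_space (numeral n) D" if "b \<in> Basis"
    by (rule compact_support_in_Lp_space[OF assms(1) test_functions_derivative_continuous[OF assms(2) that] K(1,2)])
      (simp add: K(4))
qed

section \<open>Jacobians of test fields\<close>

lemma jac_component:
  fixes \<phi> :: "real^'n \<Rightarrow> real^'n"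
  assumes "\<phi> \<in> test_functions D"
  shows "jac \<phi> x $ i $ j = frechet_derivative (\<lambda>x. \<phi> x $ i) (at x) (axis j 1)"
proof -
  have "((\<lambda>x. \<phi> x $ i) has_derivative (\<lambda>h. frechet_derivative \<phi> (at x) h $ i)) (at x)"
    by (rule bounded_linear.has_derivative[OF bounded_linear_vec_nth test_functions_has_derivative[OF assms]])
  from frechet_derivative_at[OF this, symmetric] show ?thesis
    by (simp add: jacobian_def matrix_def)
qed

lemma jac_lincomb:
  fixes \<phi> \<psi> :: "real^'n \<Rightarrow> real^'n"
  assumes "\<phi> \<in> test_functions D" "\<psi> \<in> test_functions D"
  shows "jac (\<lambda>x. s *\<^sub>R \<phi> x + t *\<^sub>R \<psi> x) x = s *\<^sub>R jac \<phi> x + t *\<^sub>R jac \<psi> x"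
proof -
  have "((\<lambda>x. s *\<^sub>R \<phi> x + t *\<^sub>R \<psi> x) has_derivative
    (\<lambda>h. s *\<^sub>R frechet_derivative \<phi> (at x) h + t *\<^sub>R frechet_derivative \<psi> (at x) h)) (at x)"
    by (rule has_derivative_add[OF has_derivative_scaleR_right has_derivative_scaleR_right];
        rule test_functions_has_derivative; rule assms)
  from frechet_derivative_at[OF this, symmetric] show ?thesis
    by (simp add: jacobian_def matrix_def vec_eq_iff)
qed

lemma jac_in_Lp_space:
  fixes \<phi> :: "real^'n \<Rightarrow> real^'n"
  assumes "open D" "\<phi> \<in> test_functions D"
  shows "continuous_on UNIV (jac \<phi>)" and "jac \<phi> \<in> Lp_space (numeral n) D"
proof -
  obtain K where K: "compact K" "K \<subseteq> D" "\<And>x. x \<notin> K \<Longrightarrow> frechet_derivative \<phi> (at x) = (\<lambda>h. 0)"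
    by (rule test_functionsE[OF assms(2)]) (rule that)
  show c: "continuous_on UNIV (jac \<phi>)"
    unfolding jacobian_def matrix_def
    by (intro continuous_on_vec_lambda continuous_on_component test_functions_derivative_continuous[OF assms(2)]) simp
  show "jac \<phi> \<in> Lp_space (numeral n) D"
    by (rule compact_support_in_Lp_space[OF assms(1) c K(1,2)])
      (simp add: jacobian_def matrix_def K(3) vec_eq_iff)
qed

lemma solenoidal_tests_lincomb:
  assumes "\<phi> \<in> solenoidal_tests D" "\<psi> \<in> solenoidal_tests D"
  shows "(\<lambda>x. s *\<^sub>R \<phi> x + t *\<^sub>R \<psi> x) \<in> solenoidal_tests D"
proof -
  have t: "\<phi> \<in> test_functions D" "\<psi> \<in> test_functions D" using assms by (auto simp: solenoidal_tests_def)
  have "(\<lambda>x. s *\<^sub>R \<phi> x + t *\<^sub>R \<psi> x) \<in> test_functions D"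
    by (intro test_functions_add test_functions_bounded_linear[OF bounded_linear_scaleR_right] t)
  moreover have "divergence (\<lambda>x. s *\<^sub>R \<phi> x + t *\<^sub>R \<psi> x) x = s * divergence \<phi> x + t * divergence \<psi> x" for x
    unfolding divergence_def jac_lincomb[OF t]
    by (simp add: trace_def sum.distrib sum_distrib_left)
  ultimately show ?thesis using assms by (simp add: solenoidal_tests_def)
qed

lemma Lp_space_component:
  fixes u :: "'a::euclidean_space \<Rightarrow> 'b::euclidean_space ^ 'n"
  assumes "u \<in> Lp_space (numeral n) D"
  shows "(\<lambda>x. u x $ i) \<in> Lp_space (numeral n) D"
proof -
  have [measurable]: "u \<in> borel_measurable (lebesgue_on D)" using assms by (rule Lp_space_measurable)
  have "integrable (lebesgue_on D) (\<lambda>x. norm (u x $ i) ^ numeral n)"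
  proof (rule Bochner_Integration.integrable_bound)
    show "integrable (lebesgue_on D) (\<lambda>x. norm (u x) ^ numeral n)"
      using assms by (simp add: Lp_space_numeral_iff)
    show "AE x in lebesgue_on D. norm (norm (u x $ i) ^ numeral n) \<le> norm (norm (u x) ^ numeral n)"
      by (intro AE_I2) (simp add: power_mono Finite_Cartesian_Product.norm_nth_le)
  qed measurable
  then show ?thesis by (simp add: Lp_space_numeral_iff)
qed

section \<open>Linearity, uniqueness and classical values of weak gradients\<close>

lemma weak_gradient_integrable:
  fixes u :: "real^'n \<Rightarrow> real^'n" and Du :: "real^'n \<Rightarrow> real^'n^'n" and \<phi> :: "real^'n \<Rightarrow> real"
  assumes "open D" "\<phi> \<in> test_functions D"
  shows "u \<in> Lp_space 2 D \<Longrightarrow> integrable (lebesgue_on D) (\<lambda>x. u x $ i * frechet_derivative \<phi> (at x) (axis j 1))"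
    and "Du \<in> Lp_space 2 D \<Longrightarrow> integrable (lebesgue_on D) (\<lambda>x. Du x $ i $ j * \<phi> x)"
  using inner_integrable_L2(1)[OF Lp_space_component test_functions_in_Lp_space(2)[OF assms], of u "axis j 1" i]
    inner_integrable_L2(1)[OF Lp_space_component[OF Lp_space_component] test_functions_in_Lp_space(1)[OF assms], of Du i j]
  by simp_all

lemma is_weak_gradient_lincomb:
  assumes "open D" "u \<in> Lp_space 2 D" "v \<in> Lp_space 2 D" "Du \<in> Lp_space 2 D" "Dv \<in> Lp_space 2 D"
    and "is_weak_gradient D u Du" "is_weak_gradient D v Dv"
  shows "is_weak_gradient D (\<lambda>x. s *\<^sub>R u x + t *\<^sub>R v x) (\<lambda>x. s *\<^sub>R Du x + t *\<^sub>R Dv x)"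
  unfolding is_weak_gradient_def
proof (intro ballI allI)
  fix \<phi> :: "real^'a \<Rightarrow> real" and i j assume \<phi>: "\<phi> \<in> test_functions D"
  note i = weak_gradient_integrable(1)[OF assms(1) \<phi>] weak_gradient_integrable(2)[OF assms(1) \<phi>]
  note i' = i(1)[OF assms(2), of i j] i(1)[OF assms(3), of i j] i(2)[OF assms(4), of i j] i(2)[OF assms(5), of i j]
  have "(LINT x|lebesgue_on D. u x $ i * frechet_derivative \<phi> (at x) (axis j 1)) = - (LINT x|lebesgue_on D. Du x $ i $ j * \<phi> x)"
    "(LINT x|lebesgue_on D. v x $ i * frechet_derivative \<phi> (at x) (axis j 1)) = - (LINT x|lebesgue_on D. Dv x $ i $ j * \<phi> x)"
    using assms(6,7) \<phi> unfolding is_weak_gradient_def by blast+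
  then show "(LINT x|lebesgue_on D. (s *\<^sub>R u x + t *\<^sub>R v x) $ i * frechet_derivative \<phi> (at x) (axis j 1)) =
      - (LINT x|lebesgue_on D. (s *\<^sub>R Du x + t *\<^sub>R Dv x) $ i $ j * \<phi> x)"
    using i' by (simp add: distrib_right mult.assoc)
qed

text \<open>The fundamental lemma applied to each entry of the difference. Boundedness of
  \<open>D\<close> puts the constant one into L^2, which makes square integrable entries
  integrable.\<close>

lemma is_weak_gradient_unique:
  assumes "open D" "bounded D" "Du \<in> Lp_space 2 D" "Dv \<in> Lp_space 2 D"
    and "is_weak_gradient D u Du" "is_weak_gradient D u Dv"
  shows "AE x in lebesgue_on D. Du x = Dv x"
proof -
  have one: "(\<lambda>x. 1::real) \<in> Lp_space 2 D"
  proof -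
    have "emeasure (lebesgue_on D) (space (lebesgue_on D)) < \<infinity>"
      using emeasure_bounded_finite[OF assms(2)] assms(1)
      by (simp add: emeasure_restrict_space space_restrict_space)
    then have "integrable (lebesgue_on D) (\<lambda>x. 1::real)"
      by (intro finite_measure.integrable_const finite_measureI) auto
    then show ?thesis by (simp add: Lp_space_numeral_iff)
  qed
  have "AE x in lebesgue_on D. Du x $ i $ j = Dv x $ i $ j" for i j
  proof -
    have d: "(\<lambda>x. Du x $ i $ j - Dv x $ i $ j) \<in> Lp_space 2 D"
      by (intro Lp_space_diff Lp_space_component assms)
    have "AE x in lebesgue_on D. Du x $ i $ j - Dv x $ i $ j = 0"
    proof (rule fundamental_lemma_calculus_of_variations[OF assms(1)])
      show "integrable (lebesgue_on D) (\<lambda>x. Du x $ i $ j - Dv x $ i $ j)"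
        using inner_integrable_L2(1)[OF d one] by simp
      fix \<phi> :: "real^'a \<Rightarrow> real" assume \<phi>: "\<phi> \<in> test_functions D"
      have "(LINT x|lebesgue_on D. Du x $ i $ j * \<phi> x) = (LINT x|lebesgue_on D. Dv x $ i $ j * \<phi> x)"
      proof -
        have "(LINT x|lebesgue_on D. u x $ i * frechet_derivative \<phi> (at x) (axis j 1)) = - (LINT x|lebesgue_on D. Du x $ i $ j * \<phi> x)"
          "(LINT x|lebesgue_on D. u x $ i * frechet_derivative \<phi> (at x) (axis j 1)) = - (LINT x|lebesgue_on D. Dv x $ i $ j * \<phi> x)"
          using assms(5,6) \<phi> unfolding is_weak_gradient_def by blast+
        then show ?thesis by simp
      qed
      then show "(LINT x|lebesgue_on D. (Du x $ i $ j - Dv x $ i $ j) * \<phi> x) = 0"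
        using weak_gradient_integrable(2)[OF assms(1) \<phi> assms(3), of i j]
          weak_gradient_integrable(2)[OF assms(1) \<phi> assms(4), of i j]
        by (simp add: left_diff_distrib)
    qed
    then show ?thesis by eventually_elim simp
  qed
  then have "AE x in lebesgue_on D. \<forall>i j. Du x $ i $ j = Dv x $ i $ j"
    unfolding AE_all_countable by simp
  then show ?thesis by eventually_elim (simp add: vec_eq_iff)
qed

lemma test_product_derivative:
  fixes \<phi> \<psi> :: "'a::euclidean_space \<Rightarrow> real"
  assumes "\<phi> \<in> test_functions D" "\<psi> \<in> test_functions D"
  shows "frechet_derivative (\<lambda>x. \<phi> x * \<psi> x) (at x) b
    = \<phi> x * frechet_derivative \<psi> (at x) b + frechet_derivative \<phi> (at x) b * \<psi> x"
  using frechet_derivative_at[OF has_derivative_mult[OF test_functions_has_derivative[OF assms(1)]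
    test_functions_has_derivative[OF assms(2)]], symmetric] by simp

text \<open>The product of a component with a test function is again a test function, so its partial
  derivatives integrate to zero; the product rule then is integration by parts.\<close>

lemma is_weak_gradient_jac:
  fixes \<phi> :: "real^'n \<Rightarrow> real^'n"
  assumes "open D" "\<phi> \<in> test_functions D"
  shows "is_weak_gradient D \<phi> (jac \<phi>)"
  unfolding is_weak_gradient_def
proof (intro ballI allI)
  fix \<psi> :: "real^'n \<Rightarrow> real" and i j assume \<psi>: "\<psi> \<in> test_functions D"
  note c = test_functions_component[OF assms(2), of i]
  define h where "h = (\<lambda>x. \<phi> x $ i * \<psi> x)"
  have h: "h \<in> test_functions D"
    unfolding h_def using test_functions_C_k[OF \<psi>] by (intro test_functions_mult c)
  obtain K where K: "K \<subseteq> D" "\<And>x. x \<notin> K \<Longrightarrow> frechet_derivative h (at x) = (\<lambda>v. 0)"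
    by (rule test_functionsE[OF h]) (rule that)
  have "(LINT x|lebesgue_on D. frechet_derivative h (at x) (axis j 1)) = (LINT x|lborel. frechet_derivative h (at x) (axis j 1))"
    by (rule lebesgue_on_eq_lborel(2)[OF assms(1) test_functions_derivative_continuous[OF h axis_Basis]])
      (use K in \<open>auto dest!: contra_subsetD\<close>)
  also have "\<dots> = 0"
    by (rule integral_frechet_derivative_eq_0[OF test_functions_mono[OF _ h]]) auto
  finally have "(LINT x|lebesgue_on D. \<phi> x $ i * frechet_derivative \<psi> (at x) (axis j 1) + jac \<phi> x $ i $ j * \<psi> x) = 0"
    unfolding h_def test_product_derivative[OF c \<psi>] jac_component[OF assms(2)] .
  then show "(LINT x|lebesgue_on D. \<phi> x $ i * frechet_derivative \<psi> (at x) (axis j 1)) = - (LINT x|lebesgue_on D. jac \<phi> x $ i $ j * \<psi> x)"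
    using weak_gradient_integrable(1)[OF assms(1) \<psi> test_functions_in_Lp_space(1)[OF assms], of i j]
      weak_gradient_integrable(2)[OF assms(1) \<psi> jac_in_Lp_space(2)[OF assms], of i j]
    by simp
qed

text \<open>Use the products a_j c_i as test functions for the weak gradient of \<open>b\<close>.
  The product rule gives a_j times the j-th derivative of c_i, which is the claimed right-hand side,
  and c_i times the j-th derivative of a_j, which sums over j to c_i times the divergence of
  \<open>a\<close>, that is to zero. Only \<open>a\<close> and \<open>c\<close> have to be
  smooth.\<close>

lemma trilin_test_skew:
  fixes a c :: "real^'n \<Rightarrow> real^'n"
  assumes "open D" "a \<in> solenoidal_tests D" "c \<in> test_functions D"
    and b: "b \<in> Lp_space 2 D" "Db \<in> Lp_space 2 D" "is_weak_gradient D b Db"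
  shows "trilin D Db a c = - trilin D (jac c) a b"
proof -
  have a: "a \<in> test_functions D" and div: "\<And>x. divergence a x = 0"
    using assms(2) by (auto simp: solenoidal_tests_def)
  define \<psi> where "\<psi> i j = (\<lambda>x. a x $ j * c x $ i)" for i j
  have \<psi>: "\<psi> i j \<in> test_functions D" for i j
    unfolding \<psi>_def using test_functions_C_k[OF test_functions_component[OF assms(3)]]
    by (intro test_functions_mult test_functions_component a)
  have d\<psi>: "frechet_derivative (\<psi> i j) (at x) (axis j 1) = a x $ j * jac c x $ i $ j + jac a x $ j $ j * c x $ i" for i j x
    unfolding \<psi>_def test_product_derivative[OF test_functions_component[OF a] test_functions_component[OF assms(3)]]
      jac_component[OF a] jac_component[OF assms(3)] ..
  note int1 = weak_gradient_integrable(2)[OF assms(1) \<psi> b(2)]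
  note int2 = weak_gradient_integrable(1)[OF assms(1) \<psi> b(1)]
  have "trilin D Db a c = (LINT x|lebesgue_on D. (\<Sum>i\<in>UNIV. \<Sum>j\<in>UNIV. Db x $ i $ j * \<psi> i j x))"
    unfolding trilin_def matrix_vector_inner_eq \<psi>_def by (simp add: mult.assoc)
  also have "\<dots> = (\<Sum>i\<in>UNIV. \<Sum>j\<in>UNIV. (LINT x|lebesgue_on D. Db x $ i $ j * \<psi> i j x))"
    using int1 by simp
  also have "\<dots> = (\<Sum>i\<in>UNIV. \<Sum>j\<in>UNIV. - (LINT x|lebesgue_on D. b x $ i * frechet_derivative (\<psi> i j) (at x) (axis j 1)))"
    using b(3) \<psi> unfolding is_weak_gradient_def by simp
  also have "\<dots> = - (LINT x|lebesgue_on D. (\<Sum>i\<in>UNIV. \<Sum>j\<in>UNIV. b x $ i * frechet_derivative (\<psi> i j) (at x) (axis j 1)))"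
    using int2 by (simp add: sum_negf)
  also have "(\<lambda>x. \<Sum>i\<in>UNIV. \<Sum>j\<in>UNIV. b x $ i * frechet_derivative (\<psi> i j) (at x) (axis j 1))
    = (\<lambda>x. (jac c x *v a x) \<bullet> b x)"
  proof
    fix x
    have "(\<Sum>j\<in>UNIV. b x $ i * frechet_derivative (\<psi> i j) (at x) (axis j 1))
        = (\<Sum>j\<in>UNIV. jac c x $ i $ j * a x $ j * b x $ i) + b x $ i * c x $ i * divergence a x" for i
      unfolding d\<psi> divergence_def trace_def
      by (simp add: distrib_left sum.distrib sum_distrib_left mult_ac)
    then show "(\<Sum>i\<in>UNIV. \<Sum>j\<in>UNIV. b x $ i * frechet_derivative (\<psi> i j) (at x) (axis j 1)) = (jac c x *v a x) \<bullet> b x"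
      unfolding div matrix_vector_inner_eq by simp
  qed
  finally show ?thesis unfolding trilin_def .
qed

section \<open>Limits of solenoidal test fields\<close>

text \<open>The scalar inequality for each component, with the norm of the Jacobian as common
  gradient bound. The constant 256 is (3 + 1)^4. One factor \<open>CARD('n)\<close> comes from
  bounding the square of a sum of squares by the sum of fourth powers, the other from adding the
  component bounds.\<close>

lemma sobolev_inequality_test_field:
  fixes \<phi> :: "real^'n \<Rightarrow> real^'n"
  assumes "CARD('n) \<le> 4" "open D" and \<phi>: "\<phi> \<in> test_functions D"
  shows "Lp_int 4 D \<phi> \<le> 256 * (real CARD('n))\<^sup>2 * (Lp_int 2 D \<phi> + Lp_int 2 D (jac \<phi>))\<^sup>2"
proof -
  let ?P = "Lp_int 2 D \<phi>" and ?J = "Lp_int 2 D (jac \<phi>)" and ?N = "real CARD('n)"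
  obtain K where K: "K \<subseteq> D" "\<And>x. x \<notin> K \<Longrightarrow> \<phi> x = 0" "\<And>x. x \<notin> K \<Longrightarrow> frechet_derivative \<phi> (at x) = (\<lambda>h. 0)"
    by (rule test_functionsE[OF \<phi>]) (rule that)
  have \<phi>0: "\<phi> x = 0" and jac0: "jac \<phi> x = 0" if "x \<notin> D" for x
  proof -
    have "x \<notin> K" using K(1) that by auto
    then show "\<phi> x = 0" "jac \<phi> x = 0"
      by (simp_all add: K(2,3) jacobian_def matrix_def vec_eq_iff)
  qed
  note cont = test_functions_continuous[OF \<phi>] jac_in_Lp_space(1)[OF assms(2) \<phi>]
  have mJ: "(\<lambda>x. norm (jac \<phi> x)) \<in> borel_measurable borel"
    using cont(2) by (intro borel_measurable_continuous_onI continuous_intros)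
  have cJ: "continuous_on UNIV (\<lambda>x. (norm (jac \<phi> x))\<^sup>2)"
    using cont(2) by (intro continuous_intros)
  have J: "integrable lborel (\<lambda>x. (norm (jac \<phi> x))\<^sup>2)" "(LINT x|lborel. (norm (jac \<phi> x))\<^sup>2) = ?J"
    using lebesgue_on_eq_lborel[OF assms(2) cJ] jac_in_Lp_space(2)[OF assms(2) \<phi>, where n="num.Bit0 num.One"] jac0
    by (simp_all add: Lp_int_def Lp_space_numeral_iff)
  have \<phi>4: "integrable (lebesgue_on D) (\<lambda>x. \<phi> x $ i ^ 4)" for i
    using Lp_space_component[OF test_functions_in_Lp_space(1)[OF assms(2) \<phi>], where n="num.Bit0 (num.Bit0 num.One)" and i=i]
    by (simp add: Lp_space_numeral_iff power_even_abs)
  have comp: "(LINT x|lebesgue_on D. \<phi> x $ i ^ 4) \<le> 256 * (?P + ?J)\<^sup>2" for i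
  proof -
    note c = test_functions_component[OF \<phi>, of i]
    note cc = test_functions_continuous[OF c]
    have "(LINT x|lborel. (\<phi> x $ i)\<^sup>2) = (LINT x|lebesgue_on D. (\<phi> x $ i)\<^sup>2)"
      using \<phi>0 by (intro lebesgue_on_eq_lborel(2)[OF assms(2), symmetric] continuous_intros cc) simp
    also have "\<dots> \<le> ?P"
      unfolding Lp_int_def
    proof (rule integral_mono)
      show "integrable (lebesgue_on D) (\<lambda>x. (\<phi> x $ i)\<^sup>2)"
        using Lp_space_component[OF test_functions_in_Lp_space(1)[OF assms(2) \<phi>], where n="num.Bit0 num.One" and i=i]
        by (simp add: Lp_space_numeral_iff)
      show "integrable (lebesgue_on D) (\<lambda>x. (norm (\<phi> x))\<^sup>2)"
        using test_functions_in_Lp_space(1)[OF assms(2) \<phi>, where n="num.Bit0 num.One"] by (simp add: Lp_space_numeral_iff)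
      show "(\<phi> x $ i)\<^sup>2 \<le> (norm (\<phi> x))\<^sup>2" for x
        using power_mono[OF component_le_norm_cart[of "\<phi> x" i], of 2] by simp
    qed
    finally have P: "(LINT x|lborel. (\<phi> x $ i)\<^sup>2) \<le> ?P" .
    have "(LINT x|lebesgue_on D. \<phi> x $ i ^ 4) = (LINT x|lborel. \<phi> x $ i ^ 4)"
      using \<phi>0 by (intro lebesgue_on_eq_lborel(2)[OF assms(2)] continuous_intros cc) simp
    also have "\<dots> \<le> (3 * sqrt (LINT x|lborel. (norm (jac \<phi> x))\<^sup>2) + sqrt (LINT x|lborel. (\<phi> x $ i)\<^sup>2)) ^ 4"
    proof (rule sobolev_inequality_test_function[OF _ test_functions_mono[OF _ c] mJ J(1)])
      fix x b :: "real^'n" assume "b \<in> Basis"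
      then obtain j where j: "b = axis j 1" by (auto simp: Basis_vec_def)
      have "\<bar>jac \<phi> x $ i $ j\<bar> \<le> norm (jac \<phi> x $ i)" by (rule component_le_norm_cart)
      also have "\<dots> \<le> norm (jac \<phi> x)" by (rule Finite_Cartesian_Product.norm_nth_le)
      finally show "\<bar>frechet_derivative (\<lambda>x. \<phi> x $ i) (at x) b\<bar> \<le> norm (jac \<phi> x)"
        unfolding j jac_component[OF \<phi>] .
    qed (use assms(1) in auto)
    also have "\<dots> \<le> (4 * sqrt (?P + ?J)) ^ 4"
    proof (rule power_mono)
      have "sqrt (LINT x|lborel. (\<phi> x $ i)\<^sup>2) \<le> sqrt (?P + ?J)" using P by (simp add: add_increasing2)
      moreover have "sqrt ?J \<le> sqrt (?P + ?J)" by simp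
      ultimately show "3 * sqrt (LINT x|lborel. (norm (jac \<phi> x))\<^sup>2) + sqrt (LINT x|lborel. (\<phi> x $ i)\<^sup>2) \<le> 4 * sqrt (?P + ?J)"
        unfolding J(2) by linarith
    qed simp
    also have "\<dots> = 256 * (?P + ?J)\<^sup>2"
    proof -
      have "(4 * r) ^ 4 = 256 * (r\<^sup>2)\<^sup>2" for r :: real by (simp add: power_mult_distrib flip: power_mult)
      from this[of "sqrt (?P + ?J)"] show ?thesis
        unfolding real_sqrt_pow2[OF add_nonneg_nonneg[OF Lp_int_nonneg Lp_int_nonneg]] .
    qed
    finally show ?thesis .
  qed
  have "Lp_int 4 D \<phi> \<le> (LINT x|lebesgue_on D. ?N * (\<Sum>i\<in>UNIV. \<phi> x $ i ^ 4))"
    unfolding Lp_int_def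
  proof (rule integral_mono)
    show "integrable (lebesgue_on D) (\<lambda>x. norm (\<phi> x) ^ 4)"
      using test_functions_in_Lp_space(1)[OF assms(2) \<phi>, where n="num.Bit0 (num.Bit0 num.One)"] by (simp add: Lp_space_numeral_iff)
    show "integrable (lebesgue_on D) (\<lambda>x. ?N * (\<Sum>i\<in>UNIV. \<phi> x $ i ^ 4))"
      using \<phi>4 by simp
    fix x
    have "norm (\<phi> x) ^ 4 = ((norm (\<phi> x))\<^sup>2)\<^sup>2" by (simp flip: power_mult)
    also have "(norm (\<phi> x))\<^sup>2 = (\<Sum>i\<in>UNIV. (\<phi> x $ i)\<^sup>2)"
      by (simp add: norm_vec_def L2_set_def sum_nonneg)
    also have "(\<Sum>i\<in>UNIV. (\<phi> x $ i)\<^sup>2)\<^sup>2 \<le> ?N * (\<Sum>i\<in>UNIV. ((\<phi> x $ i)\<^sup>2)\<^sup>2)"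
      using sum_squared_le_sum_of_squares[of "\<lambda>i. (\<phi> x $ i)\<^sup>2" "UNIV::'n set"] by (simp add: mult.commute)
    finally show "norm (\<phi> x) ^ 4 \<le> ?N * (\<Sum>i\<in>UNIV. \<phi> x $ i ^ 4)" by (simp flip: power_mult)
  qed
  also have "\<dots> = ?N * (\<Sum>i\<in>UNIV. (LINT x|lebesgue_on D. \<phi> x $ i ^ 4))"
    using \<phi>4 by simp
  also have "\<dots> \<le> ?N * (\<Sum>i\<in>(UNIV::'n set). 256 * (?P + ?J)\<^sup>2)"
    by (intro mult_left_mono sum_mono comp) simp
  also have "\<dots> = 256 * ?N\<^sup>2 * (?P + ?J)\<^sup>2"
    by (simp add: power2_eq_square[of ?N])
  finally show ?thesis .
qed

text \<open>The choice in \<open>weak_gradient\<close> favours no representative, so an explicitly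
  known gradient can replace it only almost everywhere, which is enough under integrals.\<close>

lemma weak_gradient_AE_eq:
  assumes "open D" "bounded D" "Du \<in> Lp_space 2 D" "is_weak_gradient D u Du"
  shows "weak_gradient D u \<in> Lp_space 2 D" "is_weak_gradient D u (weak_gradient D u)"
    and "AE x in lebesgue_on D. weak_gradient D u x = Du x"
proof -
  have "weak_gradient D u \<in> Lp_space 2 D \<and> is_weak_gradient D u (weak_gradient D u)"
    unfolding weak_gradient_def by (rule someI[of _ Du]) (use assms in auto)
  then show *: "weak_gradient D u \<in> Lp_space 2 D" "is_weak_gradient D u (weak_gradient D u)" by auto
  show "AE x in lebesgue_on D. weak_gradient D u x = Du x"
    by (rule is_weak_gradient_unique[OF assms(1,2) *(1) assms(3) *(2) assms(4)])
qed

lemma V_space_weak_gradient: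
  assumes "u \<in> V_space D"
  shows "u \<in> Lp_space 2 D" "weak_gradient D u \<in> Lp_space 2 D" "is_weak_gradient D u (weak_gradient D u)"
proof -
  have "u \<in> H1 D" using assms by (simp add: V_space_def H10_def closure_in_def)
  then obtain Du where "u \<in> Lp_space 2 D" and Du: "Du \<in> Lp_space 2 D" "is_weak_gradient D u Du"
    by (auto simp: H1_def)
  then show "u \<in> Lp_space 2 D" by simp
  have "weak_gradient D u \<in> Lp_space 2 D \<and> is_weak_gradient D u (weak_gradient D u)"
    unfolding weak_gradient_def by (rule someI[of _ Du]) (use Du in auto)
  then show "weak_gradient D u \<in> Lp_space 2 D" "is_weak_gradient D u (weak_gradient D u)" by auto
qed

text \<open>\<open>V_space\<close> is contained in this space, whose definition already includes the \<open>L\<^sup>4\<close> convergence.\<close>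

definition V_limit :: "(real^'n) set \<Rightarrow> (real^'n \<Rightarrow> real^'n) \<Rightarrow> (real^'n \<Rightarrow> real^'n^'n) \<Rightarrow> bool" where
  "V_limit D u Du \<longleftrightarrow> u \<in> Lp_space 2 D \<and> u \<in> Lp_space 4 D \<and> Du \<in> Lp_space 2 D \<and> is_weak_gradient D u Du \<and>
    (\<exists>\<phi>. (\<forall>n. \<phi> n \<in> solenoidal_tests D) \<and> (\<lambda>n. Lp_int 4 D (\<lambda>x. u x - \<phi> n x)) \<longlonglongrightarrow> 0 \<and>
      (\<lambda>n. Lp_int 2 D (\<lambda>x. Du x - jac (\<phi> n) x)) \<longlonglongrightarrow> 0)"

lemma V_limit_lincomb:
  assumes "open D" "V_limit D u Du" "V_limit D v Dv"
  shows "V_limit D (\<lambda>x. s *\<^sub>R u x + t *\<^sub>R v x) (\<lambda>x. s *\<^sub>R Du x + t *\<^sub>R Dv x)"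
proof -
  obtain \<phi> where u: "u \<in> Lp_space 2 D" "u \<in> Lp_space 4 D" "Du \<in> Lp_space 2 D" "is_weak_gradient D u Du"
    and \<phi>: "\<And>n. \<phi> n \<in> solenoidal_tests D" "(\<lambda>n. Lp_int 4 D (\<lambda>x. u x - \<phi> n x)) \<longlonglongrightarrow> 0"
      "(\<lambda>n. Lp_int 2 D (\<lambda>x. Du x - jac (\<phi> n) x)) \<longlonglongrightarrow> 0"
    using assms(2) unfolding V_limit_def by blast
  obtain \<psi> where v: "v \<in> Lp_space 2 D" "v \<in> Lp_space 4 D" "Dv \<in> Lp_space 2 D" "is_weak_gradient D v Dv"
    and \<psi>: "\<And>n. \<psi> n \<in> solenoidal_tests D" "(\<lambda>n. Lp_int 4 D (\<lambda>x. v x - \<psi> n x)) \<longlonglongrightarrow> 0"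
      "(\<lambda>n. Lp_int 2 D (\<lambda>x. Dv x - jac (\<psi> n) x)) \<longlonglongrightarrow> 0"
    using assms(3) unfolding V_limit_def by blast
  have tf: "\<phi> n \<in> test_functions D" "\<psi> n \<in> test_functions D" for n
    using \<phi>(1) \<psi>(1) by (auto simp: solenoidal_tests_def)
  let ?\<chi> = "\<lambda>n x. s *\<^sub>R \<phi> n x + t *\<^sub>R \<psi> n x"
  have 4: "(\<lambda>n. Lp_int 4 D (\<lambda>x. (s *\<^sub>R u x + t *\<^sub>R v x) - ?\<chi> n x)) \<longlonglongrightarrow> 0"
  proof (rule Lim_null_comparison[OF always_eventually])
    let ?b = "\<lambda>n. 2 ^ 4 * (\<bar>s\<bar> ^ 4 * Lp_int 4 D (\<lambda>x. u x - \<phi> n x) + \<bar>t\<bar> ^ 4 * Lp_int 4 D (\<lambda>x. v x - \<psi> n x))"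
    have "(s *\<^sub>R u x + t *\<^sub>R v x) - ?\<chi> n x = s *\<^sub>R (u x - \<phi> n x) + t *\<^sub>R (v x - \<psi> n x)" for n x
      by (simp add: algebra_simps)
    then show "\<forall>n. norm (Lp_int 4 D (\<lambda>x. (s *\<^sub>R u x + t *\<^sub>R v x) - ?\<chi> n x)) \<le> ?b n"
      using Lp_int_lincomb_le[OF Lp_space_diff[OF u(2) test_functions_in_Lp_space(1)[OF assms(1) tf(1)]]
          Lp_space_diff[OF v(2) test_functions_in_Lp_space(1)[OF assms(1) tf(2)]], where s=s and t=t] by simp
    have "?b \<longlonglongrightarrow> 2 ^ 4 * (\<bar>s\<bar> ^ 4 * 0 + \<bar>t\<bar> ^ 4 * 0)"
      by (intro tendsto_mult tendsto_add tendsto_const \<phi>(2) \<psi>(2))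
    then show "?b \<longlonglongrightarrow> 0" by simp
  qed
  have 2: "(\<lambda>n. Lp_int 2 D (\<lambda>x. (s *\<^sub>R Du x + t *\<^sub>R Dv x) - jac (?\<chi> n) x)) \<longlonglongrightarrow> 0"
  proof (rule Lim_null_comparison[OF always_eventually])
    let ?b = "\<lambda>n. 2 ^ 2 * (\<bar>s\<bar> ^ 2 * Lp_int 2 D (\<lambda>x. Du x - jac (\<phi> n) x) + \<bar>t\<bar> ^ 2 * Lp_int 2 D (\<lambda>x. Dv x - jac (\<psi> n) x))"
    have "(s *\<^sub>R Du x + t *\<^sub>R Dv x) - jac (?\<chi> n) x = s *\<^sub>R (Du x - jac (\<phi> n) x) + t *\<^sub>R (Dv x - jac (\<psi> n) x)" for n x
      unfolding jac_lincomb[OF tf] by (simp add: algebra_simps)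
    then show "\<forall>n. norm (Lp_int 2 D (\<lambda>x. (s *\<^sub>R Du x + t *\<^sub>R Dv x) - jac (?\<chi> n) x)) \<le> ?b n"
      using Lp_int_lincomb_le[OF Lp_space_diff[OF u(3) jac_in_Lp_space(2)[OF assms(1) tf(1)]]
          Lp_space_diff[OF v(3) jac_in_Lp_space(2)[OF assms(1) tf(2)]], where s=s and t=t] by simp
    have "?b \<longlonglongrightarrow> 2 ^ 2 * (\<bar>s\<bar> ^ 2 * 0 + \<bar>t\<bar> ^ 2 * 0)"
      by (intro tendsto_mult tendsto_add tendsto_const \<phi>(3) \<psi>(3))
    then show "?b \<longlonglongrightarrow> 0" by simp
  qed
  show ?thesis
    unfolding V_limit_def
    using Lp_space_lincomb[OF u(1) v(1), where s=s and t=t] Lp_space_lincomb[OF u(2) v(2), where s=s and t=t] Lp_space_lincomb[OF u(3) v(3), where s=s and t=t]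
      is_weak_gradient_lincomb[OF assms(1) u(1) v(1) u(3) v(3) u(4) v(4), where s=s and t=t]
      solenoidal_tests_lincomb[OF \<phi>(1) \<psi>(1), where s=s and t=t] 2 4
    by (intro conjI exI[of _ ?\<chi>]) auto
qed

text \<open>\<open>b\<close> is never approximated, since its weak gradient can be tested directly.
  First \<open>a\<close> is approximated in L^4 with a smooth third argument held fixed. Then
  \<open>c\<close> is approximated: the left-hand side uses L^4 convergence of the fields, the
  right-hand side L^2 convergence of their Jacobians.\<close>

lemma V_limit_skew:
  assumes "open D" "V_limit D a Da" "V_limit D b Db" "V_limit D c Dc"
  shows "trilin D Db a c = - trilin D Dc a b"
proof -
  obtain \<phi> where a: "a \<in> Lp_space 4 D"
    and \<phi>: "\<And>n. \<phi> n \<in> solenoidal_tests D" "(\<lambda>n. Lp_int 4 D (\<lambda>x. a x - \<phi> n x)) \<longlonglongrightarrow> 0"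
    using assms(2) unfolding V_limit_def by blast
  have b: "b \<in> Lp_space 2 D" "b \<in> Lp_space 4 D" "Db \<in> Lp_space 2 D" "is_weak_gradient D b Db"
    using assms(3) unfolding V_limit_def by blast+
  obtain \<psi> where c: "c \<in> Lp_space 4 D" "Dc \<in> Lp_space 2 D"
    and \<psi>: "\<And>n. \<psi> n \<in> solenoidal_tests D" "(\<lambda>n. Lp_int 4 D (\<lambda>x. c x - \<psi> n x)) \<longlonglongrightarrow> 0"
      "(\<lambda>n. Lp_int 2 D (\<lambda>x. Dc x - jac (\<psi> n) x)) \<longlonglongrightarrow> 0"
    using assms(4) unfolding V_limit_def by blast
  have t: "\<phi> n \<in> test_functions D" "\<psi> n \<in> test_functions D" for n
    using \<phi>(1) \<psi>(1) by (auto simp: solenoidal_tests_def)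
  note t4 = test_functions_in_Lp_space(1)[OF assms(1) t(1)] test_functions_in_Lp_space(1)[OF assms(1) t(2)]
  note j2 = jac_in_Lp_space(2)[OF assms(1) t(2)]
  have "trilin D Db a (\<psi> m) = - trilin D (jac (\<psi> m)) a b" for m
  proof (rule LIMSEQ_unique)
    show "(\<lambda>n. trilin D Db (\<phi> n) (\<psi> m)) \<longlonglongrightarrow> trilin D Db a (\<psi> m)"
      by (rule trilin_tendsto_2[OF b(3) a t4(1) t4(2) \<phi>(2)])
    have "(\<lambda>n. - trilin D (jac (\<psi> m)) (\<phi> n) b) \<longlonglongrightarrow> - trilin D (jac (\<psi> m)) a b"
      by (rule tendsto_minus[OF trilin_tendsto_2[OF j2 a t4(1) b(2) \<phi>(2)]])
    then show "(\<lambda>n. trilin D Db (\<phi> n) (\<psi> m)) \<longlonglongrightarrow> - trilin D (jac (\<psi> m)) a b"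
      unfolding trilin_test_skew[OF assms(1) \<phi>(1) t(2) b(1,3,4)] .
  qed
  then have "(\<lambda>m. - trilin D (jac (\<psi> m)) a b) \<longlonglongrightarrow> trilin D Db a c"
    using trilin_tendsto_3[OF b(3) a t4(2) c(1) \<psi>(2)] by simp
  moreover have "(\<lambda>m. - trilin D (jac (\<psi> m)) a b) \<longlonglongrightarrow> - trilin D Dc a b"
    by (rule tendsto_minus[OF trilin_tendsto_1[OF c(2) j2 a b(2) \<psi>(3)]])
  ultimately show ?thesis by (rule LIMSEQ_unique)
qed

text \<open>Convergence in L^2 yields a subsequence converging almost everywhere, and Fatou's lemma
  hands the uniform L^4 bound on the differences to the limit. This identifies the L^4 limit with
  \<open>u\<close> without completeness of L^4.\<close>

lemma L4_limit_of_Cauchy: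
  fixes u :: "'a::euclidean_space \<Rightarrow> 'b::euclidean_space"
  assumes u: "u \<in> Lp_space 2 D" and \<phi>2: "\<And>n. \<phi> n \<in> Lp_space 2 D" and \<phi>4: "\<And>n. \<phi> n \<in> Lp_space 4 D"
    and lim: "(\<lambda>n. Lp_int 2 D (\<lambda>x. u x - \<phi> n x)) \<longlonglongrightarrow> 0"
    and bound: "\<And>m. n \<le> m \<Longrightarrow> Lp_int 4 D (\<lambda>x. \<phi> m x - \<phi> n x) \<le> K"
  shows "(\<lambda>x. u x - \<phi> n x) \<in> Lp_space 4 D" and "Lp_int 4 D (\<lambda>x. u x - \<phi> n x) \<le> K"
proof -
  have [measurable]: "u \<in> borel_measurable (lebesgue_on D)" "\<phi> m \<in> borel_measurable (lebesgue_on D)" for m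
    using u \<phi>2[of m] by (auto intro: Lp_space_measurable)
  have K0: "0 \<le> K" using bound[of n] Lp_int_nonneg order_trans by blast
  have "\<exists>r. strict_mono r \<and> (AE x in lebesgue_on D. (\<lambda>k. (norm (u x - \<phi> (r k) x))\<^sup>2) \<longlonglongrightarrow> 0)"
  proof (rule tendsto_L1_AE_subseq)
    show "integrable (lebesgue_on D) (\<lambda>x. (norm (u x - \<phi> m x))\<^sup>2)" for m
      using Lp_space_diff[OF u \<phi>2[of m]] by (simp add: Lp_space_numeral_iff)
    show "(\<lambda>m. LINT x|lebesgue_on D. norm ((norm (u x - \<phi> m x))\<^sup>2)) \<longlonglongrightarrow> 0"
      using lim by (simp add: Lp_int_def)
  qed
  then obtain r where r: "strict_mono r" and ae: "AE x in lebesgue_on D. (\<lambda>k. (norm (u x - \<phi> (r k) x))\<^sup>2) \<longlonglongrightarrow> 0"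
    by blast
  have "AE x in lebesgue_on D. ennreal (norm (u x - \<phi> n x) ^ 4) = liminf (\<lambda>k. ennreal (norm (\<phi> (r k) x - \<phi> n x) ^ 4))"
    using ae
  proof eventually_elim
    case (elim x)
    have "(\<lambda>k. sqrt ((norm (u x - \<phi> (r k) x))\<^sup>2)) \<longlonglongrightarrow> sqrt 0"
      by (rule tendsto_real_sqrt[OF elim])
    then have "(\<lambda>k. u x - \<phi> (r k) x) \<longlonglongrightarrow> 0"
      by - (rule tendsto_norm_zero_cancel, simp)
    from tendsto_diff[OF tendsto_const[of "u x"] this] have "(\<lambda>k. \<phi> (r k) x) \<longlonglongrightarrow> u x" by simp
    then have "(\<lambda>k. ennreal (norm (\<phi> (r k) x - \<phi> n x) ^ 4)) \<longlonglongrightarrow> ennreal (norm (u x - \<phi> n x) ^ 4)"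
      by (intro tendsto_ennrealI tendsto_power tendsto_norm tendsto_diff tendsto_const)
    then show ?case by (rule lim_imp_Liminf[OF trivial_limit_sequentially, symmetric])
  qed
  then have "(\<integral>\<^sup>+x. ennreal (norm (u x - \<phi> n x) ^ 4) \<partial>lebesgue_on D)
      = (\<integral>\<^sup>+x. liminf (\<lambda>k. ennreal (norm (\<phi> (r k) x - \<phi> n x) ^ 4)) \<partial>lebesgue_on D)"
    by (rule nn_integral_cong_AE)
  also have "\<dots> \<le> liminf (\<lambda>k. \<integral>\<^sup>+x. ennreal (norm (\<phi> (r k) x - \<phi> n x) ^ 4) \<partial>lebesgue_on D)"
    by (rule nn_integral_liminf) measurable
  also have "\<dots> \<le> ennreal K"
  proof (rule Liminf_le)
    have "(\<integral>\<^sup>+x. ennreal (norm (\<phi> (r k) x - \<phi> n x) ^ 4) \<partial>lebesgue_on D) \<le> ennreal K" if "n \<le> k" for k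
    proof -
      have "integrable (lebesgue_on D) (\<lambda>x. norm (\<phi> (r k) x - \<phi> n x) ^ 4)"
        using Lp_space_diff[OF \<phi>4[of "r k"] \<phi>4[of n]] by (simp add: Lp_space_numeral_iff)
      then have "(\<integral>\<^sup>+x. ennreal (norm (\<phi> (r k) x - \<phi> n x) ^ 4) \<partial>lebesgue_on D) = ennreal (Lp_int 4 D (\<lambda>x. \<phi> (r k) x - \<phi> n x))"
        unfolding Lp_int_def by (intro nn_integral_eq_integral) auto
      \<comment> \<open>A strictly increasing \<open>r\<close> satisfies k \<le> r k, so indices
        past \<open>n\<close> remain past \<open>n\<close> along the subsequence.\<close>
      also have "\<dots> \<le> ennreal K"
        using seq_suble[OF r, of k] that by (intro ennreal_leI bound) simp
      finally show ?thesis .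
    qed
    then show "\<forall>\<^sub>F k in sequentially. (\<integral>\<^sup>+x. ennreal (norm (\<phi> (r k) x - \<phi> n x) ^ 4) \<partial>lebesgue_on D) \<le> ennreal K"
      by (auto simp: eventually_sequentially)
  qed simp
  finally have le: "(\<integral>\<^sup>+x. ennreal (norm (u x - \<phi> n x) ^ 4) \<partial>lebesgue_on D) \<le> ennreal K" .
  have i: "integrable (lebesgue_on D) (\<lambda>x. norm (u x - \<phi> n x) ^ 4)"
    using le by (intro integrableI_nonneg) (auto simp: less_top[symmetric] top_unique)
  then show "(\<lambda>x. u x - \<phi> n x) \<in> Lp_space 4 D" by (simp add: Lp_space_numeral_iff)
  have "(\<integral>\<^sup>+x. ennreal (norm (u x - \<phi> n x) ^ 4) \<partial>lebesgue_on D) = ennreal (Lp_int 4 D (\<lambda>x. u x - \<phi> n x))"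
    unfolding Lp_int_def using i by (intro nn_integral_eq_integral) auto
  with le K0 show "Lp_int 4 D (\<lambda>x. u x - \<phi> n x) \<le> K" by simp
qed

text \<open>The definition of \<open>H1_norm\<close> chooses a gradient for the difference afresh;
  uniqueness replaces it by the difference of the given gradients.\<close>

lemma H1_norm_diff_test:
  assumes "open D" "bounded D" "\<phi> \<in> test_functions D"
    and u: "u \<in> Lp_space 2 D" "Du \<in> Lp_space 2 D" "is_weak_gradient D u Du"
  shows "(H1_norm D (u - \<phi>))\<^sup>2 = Lp_int 2 D (\<lambda>x. u x - \<phi> x) + Lp_int 2 D (\<lambda>x. Du x - jac \<phi> x)"
proof -
  have eq: "u - \<phi> = (\<lambda>x. u x - \<phi> x)" by auto
  have J: "jac \<phi> \<in> Lp_space 2 D" by (rule jac_in_Lp_space(2)[OF assms(1,3)])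
  have D2: "(\<lambda>x. Du x - jac \<phi> x) \<in> Lp_space 2 D" by (intro Lp_space_diff u J)
  have "is_weak_gradient D (\<lambda>x. u x - \<phi> x) (\<lambda>x. Du x - jac \<phi> x)"
    using is_weak_gradient_lincomb[OF assms(1) u(1) test_functions_in_Lp_space(1)[OF assms(1,3)] u(2) J u(3)
      is_weak_gradient_jac[OF assms(1,3)], where s=1 and t="-1"] by simp
  note wg = weak_gradient_AE_eq[OF assms(1,2) D2 this]
  have "Lp_int 2 D (weak_gradient D (\<lambda>x. u x - \<phi> x)) = Lp_int 2 D (\<lambda>x. Du x - jac \<phi> x)"
    by (rule Lp_int_cong_AE[OF wg(3) Lp_space_measurable[OF wg(1)] Lp_space_measurable[OF D2]])
  then show ?thesis
    unfolding H1_norm_def eq Lp_norm_2 by simp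
qed

text \<open>The bound on the dimension enters here. Test fields approximating \<open>u\<close> in
  the \<open>H1_norm\<close> are Cauchy in L^4, by the Sobolev inequality applied to their
  differences, which are test fields themselves.\<close>

lemma V_space_V_limit:
  fixes D :: "(real^'n) set"
  assumes dim: "CARD('n) \<le> 4" and "open D" "bounded D" and uV: "u \<in> V_space D"
  shows "V_limit D u (weak_gradient D u)"
proof -
  let ?Du = "weak_gradient D u"
  note u = V_space_weak_gradient[OF uV]
  \<comment> \<open>A decreasing tolerance, so that the distance of two approximants is governed by
    the smaller index alone, as \<open>L4_limit_of_Cauchy\<close> requires.\<close>
  define e where "e n = 1 / real (Suc n)" for n
  have e: "0 < e n" "m \<le> n \<Longrightarrow> e n \<le> e m" for m n
    by (auto simp: e_def intro!: divide_left_mono)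
  have e0: "e \<longlonglongrightarrow> 0"
    unfolding e_def using LIMSEQ_inverse_real_of_nat by (simp add: inverse_eq_divide)
  have "\<forall>n. \<exists>\<phi>\<in>solenoidal_tests D. H1_norm D (u - \<phi>) < e n"
    using uV e(1) unfolding V_space_def closure_in_def by blast
  then obtain \<phi> where \<phi>: "\<And>n. \<phi> n \<in> solenoidal_tests D" "\<And>n. H1_norm D (u - \<phi> n) < e n"
    by metis
  have tf: "\<phi> n \<in> test_functions D" for n using \<phi>(1) by (auto simp: solenoidal_tests_def)
  let ?A = "\<lambda>n. Lp_int 2 D (\<lambda>x. u x - \<phi> n x)" and ?B = "\<lambda>n. Lp_int 2 D (\<lambda>x. ?Du x - jac (\<phi> n) x)"
  have AB: "?A n + ?B n \<le> (e n)\<^sup>2" for n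
    unfolding H1_norm_diff_test[OF assms(2,3) tf u, symmetric]
    using \<phi>(2)[of n] by (intro power_mono) (auto simp: H1_norm_def)
  have A: "?A n \<le> (e n)\<^sup>2" and B: "?B n \<le> (e n)\<^sup>2" for n
    using AB[of n] Lp_int_nonneg[of 2 D "\<lambda>x. u x - \<phi> n x"] Lp_int_nonneg[of 2 D "\<lambda>x. ?Du x - jac (\<phi> n) x"] by linarith+
  have e20: "(\<lambda>n. (e n)\<^sup>2) \<longlonglongrightarrow> 0" using tendsto_power[OF e0, of 2] by simp
  have A0: "?A \<longlonglongrightarrow> 0" and B0: "?B \<longlonglongrightarrow> 0"
    by (rule Lim_null_comparison[OF always_eventually e20], simp add: A B)+
  note L2 = test_functions_in_Lp_space(1)[OF assms(2) tf] and J2 = jac_in_Lp_space(2)[OF assms(2) tf]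
  \<comment> \<open>The Sobolev bound for a difference: the squared L^2 distances of fields and
    Jacobians add up to at most 4 (e m)^2 + 4 (e n)^2, hence to at most 8 (e n)^2 when n \<le>
    m.\<close>
  define K where "K n = 256 * (real CARD('n))\<^sup>2 * (8 * (e n)\<^sup>2)\<^sup>2" for n
  have Cauchy: "Lp_int 4 D (\<lambda>x. \<phi> m x - \<phi> n x) \<le> K n" if "n \<le> m" for m n
  proof -
    have em: "(e m)\<^sup>2 \<le> (e n)\<^sup>2" using e(2)[OF that] e(1)[of m] by (intro power_mono) auto
    have s: "(\<lambda>x. \<phi> m x - \<phi> n x) \<in> test_functions D"
      using solenoidal_tests_lincomb[OF \<phi>(1) \<phi>(1), of 1 m "-1" n] by (simp add: solenoidal_tests_def)
    have j: "jac (\<lambda>x. \<phi> m x - \<phi> n x) = (\<lambda>x. jac (\<phi> m) x - jac (\<phi> n) x)"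
      using jac_lincomb[OF tf tf, of 1 m "-1" n] by simp
    have "Lp_int 2 D (\<lambda>x. \<phi> m x - \<phi> n x) \<le> 2 ^ 2 * (?A m + ?A n)"
      using Lp_int_diff_triangle[OF L2 u(1) L2, of m n] unfolding Lp_int_minus_commute[of 2 D "\<phi> m" u] .
    moreover have "Lp_int 2 D (\<lambda>x. jac (\<phi> m) x - jac (\<phi> n) x) \<le> 2 ^ 2 * (?B m + ?B n)"
      using Lp_int_diff_triangle[OF J2 u(2) J2, of m n] unfolding Lp_int_minus_commute[of 2 D "jac (\<phi> m)" ?Du] .
    ultimately have "Lp_int 2 D (\<lambda>x. \<phi> m x - \<phi> n x) + Lp_int 2 D (jac (\<lambda>x. \<phi> m x - \<phi> n x)) \<le> 8 * (e n)\<^sup>2"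
      unfolding j using AB[of m] AB[of n] em by simp
    then have "(Lp_int 2 D (\<lambda>x. \<phi> m x - \<phi> n x) + Lp_int 2 D (jac (\<lambda>x. \<phi> m x - \<phi> n x)))\<^sup>2 \<le> (8 * (e n)\<^sup>2)\<^sup>2"
      by (intro power_mono) auto
    with sobolev_inequality_test_field[OF dim assms(2) s] show ?thesis
      unfolding K_def by (elim order_trans) (intro mult_left_mono, auto)
  qed
  note lim4 = L4_limit_of_Cauchy[OF u(1) L2 L2 A0 Cauchy]
  have "(\<lambda>x. 1 *\<^sub>R (u x - \<phi> 0 x) + 1 *\<^sub>R \<phi> 0 x) \<in> Lp_space 4 D"
    by (rule Lp_space_lincomb[OF lim4(1) L2])
  then have u4: "u \<in> Lp_space 4 D" by simp
  have "K \<longlonglongrightarrow> 256 * (real CARD('n))\<^sup>2 * (8 * 0)\<^sup>2"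
    unfolding K_def by (intro tendsto_mult tendsto_power tendsto_const e20)
  then have K0: "K \<longlonglongrightarrow> 0" by simp
  have "(\<lambda>n. Lp_int 4 D (\<lambda>x. u x - \<phi> n x)) \<longlonglongrightarrow> 0"
    by (rule Lim_null_comparison[OF always_eventually K0]) (simp add: lim4(2))
  then show ?thesis
    unfolding V_limit_def using u u4 \<phi>(1) B0 by blast
qed

section \<open>The values of G as bounded linear functionals\<close>

lemma integral_inner_weak_gradient_lincomb:
  fixes v w :: "real^'n \<Rightarrow> real^'n"
  assumes D: "open D" "bounded D" and M: "M \<in> Lp_space 2 D"
    and v: "v \<in> Lp_space 2 D" "Dv \<in> Lp_space 2 D" "is_weak_gradient D v Dv"
    and w: "w \<in> Lp_space 2 D" "Dw \<in> Lp_space 2 D" "is_weak_gradient D w Dw"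
  shows "(LINT x|lebesgue_on D. M x \<bullet> weak_gradient D (\<lambda>x. s *\<^sub>R v x + t *\<^sub>R w x) x)
    = s * (LINT x|lebesgue_on D. M x \<bullet> Dv x) + t * (LINT x|lebesgue_on D. M x \<bullet> Dw x)"
proof -
  have L: "(\<lambda>x. s *\<^sub>R Dv x + t *\<^sub>R Dw x) \<in> Lp_space 2 D" by (rule Lp_space_lincomb[OF v(2) w(2)])
  note wg = weak_gradient_AE_eq[OF D L is_weak_gradient_lincomb[OF D(1) v(1) w(1) v(2) w(2) v(3) w(3)]]
  note [measurable] = Lp_space_measurable[OF M] Lp_space_measurable[OF wg(1)] Lp_space_measurable[OF v(2)] Lp_space_measurable[OF w(2)]
  \<comment> \<open>The gradient chosen for the combination is unrelated to those of
    \<open>v\<close> and \<open>w\<close> off a conull set, so linearity is restored only under the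
    integral.\<close>
  have "(LINT x|lebesgue_on D. M x \<bullet> weak_gradient D (\<lambda>x. s *\<^sub>R v x + t *\<^sub>R w x) x)
    = (LINT x|lebesgue_on D. s * (M x \<bullet> Dv x) + t * (M x \<bullet> Dw x))"
  proof (rule integral_cong_AE)
    show "AE x in lebesgue_on D. M x \<bullet> weak_gradient D (\<lambda>x. s *\<^sub>R v x + t *\<^sub>R w x) x = s * (M x \<bullet> Dv x) + t * (M x \<bullet> Dw x)"
      using wg(3) by eventually_elim (simp add: inner_add_right)
  qed measurable
  also have "\<dots> = s * (LINT x|lebesgue_on D. M x \<bullet> Dv x) + t * (LINT x|lebesgue_on D. M x \<bullet> Dw x)"
    using inner_integrable_L2(1)[OF M v(2)] inner_integrable_L2(1)[OF M w(2)] by simp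
  finally show ?thesis .
qed

text \<open>Pair |u| |u| with |u| |w| in L^2. The coefficient in the bound is the cube of the L^4
  norm of \<open>u\<close>, written with square roots.\<close>

lemma C_op_integrable:
  fixes u w :: "real^'n \<Rightarrow> real^'n"
  assumes "u \<in> Lp_space 4 D" "w \<in> Lp_space 4 D"
  shows "integrable (lebesgue_on D) (\<lambda>x. (norm (u x))\<^sup>2 * (u x \<bullet> w x))"
    and "\<bar>C_op D u w\<bar> \<le> sqrt (Lp_int 4 D u) * sqrt (sqrt (Lp_int 4 D u)) * Lp_norm 4 D w"
proof -
  note [measurable] = Lp_space_measurable[OF assms(1)] Lp_space_measurable[OF assms(2)]
  note uu = norm_mult_L4[OF assms(1,1)] and uw = norm_mult_L4[OF assms(1,2)]
  note i = inner_integrable_L2[OF uu(1) uw(1), unfolded inner_real_def]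
  have le: "\<bar>(norm (u x))\<^sup>2 * (u x \<bullet> w x)\<bar> \<le> (norm (u x) * norm (u x)) * (norm (u x) * norm (w x))" for x
    unfolding abs_mult by (simp add: power2_eq_square mult_left_mono Cauchy_Schwarz_ineq2)
  show j: "integrable (lebesgue_on D) (\<lambda>x. (norm (u x))\<^sup>2 * (u x \<bullet> w x))"
    by (rule Bochner_Integration.integrable_bound[OF i(1)]) (use le in \<open>auto simp: abs_mult\<close>)
  have "\<bar>C_op D u w\<bar> \<le> (LINT x|lebesgue_on D. \<bar>(norm (u x))\<^sup>2 * (u x \<bullet> w x)\<bar>)"
    unfolding C_op_def by (rule integral_abs_bound)
  also have "\<dots> \<le> (LINT x|lebesgue_on D. (norm (u x) * norm (u x)) * (norm (u x) * norm (w x)))"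
    by (intro integral_mono i(1) integrable_abs j le)
  also have "\<dots> \<le> sqrt (Lp_int 2 D (\<lambda>x. norm (u x) * norm (u x))) * sqrt (Lp_int 2 D (\<lambda>x. norm (u x) * norm (w x)))"
    using i(2) by linarith
  also have "\<dots> \<le> sqrt (sqrt (Lp_int 4 D u) * sqrt (Lp_int 4 D u)) * sqrt (sqrt (Lp_int 4 D u) * sqrt (Lp_int 4 D w))"
    using uu(2) uw(2) by (intro mult_mono real_sqrt_le_mono) auto
  also have "\<dots> = sqrt (Lp_int 4 D u) * sqrt (sqrt (Lp_int 4 D u)) * Lp_norm 4 D w"
    by (simp add: Lp_norm_4 real_sqrt_mult)
  finally show "\<bar>C_op D u w\<bar> \<le> sqrt (Lp_int 4 D u) * sqrt (sqrt (Lp_int 4 D u)) * Lp_norm 4 D w" .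
qed

lemma B_op_eq_trilin: "B_op D u w = trilin D (weak_gradient D u) u w"
  by (simp add: B_op_def trilin_def)

lemma L4_sol_Lp: "u \<in> L4_sol D \<Longrightarrow> u \<in> Lp_space 4 D"
  by (simp add: L4_sol_def closure_in_def)

text \<open>\<open>A_op\<close> is bounded by the gradient norm alone, \<open>B_op\<close> and
  \<open>C_op\<close> by the L^4 norm alone, which is why the sum of the two norms controls
  \<open>G_op\<close>.\<close>

lemma G_op_in_V_L4_dual:
  assumes D: "open D" "bounded D" and "0 < \<mu>" "0 < \<beta>" and uV: "u \<in> V_space D" "u \<in> L4_sol D"
  shows "G_op \<mu> \<beta> D u \<in> V_L4_dual D"
  unfolding V_L4_dual_def dual_space_def
proof (intro CollectI conjI ballI allI)
  let ?Du = "weak_gradient D u"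
  note u = V_space_weak_gradient[OF uV(1)] and u4 = L4_sol_Lp[OF uV(2)]
  {
    fix v w and a b :: real
    assume vw: "v \<in> V_space D \<inter> L4_sol D" "w \<in> V_space D \<inter> L4_sol D"
    then have vV: "v \<in> V_space D" and wV: "w \<in> V_space D" by auto
    have v4: "v \<in> Lp_space 4 D" and w4: "w \<in> Lp_space 4 D" using vw L4_sol_Lp by blast+
    have "A_op D u (\<lambda>x. a *\<^sub>R v x + b *\<^sub>R w x) = a * A_op D u v + b * A_op D u w"
      unfolding A_op_def by (rule integral_inner_weak_gradient_lincomb[OF D u(2) V_space_weak_gradient[OF vV] V_space_weak_gradient[OF wV]])
    moreover have "B_op D u (\<lambda>x. a *\<^sub>R v x + b *\<^sub>R w x) = a * B_op D u v + b * B_op D u w"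
      unfolding B_op_eq_trilin by (rule trilin_lincomb_3[OF u(2) u4 v4 w4])
    moreover have "C_op D u (\<lambda>x. a *\<^sub>R v x + b *\<^sub>R w x) = a * C_op D u v + b * C_op D u w"
    proof -
      have "C_op D u (\<lambda>x. a *\<^sub>R v x + b *\<^sub>R w x)
        = (LINT x|lebesgue_on D. a * ((norm (u x))\<^sup>2 * (u x \<bullet> v x)) + b * ((norm (u x))\<^sup>2 * (u x \<bullet> w x)))"
        unfolding C_op_def by (simp add: inner_add_right algebra_simps)
      then show ?thesis
        unfolding C_op_def using C_op_integrable(1)[OF u4 v4] C_op_integrable(1)[OF u4 w4] by simp
    qed
    ultimately show "G_op \<mu> \<beta> D u (\<lambda>x. a *\<^sub>R v x + b *\<^sub>R w x) = a * G_op \<mu> \<beta> D u v + b * G_op \<mu> \<beta> D u w"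
      by (simp add: G_op_def algebra_simps)
  }
  let ?A = "sqrt (Lp_int 2 D ?Du)" and ?B = "sqrt (Lp_int 2 D ?Du) * sqrt (sqrt (Lp_int 4 D u))"
    and ?C = "sqrt (Lp_int 4 D u) * sqrt (sqrt (Lp_int 4 D u))"
  show "\<exists>C. \<forall>w\<in>V_space D \<inter> L4_sol D. \<bar>G_op \<mu> \<beta> D u w\<bar> \<le> C * (V_norm D w + Lp_norm 4 D w)"
  proof (intro exI ballI)
    fix w assume w: "w \<in> V_space D \<inter> L4_sol D"
    then have wV: "w \<in> V_space D" and w4: "w \<in> Lp_space 4 D" using L4_sol_Lp by auto
    let ?v = "V_norm D w" and ?l = "Lp_norm 4 D w"
    have nn: "0 \<le> ?v" "0 \<le> ?l" by (auto simp: V_norm_def Lp_norm_def)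
    have a: "\<bar>A_op D u w\<bar> \<le> ?A * ?v"
      using inner_integrable_L2(2)[OF u(2) V_space_weak_gradient(2)[OF wV]] by (simp add: A_op_def V_norm_def Lp_norm_2)
    have b: "\<bar>B_op D u w\<bar> \<le> ?B * ?l"
      using trilin_integrable(2)[OF u(2) u4 w4] by (simp add: B_op_eq_trilin Lp_norm_4 real_sqrt_mult)
    have c: "\<bar>C_op D u w\<bar> \<le> ?C * ?l" by (rule C_op_integrable(2)[OF u4 w4])
    have "\<bar>G_op \<mu> \<beta> D u w\<bar> \<le> \<mu> * \<bar>A_op D u w\<bar> + \<bar>B_op D u w\<bar> + \<beta> * \<bar>C_op D u w\<bar>"
      using assms(3,4) abs_triangle_ineq[of "\<mu> * A_op D u w + B_op D u w" "\<beta> * C_op D u w"]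
        abs_triangle_ineq[of "\<mu> * A_op D u w" "B_op D u w"]
      by (simp add: G_op_def abs_mult)
    also have "\<dots> \<le> \<mu> * (?A * ?v) + ?B * ?l + \<beta> * (?C * ?l)"
      using a b c assms(3,4) by (intro add_mono mult_left_mono) auto
    also have "\<dots> \<le> \<mu> * (?A * (?v + ?l)) + ?B * (?v + ?l) + \<beta> * (?C * (?v + ?l))"
      using nn assms(3,4) by (intro add_mono mult_left_mono) auto
    also have "\<dots> = (\<mu> * ?A + ?B + \<beta> * ?C) * (?v + ?l)" by (simp add: algebra_simps)
    finally show "\<bar>G_op \<mu> \<beta> D u w\<bar> \<le> (\<mu> * ?A + ?B + \<beta> * ?C) * (?v + ?l)" .
  qed
qed

section \<open>Monotonicity\<close>

lemma monotone_integrand_nonneg: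
  fixes M :: "real^'n^'n" and u v :: "real^'n"
  assumes "0 < \<mu>" "0 < \<beta>" "2 * \<beta> * \<mu> \<ge> 1"
  defines "w \<equiv> u - v" and "s \<equiv> (1/2) *\<^sub>R u + (1/2) *\<^sub>R v"
  shows "0 \<le> \<mu> * (norm M)\<^sup>2 - (M *v w) \<bullet> s + \<beta> * ((norm u)\<^sup>2 * (u \<bullet> w) - (norm v)\<^sup>2 * (v \<bullet> w))"
proof -
  let ?a = "norm M" and ?t = "norm w * norm s"
  have "(M *v w) \<bullet> s \<le> norm (M *v w) * norm s" by (rule norm_cauchy_schwarz)
  also have "\<dots> \<le> (norm M * norm w) * norm s" by (intro mult_right_mono norm_matrix_vector_mult_le) simp
  finally have 1: "(M *v w) \<bullet> s \<le> ?a * ?t" by (simp add: mult.assoc)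
  have w2: "(norm w)\<^sup>2 = (norm u)\<^sup>2 - 2 * (u \<bullet> v) + (norm v)\<^sup>2"
    unfolding w_def power2_norm_eq_inner by (simp add: inner_diff_left inner_diff_right inner_commute)
  have s2: "4 * (norm s)\<^sup>2 = (norm u)\<^sup>2 + 2 * (u \<bullet> v) + (norm v)\<^sup>2"
    unfolding s_def power2_norm_eq_inner by (simp add: inner_add_left inner_add_right inner_commute)
  \<comment> \<open>Polarisation: twice u \<bullet> w is |u|^2 - |v|^2 + |w|^2, and twice v
    \<bullet> w is |u|^2 - |v|^2 - |w|^2.\<close>
  have C: "(norm u)\<^sup>2 * (u \<bullet> w) - (norm v)\<^sup>2 * (v \<bullet> w)
    = (1/2) * ((norm u)\<^sup>2 + (norm v)\<^sup>2) * (norm w)\<^sup>2 + (1/2) * ((norm u)\<^sup>2 - (norm v)\<^sup>2)\<^sup>2"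
    unfolding w2 by (simp add: w_def inner_diff_right inner_commute power2_norm_eq_inner[symmetric] power2_eq_square field_simps)
  \<comment> \<open>Parallelogram law: 4 |s|^2 + |w|^2 is 2 (|u|^2 + |v|^2).\<close>
  have "(norm s)\<^sup>2 \<le> (1/2) * ((norm u)\<^sup>2 + (norm v)\<^sup>2)"
  proof -
    have "0 \<le> (norm u)\<^sup>2 - 2 * (u \<bullet> v) + (norm v)\<^sup>2"
      unfolding w2[symmetric] by simp
    with s2 show ?thesis by simp
  qed
  then have "(norm s)\<^sup>2 * (norm w)\<^sup>2 \<le> (1/2) * ((norm u)\<^sup>2 + (norm v)\<^sup>2) * (norm w)\<^sup>2"
    by (rule mult_right_mono) simp
  then have 2: "?t\<^sup>2 \<le> (norm u)\<^sup>2 * (u \<bullet> w) - (norm v)\<^sup>2 * (v \<bullet> w)"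
    unfolding C by (simp add: power_mult_distrib mult.commute add_increasing2)
  \<comment> \<open>Completing the square in the quadratic form of \<open>?a\<close> and
    \<open>?t\<close>, after multiplication by 4 \<mu>. The remaining coefficient is nonnegative
    because 2 \<beta> \<mu> \<ge> 1.\<close>
  have "0 \<le> (2 * \<mu> * ?a - ?t)\<^sup>2 + (4 * \<beta> * \<mu> - 1) * ?t\<^sup>2"
    using assms(3) by (intro add_nonneg_nonneg mult_nonneg_nonneg) auto
  also have "\<dots> = 4 * \<mu> * (\<mu> * ?a\<^sup>2 - ?a * ?t + \<beta> * ?t\<^sup>2)"
    by (simp add: power2_eq_square algebra_simps)
  finally have "0 \<le> \<mu> * ?a\<^sup>2 - ?a * ?t + \<beta> * ?t\<^sup>2"
    using assms(1) by (simp add: zero_le_mult_iff)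
  moreover have "\<beta> * ?t\<^sup>2 \<le> \<beta> * ((norm u)\<^sup>2 * (u \<bullet> w) - (norm v)\<^sup>2 * (v \<bullet> w))"
    using 2 assms(2) by (intro mult_left_mono) auto
  ultimately show ?thesis using 1 by linarith
qed

text \<open>\<open>u\<close> and \<open>v\<close> range over all of \<open>V_space D\<close>; the
  L^4 integrability that splits the integrals of \<open>B_op\<close> and \<open>C_op\<close> is
  supplied by \<open>V_space_V_limit\<close>. After skewness everything is one integral with
  nonnegative integrand.\<close>

lemma G_op_monotone:
  fixes D :: "(real^'n) set"
  assumes dim: "CARD('n) \<le> 4" and D: "open D" "bounded D"
    and \<mu>\<beta>: "0 < \<mu>" "0 < \<beta>" "2 * \<beta> * \<mu> \<ge> 1"
    and uV: "u \<in> V_space D" and vV: "v \<in> V_space D"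
  shows "0 \<le> G_op \<mu> \<beta> D u (u - v) - G_op \<mu> \<beta> D v (u - v)"
proof -
  define Du where "Du = weak_gradient D u"
  define Dv where "Dv = weak_gradient D v"
  have lu: "V_limit D u Du" and lv: "V_limit D v Dv"
    unfolding Du_def Dv_def by (rule V_space_V_limit[OF dim D uV], rule V_space_V_limit[OF dim D vV])
  have u: "u \<in> Lp_space 2 D" "Du \<in> Lp_space 2 D" "is_weak_gradient D u Du" and u4: "u \<in> Lp_space 4 D"
    using lu by (auto simp: V_limit_def)
  have v: "v \<in> Lp_space 2 D" "Dv \<in> Lp_space 2 D" "is_weak_gradient D v Dv" and v4: "v \<in> Lp_space 4 D"
    using lv by (auto simp: V_limit_def)
  \<comment> \<open>Difference and midpoint are spelled as scaled sums to match the linearity lemmas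
    literally.\<close>
  define w where "w = (\<lambda>x. 1 *\<^sub>R u x + (-1) *\<^sub>R v x)"
  define Dw where "Dw = (\<lambda>x. 1 *\<^sub>R Du x + (-1) *\<^sub>R Dv x)"
  define s where "s = (\<lambda>x. (1/2) *\<^sub>R u x + (1/2) *\<^sub>R v x)"
  define Ds where "Ds = (\<lambda>x. (1/2) *\<^sub>R Du x + (1/2) *\<^sub>R Dv x)"
  have lw: "V_limit D w Dw" and ls: "V_limit D s Ds"
    unfolding w_def Dw_def s_def Ds_def by (rule V_limit_lincomb[OF D(1) lu lv])+
  have w4: "w \<in> Lp_space 4 D" and Dw2: "Dw \<in> Lp_space 2 D" and s4: "s \<in> Lp_space 4 D"
    using lw ls by (auto simp: V_limit_def)
  have uvw: "u - v = w" by (auto simp: w_def)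
  have A: "A_op D u w - A_op D v w = (LINT x|lebesgue_on D. (norm (Dw x))\<^sup>2)"
  proof -
    note uu = inner_integrable_L2(1)[OF u(2) u(2)] and uv = inner_integrable_L2(1)[OF u(2) v(2)]
      and vu = inner_integrable_L2(1)[OF v(2) u(2)] and vv = inner_integrable_L2(1)[OF v(2) v(2)]
    have "A_op D u w = 1 * (LINT x|lebesgue_on D. Du x \<bullet> Du x) + (-1) * (LINT x|lebesgue_on D. Du x \<bullet> Dv x)"
      unfolding A_op_def w_def Du_def[symmetric] by (rule integral_inner_weak_gradient_lincomb[OF D u(2) u v])
    moreover have "A_op D v w = 1 * (LINT x|lebesgue_on D. Dv x \<bullet> Du x) + (-1) * (LINT x|lebesgue_on D. Dv x \<bullet> Dv x)"
      unfolding A_op_def w_def Dv_def[symmetric] by (rule integral_inner_weak_gradient_lincomb[OF D v(2) u v])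
    moreover have "(norm (Dw x))\<^sup>2 = (Du x \<bullet> Du x - Du x \<bullet> Dv x) - (Dv x \<bullet> Du x - Dv x \<bullet> Dv x)" for x
      unfolding Dw_def power2_norm_eq_inner by (simp add: inner_diff_left inner_diff_right)
    ultimately show ?thesis using uu uv vu vv by simp
  qed
  \<comment> \<open>Expand by bilinearity: \<open>trilin D Ds w w\<close> is b(w,s,w) and
    \<open>trilin D Dw s w\<close> is b(s,w,w). Their sum is the difference of the two convection
    terms, because the mixed terms cancel for the midpoint.\<close>
  have B: "B_op D u w - B_op D v w = - trilin D Dw w s"
  proof -
    have "trilin D Ds w w = 1/2 * trilin D Du w w + 1/2 * trilin D Dv w w"
      unfolding Ds_def by (rule trilin_lincomb_1[OF u(2) v(2) w4 w4])
    moreover have "trilin D Du w w = 1 * trilin D Du u w + (-1) * trilin D Du v w"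
      by (subst w_def) (rule trilin_lincomb_2[OF u(2) u4 v4 w4])
    moreover have "trilin D Dv w w = 1 * trilin D Dv u w + (-1) * trilin D Dv v w"
      by (subst w_def) (rule trilin_lincomb_2[OF v(2) u4 v4 w4])
    moreover have "trilin D Dw s w = 1 * trilin D Du s w + (-1) * trilin D Dv s w"
      unfolding Dw_def by (rule trilin_lincomb_1[OF u(2) v(2) s4 w4])
    moreover have "trilin D Du s w = 1/2 * trilin D Du u w + 1/2 * trilin D Du v w"
      unfolding s_def by (rule trilin_lincomb_2[OF u(2) u4 v4 w4])
    moreover have "trilin D Dv s w = 1/2 * trilin D Dv u w + 1/2 * trilin D Dv v w"
      unfolding s_def by (rule trilin_lincomb_2[OF v(2) u4 v4 w4])
    moreover have "trilin D Ds w w = - trilin D Dw w s"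
      by (rule V_limit_skew[OF D(1) lw ls lw])
    \<comment> \<open>Skewness with equal last two arguments: the value is its own negative, so
      b(s,w,w) is zero.\<close>
    moreover have "trilin D Dw s w = - trilin D Dw s w"
      by (rule V_limit_skew[OF D(1) ls lw lw])
    ultimately show ?thesis
      unfolding B_op_eq_trilin Du_def[symmetric] Dv_def[symmetric] by linarith
  qed
  have iA: "integrable (lebesgue_on D) (\<lambda>x. (norm (Dw x))\<^sup>2)"
    using Dw2 by (simp add: Lp_space_numeral_iff)
  note iB = trilin_integrable(1)[OF Dw2 w4 s4]
  note iC = C_op_integrable(1)[OF u4 w4] C_op_integrable(1)[OF v4 w4]
  have "G_op \<mu> \<beta> D u w - G_op \<mu> \<beta> D v w
    = \<mu> * (A_op D u w - A_op D v w) + (B_op D u w - B_op D v w) + \<beta> * (C_op D u w - C_op D v w)"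
    by (simp add: G_op_def algebra_simps)
  also have "\<dots> = (LINT x|lebesgue_on D. \<mu> * (norm (Dw x))\<^sup>2 - (Dw x *v w x) \<bullet> s x
      + \<beta> * ((norm (u x))\<^sup>2 * (u x \<bullet> w x) - (norm (v x))\<^sup>2 * (v x \<bullet> w x)))"
    unfolding A B C_op_def trilin_def using iA iB iC by simp
  also have "0 \<le> \<dots>"
  proof (rule Bochner_Integration.integral_nonneg)
    show "0 \<le> \<mu> * (norm (Dw x))\<^sup>2 - (Dw x *v w x) \<bullet> s x
      + \<beta> * ((norm (u x))\<^sup>2 * (u x \<bullet> w x) - (norm (v x))\<^sup>2 * (v x \<bullet> w x))" for x
      using monotone_integrand_nonneg[OF \<mu>\<beta>, of "Dw x" "u x" "v x"] by (simp add: w_def s_def)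
  qed
  finally show ?thesis unfolding uvw .
qed

theorem theorem2p6:
  fixes D :: "(real^'n) set" and \<mu> \<beta> :: real
  assumes "2 \<le> CARD('n)" and "CARD('n) \<le> 4"
    and "open D" and "connected D" and "D \<noteq> {}" and "bounded D" and "C2_boundary D"
    and "\<mu> > 0" and "\<beta> > 0" and "2 * \<beta> * \<mu> \<ge> 1"
  shows "G_op \<mu> \<beta> D \<in> V_space D \<inter> L4_sol D \<rightarrow> V_L4_dual D
    \<and> (\<forall>u\<in>V_space D. \<forall>v\<in>V_space D. (G_op \<mu> \<beta> D u - G_op \<mu> \<beta> D v) (u - v) \<ge> 0)"
  using G_op_in_V_L4_dual[OF assms(3,6,8,9)] G_op_monotone[OF assms(2,3,6,8,9,10)]
  by auto

end
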